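(* Let $w$ be a graphon and $\alpha\in(0,1)$ a constant such that, for some $\epsilon\in(0,1)$ and $A>0$: 1. $w^{(2)}_\alpha$ is diagonally increasing; 2. $w^{(2)}$ is uniformly $(A,\epsilon)$-good at $\alpha$; 3. $w^{(2)}$ is $(\epsilon,\alpha)$-connected; 4. $w^{(2)}_\alpha$ has an $\epsilon$-split; 5. $w^{(2)}_\alpha$ is $\epsilon$-separated. For $n\in\mathbb N$ let $G_n\sim w$ be a random graph of size $n$. Run the Main Estimation Algorithm (described in the context) on input $G_n$ with truncation level $\alpha$ and parameters $m=\log(n)^5$, $t=(n\log n)^2$, $\zeta=4\log(n)^4$. Then the output is an ordering $\sigma$ of $\{1,\dots,n\}$ with error $\mathfrak D$ satisfying $\mathfrak D\le\sqrt n\,\log(n)^5$ with extreme probability.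
   Context: **Graphons and samples.** A graphon is a symmetric measurable function $w:[0,1]^2\to[0,1]$. It is diagonally increasing if $w(x,y)\le w(z,y)$ and $w(x,z)\ge w(x,y)$ for all $x<z<y$. A random graph $G_n\sim w$ on $V=\{1,\dots,n\}$ is obtained from independent $\mathrm{Unif}[0,1]$ variables $(U_i)_{1\le i\le n}$, $(U_{i,j})_{1\le i<j\le n}$ by declaring $\{i,j\}$ an edge iff $U_{i,j}<w(U_i,U_j)$. Write $w^{(2)}(x,y)=\int_0^1w(x,u)w(u,y)\,du$, and $w^{(2)}_\alpha(x,y)=1$ if $w^{(2)}(x,y)>\alpha$, $0$ otherwise. **Properties of graphons.** ($\mathrm{Vol}$ is Lebesgue measure.) - $v$ is uniformly $(A,\delta)$-good at $\alpha$ if $\sup_{x\in[0,1]}\mathrm{Vol}(\{y\in[0,1]:|\alpha-v(x,y)|\le\delta'\})\le A\delta'$ for all $0<\delta'<\delta$. - $v$ is $(\epsilon,\alpha)$-connected if $\inf\{v(x,y):x,y\in[0,1],|x-y|\le\epsilon\}>\alpha$. - A $\{0,1\}$-valued $v$ is $\epsilon$-separated if $\mathrm{Vol}(\{z:|v(x,z)-v(y,z)|=1\})\ge\epsilon|x-y|$ for all $x,y$. - A $\{0,1\}$-valued $v$ has an $\epsilon$-split if $\{z\in[0,1]:v(x,z)=v(y,z)=1\}=\emptyset$ for all $x,y$ with $x\le y-(1-\epsilon)$. **With extreme probability (w.e.p.).** Events $\mathcal A^{(n)}$ hold w.e.p. if there are $c_1,c_2>0$ and $N_0$ with $\mathbb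 P[\mathcal A^{(n)}]\ge 1-n^{-c_1\log(n)^{c_2}}$ for all $n>N_0$. Probability is over $G_n$ and the internal randomness of the algorithm. **Error.** Let $\sigma_{\mathrm{true}}(i)=|\{j:U_j\le U_i\}|$ and let $\sigma_{\mathrm{eurt}}=n+1-\sigma_{\mathrm{true}}$ be its reverse; these two are the correct permutations. A permutation $\sigma$ has error less than $\mathfrak D$ if there is a correct permutation $\sigma_{\mathrm{correct}}$ such that $\sigma(i)>\sigma(j)$ for all $i,j$ with $\sigma_{\mathrm{correct}}(i)>\sigma_{\mathrm{correct}}(j)+\mathfrak D$. The conclusion says that $\sigma$ has error less than $\sqrt n\log(n)^5$ in this sense. **Comparisons.** Let $\tilde V=\{(u,v)\in V^2:u<v\}$. A function $F:\tilde V\to\{-1,0,1\}$ is extended antisymmetrically to $V^2$; $F(u,v)=1$ is read "$u$ before $v$". Put $\gamma_F(i)=\sum_{j\in V}F(j,i)$ and $\sigma_F(i)=|\{j\in V:\gamma_F(j)\le\gamma_F(i)\}|$, ties in $\gamma_F$ broken arbitrarily so that $\sigma_F$ is a permutation. **Unit interval graphs.** An interval order of a graph $H$ on a vertex set $S$ is a bijection $\sigma:S\to\{1,\dots,|S|\}$ such that whenever $\sigma(u)<\sigma(v)<\sigma(x)$ and $u,x$ are adjacent, $u,v$ are adjacent and $v,x$ are adjacent. A unit interval graph is a graph having an interval order. **Main Estimation Algorithm** (sample size $m$, running time $t$, threshold $\zeta$, truncation level $\alpha$; real parameters rounded to integers where needed). Input: graph $G=(V,E)$, $|V|=n$. 1.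 *Square-threshold.* Let $H$ be the graph on $V$ in which $u\ne v$ are adjacent iff the number of common neighbours of $u,v$ in $G$ is greater than $\alpha(n-2)$. 2. *SparseSketch.* (a) Repeatedly draw independent uniformly random $S\subset V$ with $|S|=m$; a draw succeeds if the induced subgraph $H(S)$ is a connected unit interval graph, in which case an interval order $\sigma$ of $H(S)$ is recorded (computed by the 3-sweep LexBFS algorithm); continue until $t$ successes $(\sigma^{(1)},S^{(1)}),\dots,(\sigma^{(t)},S^{(t)})$ are recorded. (b) *GlobalOrder:* let $\mathcal L^{(j)}=\{u\in S^{(j)}:\sigma^{(j)}(u)<\zeta\}$, $\mathcal R^{(j)}=\{u\in S^{(j)}:\sigma^{(j)}(u)>m-\zeta\}$. Set $h(j,k)=1$ if $(\mathcal L^{(j)}\cap\mathcal L^{(k)})\cup(\mathcal R^{(j)}\cap\mathcal R^{(k)})\neq\emptyset$; otherwise $h(j,k)=-1$ if $(\mathcal L^{(j)}\cap\mathcal R^{(k)})\cup(\mathcal R^{(j)}\cap\mathcal L^{(k)})\ne\emptyset$; otherwise $h(j,k)=0$. Find $a:\{1,\dots,t\}\to\{-1,1\}$ with $h(j,k)=a(j)a(k)$ whenever $h(j,k)\neq0$ (if none exists the output is arbitrary). For each $j$ with $a(j)=-1$ replace $\sigma^{(j)}$ by $m+1-\sigma^{(j)}$. (c) For $(u,v)\in\tilde V$ let $\mathcal C(u,v)$ be the number of $j$ with $u,v\in S^{(j)}$, $\sigma^{(j)}(u)<\sigma^{(j)}(v)$, minus the number of $j$ with $u,v\in S^{(j)}$,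 $\sigma^{(j)}(u)>\sigma^{(j)}(v)$. Let $F(u,v)=\operatorname{sign}\mathcal C(u,v)$. 3. *LocalRefinement.* Let $N(u)$ be the neighbourhood of $u$ in $H$. For $(u,v)\in\tilde V$ let $D_{u,v}=|\{x\in N(u)\setminus N(v):F(x,v)=1\}|-|\{x\in N(u)\setminus N(v):F(x,v)=-1\}|$ and $D_{v,u}=|\{x\in N(v)\setminus N(u):F(x,u)=1\}|-|\{x\in N(v)\setminus N(u):F(x,u)=-1\}|$. If $|D_{u,v}|>|D_{v,u}|$ set $F'(u,v)=1$ if $D_{u,v}>0$ and $-1$ if $D_{u,v}\le0$. Otherwise set $F'(u,v)=1$ if $D_{v,u}<0$ and $-1$ if $D_{v,u}\ge0$. 4. Return $\sigma_{F'}$. *)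

theory Defs
  imports "HOL-Probability.Probability"
begin

section \<open>Graphons\<close>

abbreviation unif01 :: "real measure" where
  "unif01 \<equiv> restrict_space lborel {0..1}"

text \<open>A graphon is a function on \<open>[0,1]\<^sup>2\<close>; values outside the square are never used. Measurable
  means Borel measurable, so that every section is measurable and the integral \<open>square w x y\<close>
  exists for every (not merely almost every) pair of points.\<close>

definition graphon :: "(real \<Rightarrow> real \<Rightarrow> real) \<Rightarrow> bool" where
  "graphon w \<longleftrightarrow>
     (\<lambda>(x, y). w x y) \<in> borel_measurable (unif01 \<Otimes>\<^sub>M unif01) \<and>
     (\<forall>x\<in>{0..1}. \<forall>y\<in>{0..1}. w x y = w y x \<and> 0 \<le> w x y \<and> w x y \<le> 1)"

definition square :: "(real \<Rightarrow> real \<Rightarrow> real) \<Rightarrow> real \<Rightarrow> real \<Rightarrow> real" where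
  "square w x y = (\<integral>u. w x u * w u y \<partial>unif01)"

definition thresholded_square :: "(real \<Rightarrow> real \<Rightarrow> real) \<Rightarrow> real \<Rightarrow> real \<Rightarrow> real \<Rightarrow> real" where
  "thresholded_square w \<alpha> x y = (if square w x y > \<alpha> then 1 else 0)"

definition diagonally_increasing :: "(real \<Rightarrow> real \<Rightarrow> real) \<Rightarrow> bool" where
  "diagonally_increasing v \<longleftrightarrow>
     (\<forall>x\<in>{0..1}. \<forall>y\<in>{0..1}. \<forall>z\<in>{0..1}. x < z \<and> z < y \<longrightarrow> v x y \<le> v z y \<and> v x z \<ge> v x y)"

definition uniformly_good :: "real \<Rightarrow> real \<Rightarrow> real \<Rightarrow> (real \<Rightarrow> real \<Rightarrow> real) \<Rightarrow> bool" where
  "uniformly_good A \<delta> \<alpha> v \<longleftrightarrow>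
     (\<forall>\<delta>'. 0 < \<delta>' \<and> \<delta>' < \<delta> \<longrightarrow>
        (SUP x\<in>{0..1}. measure lborel {y\<in>{0..1}. \<bar>\<alpha> - v x y\<bar> \<le> \<delta>'}) \<le> A * \<delta>')"

definition connected_at :: "real \<Rightarrow> real \<Rightarrow> (real \<Rightarrow> real \<Rightarrow> real) \<Rightarrow> bool" where
  "connected_at \<epsilon> \<alpha> v \<longleftrightarrow>
     Inf {v x y | x y. x \<in> {0..1} \<and> y \<in> {0..1} \<and> \<bar>x - y\<bar> \<le> \<epsilon>} > \<alpha>"

definition separated :: "real \<Rightarrow> (real \<Rightarrow> real \<Rightarrow> real) \<Rightarrow> bool" where
  "separated \<epsilon> v \<longleftrightarrow>
     (\<forall>x\<in>{0..1}. \<forall>y\<in>{0..1}.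
        measure lborel {z\<in>{0..1}. \<bar>v x z - v y z\<bar> = 1} \<ge> \<epsilon> * \<bar>x - y\<bar>)"

definition has_split :: "real \<Rightarrow> (real \<Rightarrow> real \<Rightarrow> real) \<Rightarrow> bool" where
  "has_split \<epsilon> v \<longleftrightarrow>
     (\<forall>x\<in>{0..1}. \<forall>y\<in>{0..1}. x \<le> y - (1 - \<epsilon>) \<longrightarrow> {z\<in>{0..1}. v x z = 1 \<and> v y z = 1} = {})"

section \<open>Graphs\<close>

text \<open>A graph on a given vertex set is represented by its set of edges, each edge being a set of two
  distinct vertices.\<close>

type_synonym graph = "nat set set"

definition graphon_graph ::
  "(real \<Rightarrow> real \<Rightarrow> real) \<Rightarrow> nat \<Rightarrow> (nat \<Rightarrow> real) \<Rightarrow> (nat \<times> nat \<Rightarrow> real) \<Rightarrow> graph" where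
  "graphon_graph w n U U' = {{i, j} | i j. 1 \<le> i \<and> i < j \<and> j \<le> n \<and> U' (i, j) < w (U i) (U j)}"

definition induced_connected :: "graph \<Rightarrow> nat set \<Rightarrow> bool" where
  "induced_connected H S \<longleftrightarrow>
     (\<forall>u\<in>S. \<forall>v\<in>S. (u, v) \<in> {(x, y). x \<in> S \<and> y \<in> S \<and> {x, y} \<in> H}\<^sup>*)"

definition interval_order :: "graph \<Rightarrow> nat set \<Rightarrow> (nat \<Rightarrow> nat) \<Rightarrow> bool" where
  "interval_order H S \<sigma> \<longleftrightarrow>
     bij_betw \<sigma> S {1..card S} \<and>
     (\<forall>u\<in>S. \<forall>v\<in>S. \<forall>x\<in>S. \<sigma> u < \<sigma> v \<and> \<sigma> v < \<sigma> x \<and> {u, x} \<in> H \<longrightarrow> {u, v} \<in> H \<and> {v, x} \<in> H)"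

definition unit_interval_graph :: "graph \<Rightarrow> nat set \<Rightarrow> bool" where
  "unit_interval_graph H S \<longleftrightarrow> (\<exists>\<sigma>. interval_order H S \<sigma>)"

definition square_threshold :: "nat \<Rightarrow> real \<Rightarrow> graph \<Rightarrow> graph" where
  "square_threshold n \<alpha> E =
     {{u, v} | u v. u \<in> {1..n} \<and> v \<in> {1..n} \<and> u \<noteq> v \<and>
        real (card {x\<in>{1..n}. {u, x} \<in> E \<and> {v, x} \<in> E}) > \<alpha> * (real n - 2)}"

definition nbhd :: "graph \<Rightarrow> nat \<Rightarrow> nat set" where
  "nbhd H u = {x. {u, x} \<in> H}"

section \<open>Comparisons\<close>

definition antisym_ext :: "(nat \<Rightarrow> nat \<Rightarrow> int) \<Rightarrow> nat \<Rightarrow> nat \<Rightarrow> int" where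
  "antisym_ext F u v = (if u < v then F u v else if v < u then - F v u else 0)"

text \<open>The permutations \<open>\<sigma>\<close> obtained by ranking the vertices by \<open>\<gamma>\<^sub>F\<close>, over all ways of breaking ties:
  without ties \<open>\<sigma> i\<close> is the number of \<open>j\<close> with \<open>\<gamma>\<^sub>F j \<le> \<gamma>\<^sub>F i\<close>.\<close>

definition ranking :: "nat \<Rightarrow> (nat \<Rightarrow> nat \<Rightarrow> int) \<Rightarrow> (nat \<Rightarrow> nat) \<Rightarrow> bool" where
  "ranking n F \<sigma> \<longleftrightarrow>
     bij_betw \<sigma> {1..n} {1..n} \<and>
     (\<forall>i\<in>{1..n}. \<forall>j\<in>{1..n}. (\<Sum>k\<in>{1..n}. F k i) < (\<Sum>k\<in>{1..n}. F k j) \<longrightarrow> \<sigma> i < \<sigma> j)"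

section \<open>The Main Estimation Algorithm\<close>

text \<open>A sketch is a recorded pair \<open>(\<sigma>, S)\<close>. Given the infinite sequence \<open>d\<close> of draws,
  \<open>sketching H t d Q\<close> says that the first \<open>t\<close> successful draws exist and that \<open>Q\<close> is a possible record
  of them. If there are fewer than \<open>t\<close> successes, the loop does not terminate and there is no such \<open>Q\<close>.
  All interval orders are allowed, in particular those which 3-sweep LexBFS computes.\<close>

type_synonym sketch = "(nat \<Rightarrow> nat) \<times> nat set"

definition sketching :: "graph \<Rightarrow> nat \<Rightarrow> (nat \<Rightarrow> nat set) \<Rightarrow> sketch list \<Rightarrow> bool" where
  "sketching H t d Q \<longleftrightarrow>
     (\<exists>N. map snd Q =
            filter (\<lambda>S. induced_connected H S \<and> unit_interval_graph H S) (map d [0..<N])) \<and>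
     length Q = t \<and>
     (\<forall>(\<sigma>, S)\<in>set Q. interval_order H S \<sigma>)"

definition left_end :: "real \<Rightarrow> sketch \<Rightarrow> nat set" where
  "left_end \<zeta> = (\<lambda>(\<sigma>, S). {u\<in>S. real (\<sigma> u) < \<zeta>})"

definition right_end :: "nat \<Rightarrow> real \<Rightarrow> sketch \<Rightarrow> nat set" where
  "right_end m \<zeta> = (\<lambda>(\<sigma>, S). {u\<in>S. real (\<sigma> u) > real m - \<zeta>})"

definition orientation :: "nat \<Rightarrow> real \<Rightarrow> sketch \<Rightarrow> sketch \<Rightarrow> int" where
  "orientation m \<zeta> p q =
     (if (left_end \<zeta> p \<inter> left_end \<zeta> q) \<union> (right_end m \<zeta> p \<inter> right_end m \<zeta> q) \<noteq> {} then 1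
      else if (left_end \<zeta> p \<inter> right_end m \<zeta> q) \<union> (right_end m \<zeta> p \<inter> left_end \<zeta> q) \<noteq> {} then -1
      else 0)"

definition consistent_signs :: "nat \<Rightarrow> real \<Rightarrow> sketch list \<Rightarrow> (nat \<Rightarrow> int) \<Rightarrow> bool" where
  "consistent_signs m \<zeta> Q a \<longleftrightarrow>
     (\<forall>j<length Q. a j \<in> {-1, 1}) \<and>
     (\<forall>j<length Q. \<forall>k<length Q.
        orientation m \<zeta> (Q ! j) (Q ! k) \<noteq> 0 \<longrightarrow> orientation m \<zeta> (Q ! j) (Q ! k) = a j * a k)"

definition oriented_order :: "nat \<Rightarrow> sketch list \<Rightarrow> (nat \<Rightarrow> int) \<Rightarrow> nat \<Rightarrow> nat \<Rightarrow> nat" where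
  "oriented_order m Q a j u = (if a j = -1 then m + 1 - fst (Q ! j) u else fst (Q ! j) u)"

definition sketch_count :: "nat \<Rightarrow> sketch list \<Rightarrow> (nat \<Rightarrow> int) \<Rightarrow> nat \<Rightarrow> nat \<Rightarrow> int" where
  "sketch_count m Q a u v =
     int (card {j. j < length Q \<and> u \<in> snd (Q ! j) \<and> v \<in> snd (Q ! j) \<and>
                   oriented_order m Q a j u < oriented_order m Q a j v}) -
     int (card {j. j < length Q \<and> u \<in> snd (Q ! j) \<and> v \<in> snd (Q ! j) \<and>
                   oriented_order m Q a j u > oriented_order m Q a j v})"

definition sketch_comparison :: "nat \<Rightarrow> sketch list \<Rightarrow> (nat \<Rightarrow> int) \<Rightarrow> nat \<Rightarrow> nat \<Rightarrow> int" where
  "sketch_comparison m Q a = antisym_ext (\<lambda>u v. sgn (sketch_count m Q a u v))"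

definition side_count :: "graph \<Rightarrow> (nat \<Rightarrow> nat \<Rightarrow> int) \<Rightarrow> nat \<Rightarrow> nat \<Rightarrow> int" where
  "side_count H F u v =
     int (card {x \<in> nbhd H u - nbhd H v. F x v = 1}) -
     int (card {x \<in> nbhd H u - nbhd H v. F x v = -1})"

definition local_refinement :: "graph \<Rightarrow> (nat \<Rightarrow> nat \<Rightarrow> int) \<Rightarrow> nat \<Rightarrow> nat \<Rightarrow> int" where
  "local_refinement H F = antisym_ext (\<lambda>u v.
     if \<bar>side_count H F u v\<bar> > \<bar>side_count H F v u\<bar>
     then (if side_count H F u v > 0 then 1 else -1)
     else (if side_count H F v u < 0 then 1 else -1))"

text \<open>\<open>estimation_output n \<alpha> m t \<zeta> E d \<sigma>\<close>: on the graph \<open>E\<close> with vertex set \<open>{1..n}\<close> and with random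
  draws \<open>d\<close>, the algorithm may return \<open>\<sigma>\<close> for some resolution of the choices it leaves open (interval
  orders, signs \<open>a\<close>, ties). If no consistent signs exist, any \<open>\<sigma>\<close> may be returned.\<close>

definition estimation_output ::
  "nat \<Rightarrow> real \<Rightarrow> nat \<Rightarrow> nat \<Rightarrow> real \<Rightarrow> graph \<Rightarrow> (nat \<Rightarrow> nat set) \<Rightarrow> (nat \<Rightarrow> nat) \<Rightarrow> bool" where
  "estimation_output n \<alpha> m t \<zeta> E d \<sigma> \<longleftrightarrow>
     (let H = square_threshold n \<alpha> E in
      \<exists>Q. sketching H t d Q \<and>
          ((\<nexists>a. consistent_signs m \<zeta> Q a) \<or>
           (\<exists>a. consistent_signs m \<zeta> Q a \<and>
                ranking n (local_refinement H (sketch_comparison m Q a)) \<sigma>)))"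

section \<open>Error and probability\<close>

definition true_order :: "nat \<Rightarrow> (nat \<Rightarrow> real) \<Rightarrow> nat \<Rightarrow> nat" where
  "true_order n U i = card {j\<in>{1..n}. U j \<le> U i}"

definition reverse_order :: "nat \<Rightarrow> (nat \<Rightarrow> real) \<Rightarrow> nat \<Rightarrow> nat" where
  "reverse_order n U i = n + 1 - true_order n U i"

definition error_less :: "nat \<Rightarrow> (nat \<Rightarrow> real) \<Rightarrow> real \<Rightarrow> (nat \<Rightarrow> nat) \<Rightarrow> bool" where
  "error_less n U \<DD> \<sigma> \<longleftrightarrow>
     (\<exists>\<tau>\<in>{true_order n U, reverse_order n U}.
        \<forall>i\<in>{1..n}. \<forall>j\<in>{1..n}. real (\<tau> i) > real (\<tau> j) + \<DD> \<longrightarrow> \<sigma> i > \<sigma> j)"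

text \<open>The components are the variables \<open>U\<^sub>i\<close>, the variables \<open>U\<^sub>i\<^sub>j\<close> for \<open>i < j\<close>, and the draws of the
  algorithm, all independent.\<close>

definition sample_space ::
  "nat \<Rightarrow> nat \<Rightarrow> ((nat \<Rightarrow> real) \<times> (nat \<times> nat \<Rightarrow> real) \<times> (nat \<Rightarrow> nat set)) measure" where
  "sample_space n m =
     (\<Pi>\<^sub>M i\<in>{1..n}. unif01) \<Otimes>\<^sub>M
     (\<Pi>\<^sub>M p\<in>{(i, j). 1 \<le> i \<and> i < j \<and> j \<le> n}. unif01) \<Otimes>\<^sub>M
     (\<Pi>\<^sub>M k\<in>UNIV. measure_pmf (pmf_of_set {S. S \<subseteq> {1..n} \<and> card S = m}))"

definition with_extreme_probability ::
  "(nat \<Rightarrow> 'a measure) \<Rightarrow> (nat \<Rightarrow> 'a \<Rightarrow> bool) \<Rightarrow> bool" where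
  "with_extreme_probability M P \<longleftrightarrow>
     (\<exists>c1>0. \<exists>c2>0. \<exists>N0. \<forall>n>N0.
        measure (M n) {\<omega> \<in> space (M n). P n \<omega>} \<ge> 1 - real n powr (- c1 * ln (real n) powr c2))"

definition sample_size :: "nat \<Rightarrow> nat" where
  "sample_size n = nat (round (ln (real n) ^ 5))"

definition running_time :: "nat \<Rightarrow> nat" where
  "running_time n = nat (round ((real n * ln (real n)) ^ 2))"

end

theory Submission
  imports Defs "HOL-Real_Asymp.Real_Asymp"
begin

text \<open>Let \<open>R x y\<close> mean \<open>\<alpha> < square w x y\<close>. By Hoeffding's inequality the numbers of common neighbours
  concentrate, so the thresholded graph \<open>H\<close> agrees with \<open>R\<close> except for pairs whose square value is
  within \<open>O(ln n / sqrt n)\<close> of \<open>\<alpha>\<close>, and uniform goodness bounds the number of such pairs at each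
  vertex by \<open>O(sqrt n * ln n)\<close>. A random sample meets only few of them, and then an interval order of
  the sample orders all points at distance at least \<open>1 / (ln n)\<^sup>2\<close> correctly up to a global reversal:
  separation yields a neighbour of just one of two such points, which reduces their comparison to
  that of a non-adjacent pair, and all non-adjacent pairs are oriented in the same way. Hence the
  ends of the sketches determine the signs up to a global sign, and the comparison \<open>F\<close> is correct
  for distant, correctly classified pairs. In the local refinement, the vertices adjacent to only one of \<open>u\<close>
  and \<open>v\<close> are at distance at least \<open>\<epsilon>\<close> from the other one, so \<open>F\<close> tells on which side they lie; by
  separation their number exceeds the number of misclassified pairs as soon as \<open>u\<close> and \<open>v\<close> are
  at distance \<open>C * ln n / sqrt n\<close> for a suitable constant \<open>C\<close>. So the refined comparison is wrong for \<open>O(sqrt n * ln n)\<close> pairs at each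
  vertex only.\<close>

section \<open>Interval orders of approximately known graphs\<close>

text \<open>The obstacle is the number of draws. One sample of polylogarithmic size is most likely
  free of misclassified pairs, but the loop inspects polynomially many samples, so they cannot all
  be expected to be clean. What can be had for all draws at once is weaker: every vertex has at most
  \<open>k = L^2\<close> misclassified partners in the sample, with \<open>L = ln n\<close>, while
  every cell and every set of separators of a distant pair is met more than \<open>4 * k\<close>
  times. Intermediate vertices with correct classifications can then be picked by counting. Clean
  samples serve only to show that successes occur and that every correctly classified pair lies in a
  successful draw. The algorithm leaves interval orders, signs and ties open, so the structural
  lemmas speak of every admissible choice, and a sign \<open>c\<close> carries along the reversal
  that cannot be detected. Structure and randomness are kept apart: the combinatorial locales are
  deterministic, and probability only verifies their hypotheses, separately for positions, edges and
  draws.\<close>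

lemma sorting_exists:
  fixes S :: "'a::linorder set" and f :: "'a \<Rightarrow> 'b::linorder"
  assumes "finite S"
  shows "\<exists>\<sigma>. bij_betw \<sigma> S {1..card S} \<and> (\<forall>u\<in>S. \<forall>v\<in>S. \<sigma> u < \<sigma> v \<longrightarrow> f u \<le> f v)"
proof -
  define xs where "xs = sort_key f (sorted_list_of_set S)"
  have xs: "distinct xs" "set xs = S" "length xs = card S" "sorted (map f xs)"
    using assms by (auto simp: xs_def)
  define pos where "pos = the_inv_into {..<card S} ((!) xs)"
  have bij: "bij_betw ((!) xs) {..<card S} S"
    by (rule bij_betw_nth) (simp_all add: xs)
  have pos: "bij_betw pos S {..<card S}"
    unfolding pos_def by (rule bij_betw_the_inv_into[OF bij])
  have xs_pos: "xs ! pos i = i" if "i \<in> S" for i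
    using f_the_inv_into_f_bij_betw[OF bij, of i] that by (simp add: pos_def)
  have pos_less: "pos i < card S" if "i \<in> S" for i
    using pos that by (auto dest: bij_betwE)
  have "bij_betw Suc {..<card S} {1..card S}"
    by (auto simp: bij_betw_def lessThan_atLeast0 image_Suc_atLeastLessThan atLeastLessThanSuc_atLeastAtMost)
  with pos have "bij_betw (Suc \<circ> pos) S {1..card S}"
    by (rule bij_betw_trans)
  moreover have "f u \<le> f v"
    if "u \<in> S" "v \<in> S" "(Suc \<circ> pos) u < (Suc \<circ> pos) v" for u v
    using sorted_nth_mono[OF xs(4), of "pos u" "pos v"] xs(3) xs_pos pos_less that by simp
  ultimately show ?thesis by blast
qed

lemma ranking_exists: "\<exists>\<sigma>. ranking n F \<sigma>"
proof -
  define \<gamma> where "\<gamma> i = (\<Sum>k\<in>{1..n}. F k i)" for i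
  obtain \<sigma> where \<sigma>: "bij_betw \<sigma> {1..n} {1..n}"
    "\<And>i j. i \<in> {1..n} \<Longrightarrow> j \<in> {1..n} \<Longrightarrow> \<sigma> i < \<sigma> j \<Longrightarrow> \<gamma> i \<le> \<gamma> j"
    using sorting_exists[of "{1..n}" \<gamma>] by auto
  have "\<sigma> i < \<sigma> j" if "i \<in> {1..n}" "j \<in> {1..n}" "\<gamma> i < \<gamma> j" for i j
  proof -
    have "\<sigma> i \<noteq> \<sigma> j" using \<sigma>(1) that by (auto simp: bij_betw_def dest: inj_onD)
    then show ?thesis using \<sigma>(2)[of j i] that by (meson linorder_neqE_nat not_le)
  qed
  then show ?thesis using \<sigma>(1) unfolding ranking_def \<gamma>_def by blast
qed

text \<open>Otherwise \<open>u\<close> would lie strictly between the ends of the edge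
  \<open>{v, z}\<close> in the order, and the interval property would make it adjacent to
  \<open>z\<close>.\<close>

lemma interval_order_same_side:
  assumes "interval_order H S \<sigma>" "u \<in> S" "v \<in> S" "z \<in> S" "{v, z} \<in> H" "{u, z} \<notin> H" "u \<noteq> z"
  shows "\<sigma> u < \<sigma> v \<longleftrightarrow> \<sigma> u < \<sigma> z"
proof -
  have inj: "inj_on \<sigma> S" using assms(1) by (auto simp: interval_order_def bij_betw_def)
  have 1: "{u, v} \<in> H \<and> {v, x} \<in> H"
    if "u \<in> S" "v \<in> S" "x \<in> S" "\<sigma> u < \<sigma> v" "\<sigma> v < \<sigma> x" "{u, x} \<in> H" for u v x
    using assms(1) that unfolding interval_order_def by blast
  have "u \<noteq> v" using assms by auto
  then have ne: "\<sigma> u \<noteq> \<sigma> v" "\<sigma> u \<noteq> \<sigma> z" using inj assms by (auto dest: inj_onD)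
  show ?thesis
  proof
    assume "\<sigma> u < \<sigma> v"
    show "\<sigma> u < \<sigma> z"
    proof (rule ccontr)
      assume "\<not> ?thesis"
      then have "\<sigma> z < \<sigma> u" using ne by simp
      from 1[OF assms(4) assms(2) assms(3) this \<open>\<sigma> u < \<sigma> v\<close>] assms show False
        by (simp add: insert_commute)
    qed
  next
    assume "\<sigma> u < \<sigma> z"
    show "\<sigma> u < \<sigma> v"
    proof (rule ccontr)
      assume "\<not> ?thesis"
      then have "\<sigma> v < \<sigma> u" using ne by simp
      from 1[OF assms(3) assms(2) assms(4) this \<open>\<sigma> u < \<sigma> z\<close>] assms show False
        by (simp add: insert_commute)
    qed
  qed
qed

text \<open>All that the combinatorial part knows about the thresholded square. Reflexivity is
  contained in \<open>R_near\<close>, so the strict monotonicity laws extend to coinciding points;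
  \<open>R_split\<close> makes the two ends of the unit interval unrelated.\<close>

locale diagonal_relation =
  fixes R :: "real \<Rightarrow> real \<Rightarrow> bool" and \<epsilon> :: real
  assumes \<epsilon>: "0 < \<epsilon>" "\<epsilon> < 1"
    and R_sym: "x \<in> {0..1} \<Longrightarrow> y \<in> {0..1} \<Longrightarrow> R x y \<longleftrightarrow> R y x"
    and R_left_strict: "x \<in> {0..1} \<Longrightarrow> y \<in> {0..1} \<Longrightarrow> x < z \<Longrightarrow> z < y \<Longrightarrow> R x y \<Longrightarrow> R x z"
    and R_right_strict: "x \<in> {0..1} \<Longrightarrow> y \<in> {0..1} \<Longrightarrow> x < z \<Longrightarrow> z < y \<Longrightarrow> R x y \<Longrightarrow> R z y"
    and R_near: "x \<in> {0..1} \<Longrightarrow> y \<in> {0..1} \<Longrightarrow> \<bar>x - y\<bar> \<le> \<epsilon> \<Longrightarrow> R x y"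
    and R_split: "x \<in> {0..1} \<Longrightarrow> y \<in> {0..1} \<Longrightarrow> x \<le> y - (1 - \<epsilon>) \<Longrightarrow> \<not> R x y"
begin

lemma R_left:
  assumes "x \<in> {0..1}" "y \<in> {0..1}" "x \<le> z" "z \<le> y" "R x y"
  shows "R x z"
  using assms R_left_strict[of x y z] R_near[of x x] \<epsilon> by (cases "x = z"; cases "z = y") auto

lemma R_right:
  assumes "x \<in> {0..1}" "y \<in> {0..1}" "x \<le> z" "z \<le> y" "R x y"
  shows "R z y"
  using assms R_right_strict[of x y z] R_near[of y y] \<epsilon> by (cases "x = z"; cases "z = y") auto

end

locale approximated_graph = diagonal_relation +
  fixes n :: nat and U :: "nat \<Rightarrow> real" and H :: graph
  assumes U01: "u \<in> {1..n} \<Longrightarrow> U u \<in> {0..1}"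
    and H_edge: "{u, v} \<in> H \<Longrightarrow> u \<noteq> v \<and> u \<in> {1..n} \<and> v \<in> {1..n}"
begin

text \<open>The misclassified neighbours of \<open>u\<close>; \<open>u\<close> itself is included so that avoiding \<open>amb u\<close> also
  avoids \<open>u\<close>.\<close>

definition amb :: "nat \<Rightarrow> nat set" where
  "amb u = {v\<in>{1..n}. v = u \<or> ({u, v} \<in> H) \<noteq> R (U u) (U v)}"

definition separators :: "nat \<Rightarrow> nat \<Rightarrow> nat set" where
  "separators u v = {x\<in>{1..n}. R (U u) (U x) \<noteq> R (U v) (U x)}"

text \<open>The cells are closed, so that the last one contains 1. A vertex on a common end point
  belongs to two cells, which is harmless.\<close>

definition cell :: "nat \<Rightarrow> nat \<Rightarrow> nat set" where
  "cell K i = {u\<in>{1..n}. real i / real K \<le> U u \<and> U u \<le> real (Suc i) / real K}"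

lemma finite_amb [simp]: "finite (amb u)"
  and finite_separators [simp]: "finite (separators u v)"
  and finite_cell [simp]: "finite (cell K i)"
  by (auto simp: amb_def separators_def cell_def)

end

context approximated_graph
begin

lemma amb_sym: "u \<in> {1..n} \<Longrightarrow> v \<in> {1..n} \<Longrightarrow> v \<in> amb u \<longleftrightarrow> u \<in> amb v"
  using R_sym[OF U01 U01, of u v] by (auto simp: amb_def insert_commute)

lemma edge_iff: "u \<in> {1..n} \<Longrightarrow> v \<in> {1..n} \<Longrightarrow> v \<notin> amb u \<Longrightarrow> {u, v} \<in> H \<longleftrightarrow> R (U u) (U v)"
  by (auto simp: amb_def)

lemma self_amb: "u \<in> {1..n} \<Longrightarrow> u \<in> amb u"
  by (simp add: amb_def)

lemma in_some_cell:
  assumes "u \<in> {1..n}" "0 < K"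
  shows "\<exists>i<K. u \<in> cell K i"
\<comment> \<open>At 1 the floor formula would give the index \<open>K\<close>, one too
  many.\<close>
proof (cases "U u = 1")
  case True
  then have "u \<in> cell K (K - 1)" using assms by (auto simp: cell_def field_simps)
  then show ?thesis using assms by (intro exI[of _ "K - 1"]) auto
next
  case False
  with U01[OF assms(1)] have U: "0 \<le> U u" "U u < 1" by auto
  define i where "i = nat \<lfloor>U u * real K\<rfloor>"
  have i: "real i \<le> U u * real K" "U u * real K < real i + 1"
    using U by (auto simp: i_def of_nat_nat)
  have "U u * real K < real K" using U assms by simp
  with i have "i < K" by linarith
  moreover have "u \<in> cell K i" using i assms by (auto simp: cell_def field_simps)
  ultimately show ?thesis by blast
qed

lemma adjacent_cells:
  assumes "u \<in> cell K i" "v \<in> cell K j" "i \<le> j" "j \<le> Suc i" "0 < K" "2 / real K \<le> \<epsilon>"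
  shows "R (U u) (U v)"
proof -
  have "real j \<le> real i + 1" "real i \<le> real j" using assms by auto
  then have "real j / real K \<le> (real i + 1) / real K" "real i / real K \<le> real j / real K"
    using assms(5) by (auto intro!: divide_right_mono)
  moreover have "real i / real K \<le> U u" "U u \<le> (real i + 1) / real K"
    "real j / real K \<le> U v" "U v \<le> (real j + 1) / real K"
    using assms by (auto simp: cell_def add.commute)
  ultimately have "\<bar>U u - U v\<bar> \<le> 2 / real K"
    using assms(5) by (auto simp: abs_le_iff field_simps)
  then show ?thesis using assms by (intro R_near U01) (auto simp: cell_def)
qed

lemma last_cell: "u \<in> cell K (K - 1) \<Longrightarrow> 0 < K \<Longrightarrow> 1 - 1 / real K \<le> U u"
  and first_cell: "u \<in> cell K 0 \<Longrightarrow> U u \<le> 1 / real K"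
  by (auto simp: cell_def field_simps)

text \<open>\<open>g\<close> is the distance from which on every interval order of the sample is reliable. The sample may
  well contain misclassified pairs: among polynomially many samples, some do.\<close>

definition good_sample :: "nat \<Rightarrow> nat \<Rightarrow> real \<Rightarrow> real \<Rightarrow> real \<Rightarrow> nat set \<Rightarrow> bool" where
  "good_sample m K k g \<zeta> S \<longleftrightarrow>
     S \<subseteq> {1..n} \<and> card S = m \<and>
     (\<forall>u\<in>{1..n}. real (card (S \<inter> amb u)) \<le> k) \<and>
     (\<forall>i<K. real (card (S \<inter> cell K i)) > 4 * k \<and> real (card (S \<inter> cell K i)) > \<zeta>) \<and>
     (\<forall>u\<in>{1..n}. \<forall>v\<in>{1..n}. U u + g \<le> U v \<longrightarrow> real (card (S \<inter> separators u v)) > 4 * k) \<and>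
     real (card (S \<inter> {u\<in>{1..n}. U u \<le> 2 * g})) < \<zeta> \<and> S \<inter> {u\<in>{1..n}. U u \<le> g} \<noteq> {}"

end

text \<open>\<open>4 \<le> K\<close> and \<open>g \<le> 1 / 4\<close> keep both end cells at
  distance at least \<open>g\<close> from 1/2. \<open>2 / real K \<le> \<epsilon>\<close> relates
  all points of neighbouring cells and, through the split, makes the first cell unrelated to the
  last.\<close>

locale sampling_scale = approximated_graph +
  fixes m K :: nat and k g \<zeta> :: real
  assumes g: "0 < g" "g \<le> \<epsilon>" "g \<le> 1 / 4" and k: "0 \<le> k"
    and K: "4 \<le> K" "2 / real K \<le> \<epsilon>"

section \<open>Comparisons inside one reliable sample\<close>

locale reliable_sample = sampling_scale +
  fixes S :: "nat set"
  assumes good: "good_sample m K k g \<zeta> S"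
begin

lemma S: "S \<subseteq> {1..n}" "finite S" "card S = m"
proof -
  show "S \<subseteq> {1..n}" "card S = m" using good unfolding good_sample_def by blast+
  then show "finite S" by (auto intro: finite_subset)
qed

lemma S01: "u \<in> S \<Longrightarrow> u \<in> {1..n}" "u \<in> S \<Longrightarrow> U u \<in> {0..1}"
  using S U01 by auto

text \<open>Pigeonhole: each \<open>w\<close> rules out at most \<open>k\<close> vertices of the
  sample, so four of them leave a vertex of \<open>C\<close>. Four are needed in
  \<open>clear_same_side\<close>.\<close>

lemma avoid_amb:
  assumes "set ws \<subseteq> {1..n}" "length ws \<le> 4" "real (card (S \<inter> C)) > 4 * k"
  shows "\<exists>x\<in>S. x \<in> C \<and> (\<forall>w\<in>set ws. x \<notin> amb w)"
proof -
  define W where "W = set ws"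
  have W: "finite W" "card W \<le> 4" using card_length[of ws] assms by (auto simp: W_def)
  have "card (S \<inter> (\<Union>w\<in>W. amb w)) \<le> (\<Sum>w\<in>W. card (S \<inter> amb w))"
    unfolding Int_UN_distrib by (rule card_UN_le[OF W(1)])
  then have "real (card (S \<inter> (\<Union>w\<in>W. amb w))) \<le> (\<Sum>w\<in>W. real (card (S \<inter> amb w)))"
    unfolding of_nat_sum[symmetric] of_nat_le_iff .
  also have "\<dots> \<le> (\<Sum>w\<in>W. k)"
    using assms(1) good by (intro sum_mono) (auto simp: good_sample_def W_def)
  also have "\<dots> \<le> 4 * k" using W k by (simp add: mult_right_mono)
  finally have "card (S \<inter> (\<Union>w\<in>W. amb w)) < card (S \<inter> C)" using assms(3) by linarith
  then have "\<not> S \<inter> C \<subseteq> S \<inter> (\<Union>w\<in>W. amb w)"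
    using card_mono[of "S \<inter> (\<Union>w\<in>W. amb w)" "S \<inter> C"] S(2) by auto
  then show ?thesis unfolding W_def by blast
qed

lemma avoid_amb_cell:
  assumes "set ws \<subseteq> {1..n}" "length ws \<le> 4" "i < K"
  shows "\<exists>x\<in>S. x \<in> cell K i \<and> (\<forall>w\<in>set ws. x \<notin> amb w)"
  using good assms(3) by (intro avoid_amb assms) (auto simp: good_sample_def)

text \<open>If \<open>v\<close> and \<open>z\<close> are adjacent but \<open>u\<close> and \<open>z\<close> are not, then \<open>v\<close> and \<open>z\<close> lie on the same side of
  \<open>u\<close> in every interval order. Hence the orientation of a pair that is correctly classified as
  non-adjacent does not change while one of its members walks from cell to cell towards the far end.\<close>

definition clear :: "nat \<Rightarrow> nat \<Rightarrow> bool" where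
  "clear u z \<longleftrightarrow> u \<in> S \<and> z \<in> S \<and> U u < U z \<and> \<not> R (U u) (U z) \<and> z \<notin> amb u"

lemma clearD:
  assumes "clear u z"
  shows "{u, z} \<notin> H" "u \<in> S" "z \<in> S" "u \<noteq> z" "U u < U z" "\<not> R (U u) (U z)" "z \<notin> amb u" "u \<notin> amb z"
  using assms edge_iff[of u z] S01 amb_sym[of u z] by (auto simp: clear_def)

context
  fixes \<sigma> assumes \<sigma>: "interval_order H S \<sigma>"
begin

lemma inj_\<sigma>: "inj_on \<sigma> S"
  using \<sigma> by (auto simp: interval_order_def bij_betw_def)

lemma clear_swap_right:
  assumes "clear u z" "clear u z1" "{z, z1} \<in> H"
  shows "\<sigma> u < \<sigma> z \<longleftrightarrow> \<sigma> u < \<sigma> z1"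
  by (rule interval_order_same_side[OF \<sigma> clearD(2)[OF assms(1)] clearD(3)[OF assms(1)]
        clearD(3)[OF assms(2)] assms(3) clearD(1)[OF assms(2)] clearD(4)[OF assms(2)]])

lemma clear_swap_left:
  assumes "clear u z" "clear u1 z" "{u, u1} \<in> H"
  shows "\<sigma> u < \<sigma> z \<longleftrightarrow> \<sigma> u1 < \<sigma> z"
proof -
  note c = clearD[OF assms(1)] and c1 = clearD[OF assms(2)]
  have "{z, u1} \<notin> H" using c1(1) by (simp add: insert_commute)
  then have "\<sigma> z < \<sigma> u \<longleftrightarrow> \<sigma> z < \<sigma> u1"
    using interval_order_same_side[OF \<sigma> c(3) c(2) c1(2) assms(3)] c1(4) by simp
  moreover have "\<sigma> z \<noteq> \<sigma> u" "\<sigma> z \<noteq> \<sigma> u1"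
    using inj_\<sigma> c c1 by (auto dest: inj_onD)
  ultimately show ?thesis by linarith
qed

text \<open>Moving \<open>z\<close> away from \<open>u\<close> keeps the pair unrelated, because
  \<open>R (U u) (U z1)\<close> would by monotonicity give \<open>R (U u) (U z)\<close>. The edge
  between \<open>z\<close> and \<open>z1\<close> keeps \<open>z1\<close> on the same side of
  \<open>u\<close>.\<close>

lemma clear_move_right:
  assumes "clear u z" "z1 \<in> S" "U z \<le> U z1" "R (U z) (U z1)" "z1 \<notin> amb u" "z1 \<notin> amb z"
  shows "clear u z1" "\<sigma> u < \<sigma> z \<longleftrightarrow> \<sigma> u < \<sigma> z1"
proof -
  note c = clearD[OF assms(1)]
  have "\<not> R (U u) (U z1)"
    using R_left[of "U u" "U z1" "U z"] c S01 assms by auto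
  then show c1: "clear u z1" using assms c by (auto simp: clear_def)
  have "{z, z1} \<in> H" using edge_iff[of z z1] assms(2-6) c(3) S01 by blast
  then show "\<sigma> u < \<sigma> z \<longleftrightarrow> \<sigma> u < \<sigma> z1"
    by (rule clear_swap_right[OF assms(1) c1])
qed

lemma clear_move_left:
  assumes "clear u z" "u1 \<in> S" "U u1 \<le> U u" "R (U u1) (U u)" "u1 \<notin> amb u" "u1 \<notin> amb z"
  shows "clear u1 z" "\<sigma> u < \<sigma> z \<longleftrightarrow> \<sigma> u1 < \<sigma> z"
proof -
  note c = clearD[OF assms(1)]
  have "\<not> R (U u1) (U z)"
    using R_right[of "U u1" "U z" "U u"] c S01 assms by auto
  then show c1: "clear u1 z" using assms c amb_sym[of u1 z] S01 by (auto simp: clear_def)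
  have "{u, u1} \<in> H" using edge_iff[of u u1] assms(2-5) S01 c(2) R_sym[of "U u" "U u1"] by blast
  then show "\<sigma> u < \<sigma> z \<longleftrightarrow> \<sigma> u1 < \<sigma> z"
    by (rule clear_swap_left[OF assms(1) c1])
qed

text \<open>Induction over the cells up to the last one: the next cell always contains a sample
  vertex that is correctly classified against both \<open>u\<close> and the current
  \<open>z\<close>, so a further move is possible.\<close>

lemma clear_to_last:
  assumes "clear u z"
  shows "\<exists>z'\<in>cell K (K - 1). clear u z' \<and> (\<sigma> u < \<sigma> z \<longleftrightarrow> \<sigma> u < \<sigma> z')"
proof -
  obtain i where i: "i < K" "z \<in> cell K i"
    using in_some_cell[of z K] clearD(3)[OF assms] S01 K by auto
  have "i \<le> K - 1" using i by simp
  then show ?thesis using assms i(2)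
  proof (induction arbitrary: z rule: inc_induct)
    case base
    then show ?case by blast
  next
    case (step i)
    note c = clearD[OF step.prems(1)]
    have "Suc i < K" using step.hyps by simp
    then obtain z1 where z1: "z1 \<in> S" "z1 \<in> cell K (Suc i)" "z1 \<notin> amb u" "z1 \<notin> amb z"
      using avoid_amb_cell[of "[u, z]" "Suc i"] c S01 by auto
    have "U z \<le> U z1" using z1(2) step.prems(2) by (auto simp: cell_def)
    moreover have "R (U z) (U z1)"
      using adjacent_cells[OF step.prems(2) z1(2)] K by auto
    ultimately have "clear u z1" "\<sigma> u < \<sigma> z \<longleftrightarrow> \<sigma> u < \<sigma> z1"
      using clear_move_right[OF step.prems(1) z1(1)] z1 by auto
    then show ?case using step.IH[OF _ z1(2)] by auto
  qed
qed

lemma clear_to_first: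
  assumes "clear u z"
  shows "\<exists>u'\<in>cell K 0. clear u' z \<and> (\<sigma> u < \<sigma> z \<longleftrightarrow> \<sigma> u' < \<sigma> z)"
proof -
  obtain i where i: "i < K" "u \<in> cell K i"
    using in_some_cell[of u K] clearD(2)[OF assms] S01 K by auto
  then show ?thesis using assms
  proof (induction i arbitrary: u)
    case 0
    then show ?case by blast
  next
    case (Suc i)
    note c = clearD[OF Suc.prems(3)]
    obtain u1 where u1: "u1 \<in> S" "u1 \<in> cell K i" "u1 \<notin> amb u" "u1 \<notin> amb z"
      using avoid_amb_cell[of "[u, z]" i] c S01 Suc.prems by auto
    have "U u1 \<le> U u" using u1(2) Suc.prems(2) by (auto simp: cell_def)
    moreover have "R (U u1) (U u)"
      using adjacent_cells[OF u1(2) Suc.prems(2)] K by auto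
    ultimately have "clear u1 z" "\<sigma> u < \<sigma> z \<longleftrightarrow> \<sigma> u1 < \<sigma> z"
      using clear_move_left[OF Suc.prems(3) u1(1)] u1 by auto
    then show ?case using Suc.IH[OF _ u1(2)] Suc.prems by auto
  qed
qed

text \<open>The end cells have width \<open>1 / K\<close>, and
  \<open>2 / K \<le> \<epsilon>\<close>, so such points are at distance at least
  \<open>1 - \<epsilon>\<close> and the split applies.\<close>

lemma clear_extreme:
  assumes "u \<in> S" "z \<in> S" "u \<in> cell K 0" "z \<in> cell K (K - 1)" "z \<notin> amb u"
  shows "clear u z"
proof -
  have 1: "U u \<le> 1 / real K" "1 - 1 / real K \<le> U z"
    using first_cell[OF assms(3)] last_cell[OF assms(4)] K by auto
  have 2: "1 / real K \<le> 1 / 4" using K by (auto intro!: divide_left_mono)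
  have "2 / real K = 2 * (1 / real K)" by simp
  then have "U u \<le> U z - (1 - \<epsilon>)" using 1 K by linarith
  then show ?thesis using assms 1 2 R_split[of "U u" "U z"] S01 by (auto simp: clear_def)
qed

text \<open>Both pairs are moved to the end cells. The resulting pairs \<open>(u1, z1)\<close> and
  \<open>(u2, z2)\<close> may be misclassified against each other, so they are compared through a
  third pair \<open>(u3, z3)\<close>, chosen from the sample so that all classifications used are
  correct.\<close>

lemma clear_same_side:
  assumes "clear u z" "clear u' z'"
  shows "\<sigma> u < \<sigma> z \<longleftrightarrow> \<sigma> u' < \<sigma> z'"
proof -
  obtain z1 where z1: "z1 \<in> cell K (K - 1)" "clear u z1" "\<sigma> u < \<sigma> z \<longleftrightarrow> \<sigma> u < \<sigma> z1"
    using clear_to_last[OF assms(1)] by blast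
  obtain u1 where u1: "u1 \<in> cell K 0" "clear u1 z1" "\<sigma> u < \<sigma> z1 \<longleftrightarrow> \<sigma> u1 < \<sigma> z1"
    using clear_to_first[OF z1(2)] by blast
  obtain z2 where z2: "z2 \<in> cell K (K - 1)" "clear u' z2" "\<sigma> u' < \<sigma> z' \<longleftrightarrow> \<sigma> u' < \<sigma> z2"
    using clear_to_last[OF assms(2)] by blast
  obtain u2 where u2: "u2 \<in> cell K 0" "clear u2 z2" "\<sigma> u' < \<sigma> z2 \<longleftrightarrow> \<sigma> u2 < \<sigma> z2"
    using clear_to_first[OF z2(2)] by blast
  note c1 = clearD[OF u1(2)] and c2 = clearD[OF u2(2)]
  have K': "0 < K" "K - 1 < K" using K by auto
  have near: "R (U x) (U y)" if "x \<in> cell K i" "y \<in> cell K i" for x y i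
    using adjacent_cells[OF that] K by auto
  have near_last: "{z, z'} \<in> H" if "z \<in> S" "z' \<in> S" "z' \<in> cell K i" "z \<in> cell K i" "z' \<notin> amb z" for z z' i
    using edge_iff[of z z'] near[of z i z'] that S01 by auto
  obtain z3 where z3: "z3 \<in> S" "z3 \<in> cell K (K - 1)" "z3 \<notin> amb u1" "z3 \<notin> amb u2" "z3 \<notin> amb z1" "z3 \<notin> amb z2"
    using avoid_amb_cell[of "[u1, u2, z1, z2]" "K - 1"] c1 c2 S01 K' by auto
  obtain u3 where u3: "u3 \<in> S" "u3 \<in> cell K 0" "u3 \<notin> amb u1" "u3 \<notin> amb u2" "u3 \<notin> amb z3"
    using avoid_amb_cell[of "[u1, u2, z3]" 0] c1 c2 z3 S01 K' by auto
  have c3: "clear u1 z3" "clear u2 z3" "clear u3 z3"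
    using clear_extreme[OF c1(2) z3(1) u1(1) z3(2) z3(3)] clear_extreme[OF c2(2) z3(1) u2(1) z3(2) z3(4)]
      clear_extreme[OF u3(1) z3(1) u3(2) z3(2)] amb_sym[of u3 z3] S01(1)[OF u3(1)] S01(1)[OF z3(1)] u3(5)
    by auto
  have "\<sigma> u1 < \<sigma> z1 \<longleftrightarrow> \<sigma> u1 < \<sigma> z3"
    by (rule clear_swap_right[OF u1(2) c3(1) near_last[OF c1(3) z3(1,2) z1(1) z3(5)]])
  moreover have "\<sigma> u2 < \<sigma> z2 \<longleftrightarrow> \<sigma> u2 < \<sigma> z3"
    by (rule clear_swap_right[OF u2(2) c3(2) near_last[OF c2(3) z3(1,2) z2(1) z3(6)]])
  moreover have "\<sigma> u1 < \<sigma> z3 \<longleftrightarrow> \<sigma> u3 < \<sigma> z3"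
    by (rule clear_swap_left[OF c3(1,3) near_last[OF c1(2) u3(1,2) u1(1) u3(3)]])
  moreover have "\<sigma> u2 < \<sigma> z3 \<longleftrightarrow> \<sigma> u3 < \<sigma> z3"
    by (rule clear_swap_left[OF c3(2,3) near_last[OF c2(2) u3(1,2) u2(1) u3(4)]])
  ultimately show ?thesis using z1(3) z2(3) u1(3) u2(3) by blast
qed

text \<open>A correctly classified separator \<open>z\<close> is related to just one of
  \<open>u\<close> and \<open>v\<close>. If to \<open>v\<close>, monotonicity places
  \<open>z\<close> to the right of \<open>u\<close>, so \<open>(u, z)\<close> is clear and
  \<open>v\<close> lies on the same side of \<open>u\<close> as \<open>z\<close>. The other case is
  the mirror image, with the clear pair \<open>(z, v)\<close>.\<close>

lemma order_from_clear:
  assumes uv: "u \<in> S" "v \<in> S" "U u + g \<le> U v"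
  shows "\<exists>u' z'. clear u' z' \<and> (\<sigma> u < \<sigma> v \<longleftrightarrow> \<sigma> u' < \<sigma> z')"
proof -
  have lt: "U u < U v" using g uv by simp
  have "real (card (S \<inter> separators u v)) > 4 * k"
    using good uv S01 by (auto simp: good_sample_def)
  then obtain z where z: "z \<in> S" "z \<in> separators u v" "z \<notin> amb u" "z \<notin> amb v"
    using avoid_amb[of "[u, v]" "separators u v"] S01 uv by auto
  have ne: "z \<noteq> u" "z \<noteq> v" using z self_amb S01 uv by auto
  note z01 = S01(2)[OF z(1)] S01(2)[OF uv(1)] S01(2)[OF uv(2)]
  note zV = S01(1)[OF z(1)] S01(1)[OF uv(1)] S01(1)[OF uv(2)]
  note e = edge_iff[of u z] edge_iff[of v z]
  have \<sigma>ne: "\<sigma> u \<noteq> \<sigma> v" "\<sigma> z \<noteq> \<sigma> v" using inj_\<sigma> uv lt z ne by (auto dest: inj_onD)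
  show ?thesis
  proof (cases "R (U v) (U z)")
    case True
    then have nR: "\<not> R (U u) (U z)" using z(2) by (auto simp: separators_def)
    have "U u < U z"
    proof (rule ccontr)
      assume "\<not> ?thesis"
      then show False
        using True nR R_left[of "U z" "U v" "U u"] R_sym[of "U z" "U v"] R_sym[of "U z" "U u"] lt z01
        by auto
    qed
    then have "clear u z" using nR z uv by (simp add: clear_def)
    moreover have "\<sigma> u < \<sigma> v \<longleftrightarrow> \<sigma> u < \<sigma> z"
      using interval_order_same_side[OF \<sigma> uv(1,2) z(1)] e(1)[OF zV(2,1) z(3)] e(2)[OF zV(3,1) z(4)]
        True nR ne by metis
    ultimately show ?thesis by blast
  next
    case False
    then have R: "R (U u) (U z)" using z(2) by (auto simp: separators_def)
    have lt': "U z < U v"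
    proof (rule ccontr)
      assume "\<not> ?thesis"
      then show False using False R R_right[of "U u" "U z" "U v"] lt z01 by auto
    qed
    then have "clear z v"
      using False z uv R_sym[of "U v" "U z"] z01 amb_sym[of z v] S01 by (auto simp: clear_def)
    moreover have "\<sigma> v < \<sigma> u \<longleftrightarrow> \<sigma> v < \<sigma> z"
      using interval_order_same_side[OF \<sigma> uv(2,1) z(1)] e(1)[OF zV(2,1) z(3)] e(2)[OF zV(3,1) z(4)]
        R False ne by metis
    then have "\<sigma> u < \<sigma> v \<longleftrightarrow> \<sigma> z < \<sigma> v" using \<sigma>ne by linarith
    ultimately show ?thesis by blast
  qed
qed

text \<open>Every comparison at distance \<open>g\<close> copies that of a clear pair
  (\<open>order_from_clear\<close>), and all clear pairs agree
  (\<open>clear_same_side\<close>).\<close>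

lemma interval_order_sign:
  "\<exists>s\<in>{-1, 1::int}. \<forall>u\<in>S. \<forall>v\<in>S. U u + g \<le> U v \<longrightarrow> sgn (int (\<sigma> v) - int (\<sigma> u)) = s"
proof -
  define b where "b \<longleftrightarrow> (\<exists>u z. clear u z \<and> \<sigma> u < \<sigma> z)"
  have b: "\<sigma> u < \<sigma> v \<longleftrightarrow> b" if uv: "u \<in> S" "v \<in> S" "U u + g \<le> U v" for u v
  proof -
    obtain u' z' where c: "clear u' z'" "\<sigma> u < \<sigma> v \<longleftrightarrow> \<sigma> u' < \<sigma> z'"
      using order_from_clear[OF uv] by blast
    have "b \<longleftrightarrow> \<sigma> u' < \<sigma> z'"
      unfolding b_def using clear_same_side[OF c(1)] c(1) by blast
    with c(2) show ?thesis by simp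
  qed
  have "sgn (int (\<sigma> v) - int (\<sigma> u)) = (if b then 1 else -1)"
    if "u \<in> S" "v \<in> S" "U u + g \<le> U v" for u v
  proof -
    have "u \<noteq> v" using that(3) g(1) by auto
    then have "\<sigma> u \<noteq> \<sigma> v" using inj_on_eq_iff[OF inj_\<sigma> that(1,2)] by simp
    then show ?thesis using b[OF that] by (cases b) simp_all
  qed
  then show ?thesis by (cases b) auto
qed

end

end

section \<open>Orientation of the sketches\<close>

context sampling_scale
begin

definition oriented_by :: "int \<Rightarrow> sketch \<Rightarrow> bool" where
  "oriented_by s p \<longleftrightarrow> s \<in> {-1, 1} \<and>
     (\<forall>u\<in>snd p. \<forall>v\<in>snd p. U u + g \<le> U v \<longrightarrow> sgn (int (fst p v) - int (fst p u)) = s)"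

text \<open>The end of a sketch near \<open>0\<close> and the end near \<open>1\<close>, whichever way the sketch is oriented.\<close>

definition low_end :: "int \<Rightarrow> sketch \<Rightarrow> nat set" where
  "low_end s p = (if s = 1 then left_end \<zeta> p else right_end m \<zeta> p)"

definition high_end :: "int \<Rightarrow> sketch \<Rightarrow> nat set" where
  "high_end s p = (if s = 1 then right_end m \<zeta> p else left_end \<zeta> p)"

end

section \<open>Positions of vertices near the ends of a sketch\<close>

context reliable_sample
begin

context
  fixes \<sigma> s assumes \<sigma>: "interval_order H S \<sigma>" and s: "oriented_by s (\<sigma>, S)"
begin

lemma \<sigma>_bij: "bij_betw \<sigma> S {1..m}"
  using \<sigma> S by (simp add: interval_order_def)

lemma card_le_positions:
  assumes "B \<subseteq> S" "\<And>v. v \<in> B \<Longrightarrow> \<sigma> v \<in> X" "finite X"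
  shows "card B \<le> card X"
proof (rule card_inj_on_le)
  show "inj_on \<sigma> B" using inj_on_subset[OF bij_betw_imp_inj_on[OF \<sigma>_bij] assms(1)] .
qed (use assms in auto)

lemma \<sigma>_range: "u \<in> S \<Longrightarrow> 1 \<le> \<sigma> u \<and> \<sigma> u \<le> m"
  using bij_betwE[OF \<sigma>_bij] by auto

lemma card_before:
  assumes "u \<in> S" "B \<subseteq> S" "\<And>v. v \<in> B \<Longrightarrow> \<sigma> v < \<sigma> u"
  shows "card B < \<sigma> u"
  using card_le_positions[OF assms(2), of "{1..<\<sigma> u}"] assms \<sigma>_range by fastforce

lemma card_after:
  assumes "u \<in> S" "B \<subseteq> S" "\<And>v. v \<in> B \<Longrightarrow> \<sigma> u < \<sigma> v"
  shows "card B + \<sigma> u \<le> m"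
  using card_le_positions[OF assms(2), of "{\<sigma> u<..m}"] assms \<sigma>_range by fastforce

lemma card_positions_le: "X \<subseteq> {1..m} \<Longrightarrow> card X \<le> card {v\<in>S. \<sigma> v \<in> X}"
  by (rule surj_card_le[of _ _ \<sigma>]) (use S(2) bij_betw_imp_surj_on[OF \<sigma>_bij] in auto)

lemma card_until: "u \<in> S \<Longrightarrow> \<sigma> u \<le> card {v\<in>S. \<sigma> v \<le> \<sigma> u}"
proof -
  assume u: "u \<in> S"
  have "card {1..\<sigma> u} \<le> card {v\<in>S. \<sigma> v \<in> {1..\<sigma> u}}" using \<sigma>_range[OF u] by (intro card_positions_le) auto
  also have "{v\<in>S. \<sigma> v \<in> {1..\<sigma> u}} = {v\<in>S. \<sigma> v \<le> \<sigma> u}" using \<sigma>_range by auto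
  finally show ?thesis by simp
qed

lemma card_from: "u \<in> S \<Longrightarrow> m + 1 \<le> card {v\<in>S. \<sigma> u \<le> \<sigma> v} + \<sigma> u"
proof -
  assume u: "u \<in> S"
  have "card {\<sigma> u..m} \<le> card {v\<in>S. \<sigma> v \<in> {\<sigma> u..m}}" using \<sigma>_range[OF u] by (intro card_positions_le) auto
  also have "{v\<in>S. \<sigma> v \<in> {\<sigma> u..m}} = {v\<in>S. \<sigma> u \<le> \<sigma> v}" using \<sigma>_range by auto
  finally show ?thesis using \<sigma>_range[OF u] by simp
qed

lemma s_cases: "s = 1 \<or> s = -1"
  using s by (auto simp: oriented_by_def)

lemma ordered: "u \<in> S \<Longrightarrow> v \<in> S \<Longrightarrow> U u + g \<le> U v \<Longrightarrow> if s = 1 then \<sigma> u < \<sigma> v else \<sigma> v < \<sigma> u"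
proof -
  assume "u \<in> S" "v \<in> S" "U u + g \<le> U v"
  then have "sgn (int (\<sigma> v) - int (\<sigma> u)) = s" using s by (simp add: oriented_by_def)
  then show ?thesis using s_cases by (auto simp: sgn_if split: if_splits)
qed

text \<open>The end cells lie in the outer quarters, so by \<open>ordered\<close> a vertex in the
  right half has the whole first cell on one side of it in the order. These are more than
  \<open>\<zeta>\<close> sample vertices, which keeps it out of the low end; likewise for the left
  half and the high end.\<close>

lemma inner_not_extreme:
  assumes "u \<in> S"
  shows "1 / 2 \<le> U u \<Longrightarrow> u \<notin> low_end s (\<sigma>, S)" "U u \<le> 1 / 2 \<Longrightarrow> u \<notin> high_end s (\<sigma>, S)"
proof -
  have K4: "1 / real K \<le> 1 / 4" using K by (auto intro!: divide_left_mono)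
  have large: "real (card (S \<inter> cell K 0)) > \<zeta>" "real (card (S \<inter> cell K (K - 1))) > \<zeta>"
    using good K unfolding good_sample_def by auto
  show "u \<notin> low_end s (\<sigma>, S)" if "1 / 2 \<le> U u"
  proof -
    have "if s = 1 then \<sigma> v < \<sigma> u else \<sigma> u < \<sigma> v" if "v \<in> S \<inter> cell K 0" for v
    proof -
      have "U v \<le> 1 / real K" using first_cell[of v K] that by auto
      then have "U v + g \<le> U u" using \<open>1 / 2 \<le> U u\<close> g(3) K4 by linarith
      then show ?thesis using ordered[of v u] that assms by auto
    qed
    then show ?thesis
      using card_before[OF assms, of "S \<inter> cell K 0"] card_after[OF assms, of "S \<inter> cell K 0"] large(1)
      by (auto simp: low_end_def left_end_def right_end_def split: if_splits)
  qed
  show "u \<notin> high_end s (\<sigma>, S)" if "U u \<le> 1 / 2"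
  proof -
    have "if s = 1 then \<sigma> u < \<sigma> v else \<sigma> v < \<sigma> u" if "v \<in> S \<inter> cell K (K - 1)" for v
    proof -
      have "1 - 1 / real K \<le> U v" using last_cell[of v K] that K(1) by auto
      then have "U u + g \<le> U v" using \<open>U u \<le> 1 / 2\<close> g(3) K4 by linarith
      then show ?thesis using ordered[of u v] that assms by auto
    qed
    then show ?thesis
      using card_before[OF assms, of "S \<inter> cell K (K - 1)"] card_after[OF assms, of "S \<inter> cell K (K - 1)"] large(2)
      by (auto simp: high_end_def left_end_def right_end_def split: if_splits)
  qed
qed

text \<open>Whatever the order places at least as far out as \<open>u\<close> is not at distance
  \<open>g\<close> to the right of \<open>u\<close>, hence lies in \<open>[0, 2 * g]\<close>, where
  the sample has fewer than \<open>\<zeta>\<close> vertices. This explains the \<open>2 * g\<close>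
  in \<open>good_sample\<close>.\<close>

lemma extreme_in_low_end:
  assumes "u \<in> S" "U u \<le> g"
  shows "u \<in> low_end s (\<sigma>, S)"
proof -
  have small: "real (card (S \<inter> {u\<in>{1..n}. U u \<le> 2 * g})) < \<zeta>"
    using good unfolding good_sample_def by auto
  have bound: "real (card B) < \<zeta>" if "B \<subseteq> S" "\<And>v. v \<in> B \<Longrightarrow> \<not> (U u + g \<le> U v)" for B
  proof -
    have "U v \<le> 2 * g" if "v \<in> B" for v
      using \<open>\<And>v. v \<in> B \<Longrightarrow> \<not> (U u + g \<le> U v)\<close>[OF that] assms(2) by linarith
    then have "B \<subseteq> S \<inter> {u\<in>{1..n}. U u \<le> 2 * g}" using that(1) S by blast
    then have "card B \<le> card (S \<inter> {u\<in>{1..n}. U u \<le> 2 * g})"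
      using S by (intro card_mono) auto
    then show ?thesis using small by linarith
  qed
  show ?thesis
  proof (cases "s = 1")
    case True
    have "real (card {v\<in>S. \<sigma> v \<le> \<sigma> u}) < \<zeta>"
      using ordered[OF assms(1)] True by (intro bound) fastforce+
    then have "real (\<sigma> u) < \<zeta>" using card_until[OF assms(1)] by linarith
    then show ?thesis using True assms by (simp add: low_end_def left_end_def)
  next
    case False
    have "real (card {v\<in>S. \<sigma> u \<le> \<sigma> v}) < \<zeta>"
      using ordered[OF assms(1)] False by (intro bound) fastforce+
    then have "real (\<sigma> u) > real m - \<zeta>" using card_from[OF assms(1)] by linarith
    then show ?thesis using False assms by (simp add: low_end_def right_end_def)
  qed
qed

end

end

text \<open>\<open>pair_covered\<close> has to omit misclassified pairs; \<open>near_clear\<close>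
  guarantees that it still covers the pairs of vertices near 0 through which the sketches are
  linked.\<close>

locale reliable_sketches = sampling_scale +
  fixes Q :: "sketch list"
  assumes good_sketches: "j < length Q \<Longrightarrow> good_sample m K k g \<zeta> (snd (Q ! j))"
    and sketch_orders: "j < length Q \<Longrightarrow> interval_order H (snd (Q ! j)) (fst (Q ! j))"
    and pair_covered: "u \<in> {1..n} \<Longrightarrow> v \<in> {1..n} \<Longrightarrow> v \<notin> amb u \<Longrightarrow> \<exists>j<length Q. u \<in> snd (Q ! j) \<and> v \<in> snd (Q ! j)"
    and near_clear: "u \<in> {1..n} \<Longrightarrow> v \<in> {1..n} \<Longrightarrow> u \<noteq> v \<Longrightarrow> \<bar>U u - U v\<bar> \<le> \<epsilon> \<Longrightarrow> v \<notin> amb u"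
begin

lemma reliable: "j < length Q \<Longrightarrow> reliable_sample R \<epsilon> n U H m K k g \<zeta> (snd (Q ! j))"
  using good_sketches by unfold_locales

definition sketch_sign :: "nat \<Rightarrow> int" where
  "sketch_sign j = (SOME s. oriented_by s (Q ! j))"

lemma oriented: "j < length Q \<Longrightarrow> oriented_by (sketch_sign j) (Q ! j)"
  unfolding sketch_sign_def
  by (rule someI_ex)
    (use reliable_sample.interval_order_sign[OF reliable sketch_orders] in \<open>force simp: oriented_by_def\<close>)

lemma sketch_sign: "j < length Q \<Longrightarrow> sketch_sign j = 1 \<or> sketch_sign j = -1"
  using oriented by (auto simp: oriented_by_def)

text \<open>Low ends stay in the left half and high ends in the right half, whichever sketch they
  come from.\<close>

lemma ends_disjoint:
  assumes "i < length Q" "j < length Q"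
  shows "low_end (sketch_sign i) (Q ! i) \<inter> high_end (sketch_sign j) (Q ! j) = {}"
proof -
  have "U u < 1 / 2" if "u \<in> low_end (sketch_sign i) (Q ! i)" for u
    using that reliable_sample.inner_not_extreme(1)[OF reliable[OF assms(1)] sketch_orders[OF assms(1)], of "sketch_sign i" u]
      oriented[OF assms(1)] by (force simp: low_end_def left_end_def right_end_def split: if_splits prod.splits)
  moreover have "U u > 1 / 2" if "u \<in> high_end (sketch_sign j) (Q ! j)" for u
    using that reliable_sample.inner_not_extreme(2)[OF reliable[OF assms(2)] sketch_orders[OF assms(2)], of "sketch_sign j" u]
      oriented[OF assms(2)] by (force simp: high_end_def left_end_def right_end_def split: if_splits prod.splits)
  ultimately show ?thesis by force
qed

text \<open>Only ends near the same point can meet. So two left ends or two right ends that meet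
  come from sketches of the same direction, a left and a right end from opposite ones, and the order
  in which \<open>orientation\<close> tests the cases is immaterial.\<close>

lemma orientation_sign:
  assumes "i < length Q" "j < length Q" "orientation m \<zeta> (Q ! i) (Q ! j) \<noteq> 0"
  shows "orientation m \<zeta> (Q ! i) (Q ! j) = sketch_sign i * sketch_sign j"
  using ends_disjoint[OF assms(1,2)] ends_disjoint[OF assms(2,1)] assms(3)
    sketch_sign[OF assms(1)] sketch_sign[OF assms(2)]
  by (auto simp: orientation_def low_end_def high_end_def split: if_splits)

text \<open>Rules out the branch in which the algorithm may return anything.\<close>

lemma signs_consistent: "consistent_signs m \<zeta> Q sketch_sign"
  using orientation_sign sketch_sign by (auto simp: consistent_signs_def)

lemma low_end_vertex:
  assumes "j < length Q" "u \<in> snd (Q ! j)" "U u \<le> g"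
  shows "u \<in> low_end (sketch_sign j) (Q ! j)"
  using reliable_sample.extreme_in_low_end[OF reliable[OF assms(1)] sketch_orders[OF assms(1)] _ assms(2,3), of "sketch_sign j"]
    oriented[OF assms(1)] by simp

lemma orientation_nonzero:
  assumes "i < length Q" "j < length Q" "u \<in> snd (Q ! i)" "u \<in> snd (Q ! j)" "U u \<le> g"
  shows "orientation m \<zeta> (Q ! i) (Q ! j) \<noteq> 0"
  using low_end_vertex[OF assms(1,3,5)] low_end_vertex[OF assms(2,4,5)]
  by (auto simp: orientation_def low_end_def split: if_splits)

text \<open>Two sketches are linked through a third one which contains a vertex near \<open>0\<close> of each.\<close>

lemma consistent_signs_unique:
  assumes a: "consistent_signs m \<zeta> Q a"
  shows "\<exists>c\<in>{-1, 1}. \<forall>j<length Q. a j = c * sketch_sign j"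
proof (cases "Q = []")
  case False
  have a1: "a j = 1 \<or> a j = -1" if "j < length Q" for j
    using a that by (auto simp: consistent_signs_def)
  have link: "a i * sketch_sign i = a j * sketch_sign j"
    if "i < length Q" "j < length Q" "u \<in> snd (Q ! i)" "u \<in> snd (Q ! j)" "U u \<le> g" for i j u
  proof -
    have "a i * a j = sketch_sign i * sketch_sign j"
      using orientation_nonzero[OF that] orientation_sign[OF that(1,2)] a that(1,2)
      by (auto simp: consistent_signs_def)
    then show ?thesis
      using a1[OF that(1)] a1[OF that(2)] sketch_sign[OF that(1)] sketch_sign[OF that(2)] by auto
  qed
  have all: "a i * sketch_sign i = a j * sketch_sign j" if ij: "i < length Q" "j < length Q" for i j
  proof -
    obtain u where u: "u \<in> snd (Q ! i)" "u \<in> {1..n}" "U u \<le> g"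
      using good_sketches[OF ij(1)] unfolding good_sample_def by blast
    obtain v where v: "v \<in> snd (Q ! j)" "v \<in> {1..n}" "U v \<le> g"
      using good_sketches[OF ij(2)] unfolding good_sample_def by blast
    show ?thesis
    proof (cases "u = v")
      case True
      then show ?thesis using link[OF ij u(1)] u v by auto
    next
      case False
      have "\<bar>U u - U v\<bar> \<le> \<epsilon>" using u v U01[OF u(2)] U01[OF v(2)] g by auto
      then obtain l where l: "l < length Q" "u \<in> snd (Q ! l)" "v \<in> snd (Q ! l)"
        using pair_covered[OF u(2) v(2)] near_clear[OF u(2) v(2) False] by blast
      show ?thesis using link[OF ij(1) l(1) u(1) l(2) u(3)] link[OF l(1) ij(2) l(3) v(1,3)] by simp
    qed
  qed
  have 0: "0 < length Q" using False by simp
  have "a j = a 0 * sketch_sign 0 * sketch_sign j" if "j < length Q" for j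
    using all[OF 0 that] sketch_sign[OF that] a1[OF that] by auto
  then show ?thesis
    using a1[OF 0] sketch_sign[OF 0] by (intro bexI[of _ "a 0 * sketch_sign 0"]) auto
qed auto

text \<open>All sketches that contain both vertices vote alike, since the chosen signs undo their
  individual directions up to \<open>c\<close>. At least one such sketch exists, so the vote is not
  a tie.\<close>

lemma sketch_comparison_correct:
  assumes c: "c \<in> {-1, 1}" "\<And>j. j < length Q \<Longrightarrow> a j = c * sketch_sign j"
    and uv: "u \<in> {1..n}" "v \<in> {1..n}" "v \<notin> amb u" "U u + g \<le> U v"
  shows "sketch_comparison m Q a u v = c" "sketch_comparison m Q a v u = - c"
proof -
  have lt: "U u < U v" using uv g by auto
  have ord: "sgn (int (oriented_order m Q a j v) - int (oriented_order m Q a j u)) = c"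
    if j: "j < length Q" "u \<in> snd (Q ! j)" "v \<in> snd (Q ! j)" for j
  proof -
    have s: "sgn (int (fst (Q ! j) v) - int (fst (Q ! j) u)) = sketch_sign j"
      using oriented[OF j(1)] j uv by (auto simp: oriented_by_def)
    have "card (snd (Q ! j)) = m" using good_sketches[OF j(1)] by (simp add: good_sample_def)
    then have "bij_betw (fst (Q ! j)) (snd (Q ! j)) {1..m}"
      using sketch_orders[OF j(1)] by (simp add: interval_order_def)
    then have "fst (Q ! j) u \<le> m" "fst (Q ! j) v \<le> m" using j bij_betwE by fastforce+
    then show ?thesis
      using s sketch_sign[OF j(1)] c(1) c(2)[OF j(1)]
      by (auto simp: oriented_order_def sgn_if of_nat_diff split: if_splits)
  qed
  define J where "J = {j. j < length Q \<and> u \<in> snd (Q ! j) \<and> v \<in> snd (Q ! j)}"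
  have "J \<noteq> {}" "finite J" using pair_covered[OF uv(1-3)] by (auto simp: J_def)
  then have J: "card J > 0" by (simp add: card_gt_0_iff)
  have sets: "{j. j < length Q \<and> u \<in> snd (Q ! j) \<and> v \<in> snd (Q ! j) \<and>
       oriented_order m Q a j u < oriented_order m Q a j v} = (if c = 1 then J else {})"
    "{j. j < length Q \<and> u \<in> snd (Q ! j) \<and> v \<in> snd (Q ! j) \<and>
       oriented_order m Q a j u > oriented_order m Q a j v} = (if c = 1 then {} else J)"
    using ord c(1) by (force simp: J_def sgn_if split: if_splits)+
  have "sketch_count m Q a u v = c * int (card J)"
    using c(1) unfolding sketch_count_def sets by auto
  moreover have "sketch_count m Q a v u = - sketch_count m Q a u v"
    unfolding sketch_count_def by (simp add: conj_ac)
  ultimately show "sketch_comparison m Q a u v = c" "sketch_comparison m Q a v u = - c"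
    using J c(1) lt by (auto simp: sketch_comparison_def antisym_ext_def sgn_mult sgn_if)
qed

end

section \<open>Local refinement and ranking\<close>

text \<open>Off \<open>B\<close> the two sets agree and every vote is \<open>c\<close>, so the
  difference comes from \<open>N \<inter> B\<close> and \<open>T \<inter> B\<close>, each
  contributing at most \<open>card B\<close>.\<close>

lemma signed_count_approx:
  fixes F :: "'a \<Rightarrow> int" and c :: int
  assumes "finite N" "finite T" "finite B" "N - B = T - B" "\<And>x. x \<in> T - B \<Longrightarrow> F x = c" "c \<in> {-1, 1}"
  shows "\<bar>int (card {x\<in>N. F x = 1}) - int (card {x\<in>N. F x = -1}) - c * int (card T)\<bar> \<le> 2 * int (card B)"
proof -
  define h where "h x = (if F x = 1 then 1 else if F x = -1 then -1 else (0::int))" for x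
  have "int (card {x\<in>N. F x = 1}) = (\<Sum>x\<in>N. if F x = 1 then 1 else 0)"
    "int (card {x\<in>N. F x = -1}) = (\<Sum>x\<in>N. if F x = -1 then 1 else 0)"
    using assms(1) by (simp_all flip: sum.inter_filter)
  then have "int (card {x\<in>N. F x = 1}) - int (card {x\<in>N. F x = -1}) = sum h N"
    unfolding h_def by (simp only: sum_subtractf[symmetric]) (rule sum.cong, auto)
  also have "\<dots> = sum h (N \<inter> B) + sum h (N - B)"
    using assms(1) by (metis sum.Int_Diff)
  finally have 1: "int (card {x\<in>N. F x = 1}) - int (card {x\<in>N. F x = -1}) = sum h (N \<inter> B) + sum h (N - B)" .
  have "c * int (card T) = (\<Sum>x\<in>T. c)" by simp
  also have "\<dots> = (\<Sum>x\<in>T \<inter> B. c) + (\<Sum>x\<in>T - B. c)"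
    using assms(2) by (metis sum.Int_Diff)
  finally have 2: "c * int (card T) = (\<Sum>x\<in>T \<inter> B. c) + (\<Sum>x\<in>T - B. c)" .
  have 3: "sum h (N - B) = (\<Sum>x\<in>T - B. c)"
    unfolding assms(4) using assms(5,6) by (intro sum.cong) (auto simp: h_def)
  have "\<bar>sum h (N \<inter> B)\<bar> \<le> (\<Sum>x\<in>N \<inter> B. 1)"
    by (rule order.trans[OF sum_abs sum_mono]) (auto simp: h_def)
  also have "\<dots> \<le> int (card B)" using assms(3) by (simp add: card_mono)
  finally have 4: "\<bar>sum h (N \<inter> B)\<bar> \<le> int (card B)" .
  have "\<bar>\<Sum>x\<in>T \<inter> B. c\<bar> \<le> (\<Sum>x\<in>T \<inter> B. 1)"
    using assms(6) by auto
  also have "\<dots> \<le> int (card B)" using assms(3) by (simp add: card_mono)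
  finally show ?thesis using 1 2 3 4 by linarith
qed

text \<open>A value of the wrong sign has modulus at most \<open>4 * b\<close>, whereas one of
  \<open>X\<close>, \<open>Y\<close> exceeds \<open>8 * b\<close>, so that the larger modulus
  exceeds \<open>4 * b\<close> and belongs to a value of the right sign. The second claim is the
  same decision with exchanged roles, for pairs numbered against their positions.\<close>

lemma dominant_side:
  fixes d e c b :: int and X Y :: nat
  assumes "c \<in> {-1, 1}" "\<bar>d - c * int X\<bar> \<le> 4 * b" "\<bar>e + c * int Y\<bar> \<le> 4 * b" "16 * b < int X + int Y"
  shows "(if \<bar>e\<bar> < \<bar>d\<bar> then (if 0 < d then 1 else -1) else (if e < 0 then 1 else -1)) = c"
    and "(if \<bar>d\<bar> < \<bar>e\<bar> then (if 0 < e then 1 else -1) else (if d < 0 then 1 else -1)) = - c"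
proof -
  define X' Y' where "X' = int X" and "Y' = int Y"
  have nn: "0 \<le> X'" "0 \<le> Y'" by (simp_all add: X'_def Y'_def)
  note a = assms[folded X'_def Y'_def]
  consider "c = 1" | "c = -1" using assms(1) by blast
  then have "(if \<bar>e\<bar> < \<bar>d\<bar> then (if 0 < d then 1 else -1) else (if e < 0 then 1 else -1)) = c \<and>
    (if \<bar>d\<bar> < \<bar>e\<bar> then (if 0 < e then 1 else -1) else (if d < 0 then 1 else -1)) = - c"
  proof cases
    case 1
    with a have "\<bar>d - X'\<bar> \<le> 4 * b" "\<bar>e + Y'\<bar> \<le> 4 * b" by simp_all
    then show ?thesis using a(4) nn 1 by (smt (verit))
  next
    case 2
    with a have "\<bar>d + X'\<bar> \<le> 4 * b" "\<bar>e - Y'\<bar> \<le> 4 * b" by simp_all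
    then show ?thesis using a(4) nn 2 by (smt (verit))
  qed
  then show "(if \<bar>e\<bar> < \<bar>d\<bar> then (if 0 < d then 1 else -1) else (if e < 0 then 1 else -1)) = c"
    "(if \<bar>d\<bar> < \<bar>e\<bar> then (if 0 < e then 1 else -1) else (if d < 0 then 1 else -1)) = - c" by blast+
qed

context approximated_graph
begin

context
  fixes F :: "nat \<Rightarrow> nat \<Rightarrow> int" and c :: int and b :: nat and g g\<^sub>2 :: real
  assumes c: "c \<in> {-1, 1}" and g_le: "g < \<epsilon>"
    and F: "\<And>u v. u \<in> {1..n} \<Longrightarrow> v \<in> {1..n} \<Longrightarrow> v \<notin> amb u \<Longrightarrow> U u + g \<le> U v \<Longrightarrow> F u v = c \<and> F v u = - c"
    and amb_le: "\<And>u. u \<in> {1..n} \<Longrightarrow> card (amb u) \<le> b"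
    and g2: "0 < g\<^sub>2"
    and separators_ge: "\<And>u v. u \<in> {1..n} \<Longrightarrow> v \<in> {1..n} \<Longrightarrow> U u + g\<^sub>2 \<le> U v \<Longrightarrow> 16 * b < card (separators u v)"
begin

lemma card_amb_Un: "u \<in> {1..n} \<Longrightarrow> v \<in> {1..n} \<Longrightarrow> card (amb u \<union> amb v) \<le> 2 * b"
  using card_Un_le[of "amb u" "amb v"] amb_le[of u] amb_le[of v] by linarith

text \<open>A vertex adjacent to only one of \<open>u\<close> and \<open>v\<close> is far from the other one, so that \<open>F\<close> compares it
  correctly with the latter.\<close>

lemma side_counts:
  assumes uv: "u \<in> {1..n}" "v \<in> {1..n}" "U u < U v"
  shows "\<bar>side_count H F u v - c * int (card {x\<in>{1..n}. R (U u) (U x) \<and> \<not> R (U v) (U x)})\<bar> \<le> 4 * int b"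
    and "\<bar>side_count H F v u + c * int (card {x\<in>{1..n}. R (U v) (U x) \<and> \<not> R (U u) (U x)})\<bar> \<le> 4 * int b"
proof -
  have fin: "finite (nbhd H x)" for x
    by (rule finite_subset[of _ "{1..n}"]) (use H_edge in \<open>auto simp: nbhd_def\<close>)
  have nbhd: "x \<in> nbhd H y \<longleftrightarrow> R (U y) (U x)" if "x \<in> {1..n}" "y \<in> {1..n}" "x \<notin> amb y" for x y
    using edge_iff that by (simp add: nbhd_def)
  have nbhd_V: "nbhd H x \<subseteq> {1..n}" for x using H_edge by (auto simp: nbhd_def)
  \<comment> \<open>\<open>signed_count_approx\<close> costs twice the size of this set, hence the
    error \<open>4 * b\<close>.\<close>
  have B: "int (card (amb u \<union> amb v)) \<le> 2 * int b" using card_amb_Un[OF uv(1,2)] by linarith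
  define T1 where "T1 = {x\<in>{1..n}. R (U u) (U x) \<and> \<not> R (U v) (U x)}"
  define T2 where "T2 = {x\<in>{1..n}. R (U v) (U x) \<and> \<not> R (U u) (U x)}"
  have T1: "F x v = c" if "x \<in> T1 - (amb u \<union> amb v)" for x
  proof -
    have x: "x \<in> {1..n}" "R (U u) (U x)" "\<not> R (U v) (U x)" "x \<notin> amb v" using that by (auto simp: T1_def)
    have "U x < U v"
      using R_right[of "U u" "U x" "U v"] x uv U01[OF x(1)] U01[OF uv(1)] U01[OF uv(2)] by fastforce
    moreover have "\<not> \<bar>U v - U x\<bar> \<le> \<epsilon>"
      using R_near[of "U v" "U x"] x U01[OF x(1)] U01[OF uv(2)] by blast
    ultimately have "U x + g \<le> U v" using g_le by linarith
    then show ?thesis using F[of x v] x uv amb_sym[of x v] by auto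
  qed
  have T2: "F x u = - c" if "x \<in> T2 - (amb u \<union> amb v)" for x
  proof -
    have x: "x \<in> {1..n}" "R (U v) (U x)" "\<not> R (U u) (U x)" "x \<notin> amb u" using that by (auto simp: T2_def)
    have "U u < U x"
    proof (rule ccontr)
      assume "\<not> ?thesis"
      then show False
        using R_left[of "U x" "U v" "U u"] R_sym[of "U x" "U v"] R_sym[of "U x" "U u"] x uv
          U01[OF x(1)] U01[OF uv(1)] U01[OF uv(2)] by auto
    qed
    moreover have "\<not> \<bar>U u - U x\<bar> \<le> \<epsilon>"
      using R_near[of "U u" "U x"] x U01[OF x(1)] U01[OF uv(1)] by blast
    ultimately have "U u + g \<le> U x" using g_le by linarith
    then show ?thesis using F[of u x] x uv by auto
  qed
  have eq1: "(nbhd H u - nbhd H v) - (amb u \<union> amb v) = T1 - (amb u \<union> amb v)"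
    using nbhd[OF _ uv(1)] nbhd[OF _ uv(2)] nbhd_V unfolding T1_def by blast
  have eq2: "(nbhd H v - nbhd H u) - (amb u \<union> amb v) = T2 - (amb u \<union> amb v)"
    using nbhd[OF _ uv(1)] nbhd[OF _ uv(2)] nbhd_V unfolding T2_def by blast
  have finT: "finite T1" "finite T2" by (auto simp: T1_def T2_def)
  show "\<bar>side_count H F u v - c * int (card {x\<in>{1..n}. R (U u) (U x) \<and> \<not> R (U v) (U x)})\<bar> \<le> 4 * int b"
    using signed_count_approx[OF _ finT(1) _ eq1, of "\<lambda>x. F x v" c] T1 fin B c
    unfolding side_count_def T1_def[symmetric] by fastforce
  show "\<bar>side_count H F v u + c * int (card {x\<in>{1..n}. R (U v) (U x) \<and> \<not> R (U u) (U x)})\<bar> \<le> 4 * int b"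
    using signed_count_approx[OF _ finT(2) _ eq2, of "\<lambda>x. F x u" "- c"] T2 fin B c
    unfolding side_count_def T2_def[symmetric] by fastforce
qed

text \<open>The two sides together contain all separators of \<open>u\<close> and \<open>v\<close>,
  so \<open>separators_ge\<close> supplies the margin \<open>16 * b\<close> of
  \<open>dominant_side\<close>. The smaller side alone may be drowned by misclassified
  vertices.\<close>

lemma local_refinement_correct:
  assumes uv: "u \<in> {1..n}" "v \<in> {1..n}" "U u + g\<^sub>2 \<le> U v"
  shows "local_refinement H F u v = c" "local_refinement H F v u = - c"
proof -
  have lt: "U u < U v" using uv(3) g2 by linarith
  define X where "X = card {x\<in>{1..n}. R (U u) (U x) \<and> \<not> R (U v) (U x)}"
  define Y where "Y = card {x\<in>{1..n}. R (U v) (U x) \<and> \<not> R (U u) (U x)}"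
  have "separators u v = {x\<in>{1..n}. R (U u) (U x) \<and> \<not> R (U v) (U x)} \<union> {x\<in>{1..n}. R (U v) (U x) \<and> \<not> R (U u) (U x)}"
    by (auto simp: separators_def)
  then have "card (separators u v) \<le> X + Y" by (simp only: X_def Y_def card_Un_le)
  then have "16 * b < X + Y" using separators_ge[OF uv] by linarith
  then have XY: "16 * int b < int X + int Y" by linarith
  note d = dominant_side[OF c side_counts[OF uv(1,2) lt, folded X_def Y_def] XY]
  have ne: "u \<noteq> v" using lt by auto
  show "local_refinement H F u v = c" "local_refinement H F v u = - c"
    unfolding local_refinement_def antisym_ext_def
    using d ne by (cases u v rule: linorder_cases; simp)+
qed

end

end

lemma local_refinement_bounded: "\<bar>local_refinement H F u v\<bar> \<le> 1"
  by (auto simp: local_refinement_def antisym_ext_def)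

text \<open>A perfect comparison gives \<open>i\<close> the score \<open>c\<close> times the number
  of vertices up to \<open>i\<close> minus the number beyond it, that is
  \<open>c * (2 * true_order n U i - n)\<close>. Only vertices within distance \<open>r\<close>,
  among them \<open>i\<close> itself, can deviate, each by at most 2.\<close>

lemma score_approx:
  fixes F :: "nat \<Rightarrow> nat \<Rightarrow> int" and c :: int and U :: "nat \<Rightarrow> real"
  assumes "\<And>u v. \<bar>F u v\<bar> \<le> 1" and c: "c \<in> {-1, 1}"
    and F: "\<And>u v. u \<in> {1..n} \<Longrightarrow> v \<in> {1..n} \<Longrightarrow> U u + r \<le> U v \<Longrightarrow> F u v = c \<and> F v u = - c"
    and i: "i \<in> {1..n}"
    and W: "card {k\<in>{1..n}. \<bar>U k - U i\<bar> < r} \<le> W" and r: "0 < r"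
  shows "\<bar>(\<Sum>k\<in>{1..n}. F k i) - c * (2 * int (true_order n U i) - int n)\<bar> \<le> 2 * int W"
proof -
  have "int (true_order n U i) = (\<Sum>k\<in>{1..n}. if U k \<le> U i then 1 else 0)"
    unfolding true_order_def by (simp flip: sum.inter_filter)
  moreover have "int n = (\<Sum>k\<in>{1..n}. 1)" by simp
  ultimately have "2 * int (true_order n U i) - int n = (\<Sum>k\<in>{1..n}. if U k \<le> U i then 1 else -1)"
    by (simp only: sum_distrib_left sum_subtractf[symmetric]) (auto intro!: sum.cong)
  then have "\<bar>(\<Sum>k\<in>{1..n}. F k i) - c * (2 * int (true_order n U i) - int n)\<bar>
      = \<bar>\<Sum>k\<in>{1..n}. F k i - c * (if U k \<le> U i then 1 else -1)\<bar>"
    by (simp only: sum_distrib_left sum_subtractf)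
  also have "\<dots> \<le> (\<Sum>k\<in>{1..n}. \<bar>F k i - c * (if U k \<le> U i then 1 else -1)\<bar>)"
    by (rule sum_abs)
  also have "\<dots> \<le> (\<Sum>k\<in>{1..n}. if \<bar>U k - U i\<bar> < r then 2 else 0)"
  proof (rule sum_mono)
    fix k assume k: "k \<in> {1..n}"
    show "\<bar>F k i - c * (if U k \<le> U i then 1 else -1)\<bar> \<le> (if \<bar>U k - U i\<bar> < r then 2 else 0)"
    proof (cases "\<bar>U k - U i\<bar> < r")
      case True
      then show ?thesis using assms(1)[of k i] c by auto
    next
      case False
      then have "U k + r \<le> U i \<or> U i + r \<le> U k" by linarith
      then show ?thesis using F[OF k i] F[OF i k] r by auto
    qed
  qed
  also have "\<dots> = 2 * int (card {k\<in>{1..n}. \<bar>U k - U i\<bar> < r})"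
    by (simp flip: sum.inter_filter)
  finally show ?thesis using W by linarith
qed

text \<open>Ranks that differ by more than \<open>2 * W\<close> have ideal scores differing by more
  than \<open>4 * W\<close>, which two errors of \<open>2 * W\<close> cannot reverse. The sign
  \<open>c\<close> selects the true or the reverse order as the correct one.\<close>

lemma error_of_ranking:
  fixes F :: "nat \<Rightarrow> nat \<Rightarrow> int" and c :: int
  assumes rank: "ranking n F \<sigma>" and c: "c \<in> {-1, 1}"
    and approx: "\<And>i. i \<in> {1..n} \<Longrightarrow>
      \<bar>(\<Sum>k\<in>{1..n}. F k i) - c * (2 * int (true_order n U i) - int n)\<bar> \<le> 2 * int W"
    and D: "2 * real W \<le> D"
  shows "error_less n U D \<sigma>"
proof -
  \<comment> \<open>Ensures that the natural subtraction in \<open>reverse_order\<close> does not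
    truncate.\<close>
  have le: "true_order n U i \<le> n" for i
    unfolding true_order_def by (rule order.trans[OF card_mono[of "{1..n}"]]) auto
  have less: "\<sigma> j < \<sigma> i"
    if "i \<in> {1..n}" "j \<in> {1..n}" "c * (int (true_order n U i) - int (true_order n U j)) > 2 * int W" for i j
  proof -
    have "(\<Sum>k\<in>{1..n}. F k j) < (\<Sum>k\<in>{1..n}. F k i)"
      using approx[OF that(1)] approx[OF that(2)] that(3) c by auto
    then show ?thesis using rank that by (auto simp: ranking_def)
  qed
  show ?thesis
  proof (cases "c = 1")
    case True
    have "\<sigma> j < \<sigma> i" if "i \<in> {1..n}" "j \<in> {1..n}" "real (true_order n U i) > real (true_order n U j) + D" for i j
      using less[OF that(1,2)] that(3) D True by auto
    then show ?thesis unfolding error_less_def by blast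
  next
    case False
    then have c: "c = -1" using c by simp
    have "\<sigma> j < \<sigma> i" if "i \<in> {1..n}" "j \<in> {1..n}" "real (reverse_order n U i) > real (reverse_order n U j) + D" for i j
      using less[OF that(1,2)] that(3) D c le[of i] le[of j] by (auto simp: reverse_order_def of_nat_diff)
    then show ?thesis unfolding error_less_def by blast
  qed
qed

context reliable_sketches
begin

theorem ranking_error:
  assumes g_less: "g < \<epsilon>"
    and "\<And>u. u \<in> {1..n} \<Longrightarrow> card (amb u) \<le> b"
    and g2: "0 < g\<^sub>2"
    and "\<And>u v. u \<in> {1..n} \<Longrightarrow> v \<in> {1..n} \<Longrightarrow> U u + g\<^sub>2 \<le> U v \<Longrightarrow> 16 * b < card (separators u v)"
    and W: "\<And>i. i \<in> {1..n} \<Longrightarrow> card {k\<in>{1..n}. \<bar>U k - U i\<bar> < g\<^sub>2} \<le> W"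
    and D: "2 * real W \<le> D"
    and a: "consistent_signs m \<zeta> Q a"
    and rank: "ranking n (local_refinement H (sketch_comparison m Q a)) \<sigma>"
  shows "error_less n U D \<sigma>"
proof -
  obtain c where c: "c \<in> {-1, 1}" "\<And>j. j < length Q \<Longrightarrow> a j = c * sketch_sign j"
    using consistent_signs_unique[OF a] by blast
  have "local_refinement H (sketch_comparison m Q a) u v = c \<and> local_refinement H (sketch_comparison m Q a) v u = - c"
    if "u \<in> {1..n}" "v \<in> {1..n}" "U u + g\<^sub>2 \<le> U v" for u v
    using local_refinement_correct[OF c(1) g_less _ assms(2) g2 assms(4) that]
      sketch_comparison_correct[OF c] by auto
  then have "\<bar>(\<Sum>k\<in>{1..n}. local_refinement H (sketch_comparison m Q a) k i) -
      c * (2 * int (true_order n U i) - int n)\<bar> \<le> 2 * int W" if "i \<in> {1..n}" for i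
    using score_approx[where F = "local_refinement H (sketch_comparison m Q a)" and U = U and r = g\<^sub>2,
        OF local_refinement_bounded c(1) _ that W[OF that] g2] by blast
  then show ?thesis by (rule error_of_ranking[OF rank c(1) _ D])
qed

end

section \<open>Successful samples and the output\<close>

context approximated_graph
begin

text \<open>Without misclassified pairs \<open>H\<close> on \<open>S\<close> is the relation
  \<open>R\<close> of the positions. Sorting by position is then an interval order by monotonicity
  of \<open>R\<close>, and the nonempty consecutive cells connect the sample.\<close>

lemma clean_sample_succeeds:
  assumes S: "S \<subseteq> {1..n}" and clean: "\<And>u v. u \<in> S \<Longrightarrow> v \<in> S \<Longrightarrow> u \<noteq> v \<Longrightarrow> v \<notin> amb u"
    and cells: "\<And>i. i < K \<Longrightarrow> S \<inter> cell K i \<noteq> {}" and K: "0 < K" "2 / real K \<le> \<epsilon>"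
  shows "induced_connected H S" "unit_interval_graph H S"
proof -
  have fin: "finite S" using S by (auto intro: finite_subset)
  have edge: "{u, v} \<in> H \<longleftrightarrow> R (U u) (U v)" if "u \<in> S" "v \<in> S" "u \<noteq> v" for u v
    using edge_iff[OF _ _ clean[OF that]] S that by blast
  define E where "E = {(x, y). x \<in> S \<and> y \<in> S \<and> {x, y} \<in> H}"
  have symE: "sym E" by (auto simp: E_def sym_def insert_commute)
  have step: "(u, v) \<in> E\<^sup>*" if "u \<in> S" "v \<in> S" "R (U u) (U v)" for u v
    using that edge[of u v] by (cases "u = v") (auto simp: E_def)
  define f where "f i = (SOME u. u \<in> S \<inter> cell K i)" for i
  have f: "f i \<in> S \<inter> cell K i" if "i < K" for i
    unfolding f_def using cells[OF that] by (rule some_in_eq[THEN iffD2])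
  have first: "(f 0, f i) \<in> E\<^sup>*" if "i < K" for i
    using that
  proof (induction i)
    case (Suc i)
    have "R (U (f i)) (U (f (Suc i)))"
      using f[of i] f[of "Suc i"] Suc.prems K by (intro adjacent_cells[of _ K i _ "Suc i"]) auto
    then show ?case using Suc step[of "f i" "f (Suc i)"] f[of i] f[of "Suc i"] by (auto intro: rtrancl_trans)
  qed simp
  have reach: "(f 0, u) \<in> E\<^sup>*" if u: "u \<in> S" for u
  proof -
    obtain i where i: "i < K" "u \<in> cell K i" using in_some_cell[OF subsetD[OF S u] K(1)] by blast
    have "R (U (f i)) (U u)" using f[of i] i K by (intro adjacent_cells[of _ K i _ i]) auto
    then show ?thesis using first[OF i(1)] step[of "f i" u] f[of i] i u by (auto intro: rtrancl_trans)
  qed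
  have "(u, v) \<in> E\<^sup>*" if "u \<in> S" "v \<in> S" for u v
    using reach[OF that(1)] reach[OF that(2)] symE by (meson rtrancl_trans sym_rtrancl symD)
  then show "induced_connected H S" by (simp add: induced_connected_def E_def)
  obtain \<sigma> where \<sigma>: "bij_betw \<sigma> S {1..card S}" "\<And>u v. u \<in> S \<Longrightarrow> v \<in> S \<Longrightarrow> \<sigma> u < \<sigma> v \<Longrightarrow> U u \<le> U v"
    using sorting_exists[OF fin, of U] by blast
  have "{u, v} \<in> H \<and> {v, x} \<in> H"
    if "u \<in> S" "v \<in> S" "x \<in> S" "\<sigma> u < \<sigma> v" "\<sigma> v < \<sigma> x" "{u, x} \<in> H" for u v x
  proof -
    have ne: "u \<noteq> v" "v \<noteq> x" "u \<noteq> x" using that by auto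
    have le: "U u \<le> U v" "U v \<le> U x" using \<sigma>(2) that by auto
    have R: "R (U u) (U x)" using edge[OF that(1,3) ne(3)] that(6) by simp
    note 01 = U01[OF subsetD[OF S that(1)]] U01[OF subsetD[OF S that(3)]]
    have "R (U u) (U v)" by (rule R_left[OF 01 le R])
    moreover have "R (U v) (U x)" by (rule R_right[OF 01 le R])
    ultimately show ?thesis using edge[OF that(1,2) ne(1)] edge[OF that(2,3) ne(2)] by simp
  qed
  then have "interval_order H S \<sigma>" using \<sigma>(1) by (auto simp: interval_order_def)
  then show "unit_interval_graph H S" by (auto simp: unit_interval_graph_def)
qed

end

abbreviation successful :: "graph \<Rightarrow> nat set \<Rightarrow> bool" where
  "successful H S \<equiv> induced_connected H S \<and> unit_interval_graph H S"

lemma filter_prefix_of_length: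
  assumes "t \<le> length (filter P xs)"
  shows "\<exists>N\<le>length xs. length (filter P (take N xs)) = t"
  using assms
proof (induction xs rule: rev_induct)
  case (snoc x xs)
  show ?case
  proof (cases "t \<le> length (filter P xs)")
    case True
    then obtain N where "N \<le> length xs" "length (filter P (take N xs)) = t" using snoc.IH by blast
    then show ?thesis by (intro exI[of _ N]) auto
  next
    case False
    then show ?thesis using snoc.prems by (intro exI[of _ "Suc (length xs)"]) (auto split: if_splits)
  qed
qed simp

lemma sketching_exists:
  assumes "t \<le> length (filter (successful H) (map d [0..<M]))"
  shows "\<exists>Q. sketching H t d Q"
proof -
  obtain N where N: "N \<le> M" "length (filter (successful H) (map d [0..<N])) = t"
    using filter_prefix_of_length[OF assms] by (auto simp: take_map)
  define Q where "Q = map (\<lambda>S. (SOME \<sigma>. interval_order H S \<sigma>, S)) (filter (successful H) (map d [0..<N]))"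
  have "map snd Q = filter (successful H) (map d [0..<N])"
    by (simp add: Q_def comp_def)
  moreover have "length Q = t" using N(2) by (simp add: Q_def)
  moreover have "\<forall>(\<sigma>, S)\<in>set Q. interval_order H S \<sigma>"
    unfolding Q_def unit_interval_graph_def by (auto intro: someI[of "interval_order H _"])
  ultimately show ?thesis unfolding sketching_def by blast
qed

text \<open>As the first \<open>M\<close> draws contain \<open>t\<close> successes, no recorded
  sample comes later; and as \<open>t\<close> successes take at least \<open>t\<close> draws, every
  success among the first \<open>t\<close> draws is recorded.\<close>

lemma sketching_draws:
  assumes Q: "sketching H t d Q" and t: "t \<le> length (filter (successful H) (map d [0..<M]))"
  shows "snd ` set Q \<subseteq> d ` {..<M}"
    and "\<And>j. j < t \<Longrightarrow> successful H (d j) \<Longrightarrow> d j \<in> snd ` set Q"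
proof -
  obtain N where N: "map snd Q = filter (successful H) (map d [0..<N])" "length Q = t"
    using Q by (auto simp: sketching_def)
  have len: "length (filter (successful H) (map d [0..<N])) = t" using N by (metis length_map)
  have set: "snd ` set Q = {S \<in> d ` {..<N}. successful H S}"
    using arg_cong[OF N(1), of set] by (auto simp: atLeast0LessThan)
  show "snd ` set Q \<subseteq> d ` {..<M}"
  proof (cases "N \<le> M")
    case True
    then show ?thesis using set by auto
  next
    case False
    then have "[0..<N] = [0..<M] @ [M..<N]" by (metis le_add_diff_inverse less_imp_le not_le upt_add_eq_append zero_le)
    then have "length (filter (successful H) (map d [0..<N])) =
      length (filter (successful H) (map d [0..<M])) + length (filter (successful H) (map d [M..<N]))"
      by (simp only: map_append filter_append length_append)
    then have "length (filter (successful H) (map d [M..<N])) = 0" using len t by linarith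
    then have "\<not> successful H (d j)" if "M \<le> j" "j < N" for j
      using that by (auto simp: filter_empty_conv)
    then show ?thesis using set by (auto simp: not_less[symmetric])
  qed
  have "t \<le> N" using len length_filter_le[of "successful H" "map d [0..<N]"] by simp
  then show "d j \<in> snd ` set Q" if "j < t" "successful H (d j)" for j
    using set that by auto
qed

lemma square_threshold_edge:
  "{u, v} \<in> square_threshold n \<alpha> E \<Longrightarrow> u \<noteq> v \<and> u \<in> {1..n} \<and> v \<in> {1..n}"
  by (auto simp: square_threshold_def doubleton_eq_iff)

lemma square_threshold_iff:
  "{u, v} \<in> square_threshold n \<alpha> E \<longleftrightarrow> u \<noteq> v \<and> u \<in> {1..n} \<and> v \<in> {1..n} \<and>
     real (card {x\<in>{1..n}. {u, x} \<in> E \<and> {v, x} \<in> E}) > \<alpha> * (real n - 2)"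
  by (auto simp: square_threshold_def doubleton_eq_iff conj_commute)

text \<open>The existence clause matters: with fewer than \<open>t\<close> successes there would be
  no output and the second clause would hold vacuously.\<close>

definition correct_outputs ::
  "nat \<Rightarrow> real \<Rightarrow> nat \<Rightarrow> nat \<Rightarrow> real \<Rightarrow> real \<Rightarrow> graph \<Rightarrow> (nat \<Rightarrow> real) \<Rightarrow> (nat \<Rightarrow> nat set) \<Rightarrow> bool" where
  "correct_outputs n \<alpha> m t \<zeta> D E U d \<longleftrightarrow> (\<exists>\<sigma>. estimation_output n \<alpha> m t \<zeta> E d \<sigma>) \<and>
     (\<forall>\<sigma>. estimation_output n \<alpha> m t \<zeta> E d \<sigma> \<longrightarrow> bij_betw \<sigma> {1..n} {1..n} \<and> error_less n U D \<sigma>)"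

text \<open>Goodness is demanded of all of the first \<open>M\<close> draws, successful or not, so
  that its failure can be estimated by a union bound without conditioning on success.\<close>

lemma (in sampling_scale) output_correct:
  fixes \<alpha> :: real and E :: graph and d :: "nat \<Rightarrow> nat set"
  assumes H: "H = square_threshold n \<alpha> E"
    and draws: "\<And>j. j < M \<Longrightarrow> good_sample m K k g \<zeta> (d j)"
    and t: "t \<le> length (filter (successful H) (map d [0..<M]))"
    and pairs: "\<And>u v. u \<in> {1..n} \<Longrightarrow> v \<in> {1..n} \<Longrightarrow> v \<notin> amb u \<Longrightarrow>
        \<exists>j<t. u \<in> d j \<and> v \<in> d j \<and> successful H (d j)"
    and near_clear: "\<And>u v. u \<in> {1..n} \<Longrightarrow> v \<in> {1..n} \<Longrightarrow> u \<noteq> v \<Longrightarrow> \<bar>U u - U v\<bar> \<le> \<epsilon> \<Longrightarrow> v \<notin> amb u"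
    and g_less: "g < \<epsilon>"
    and amb_le: "\<And>u. u \<in> {1..n} \<Longrightarrow> card (amb u) \<le> b"
    and g2: "0 < g\<^sub>2"
    and seps: "\<And>u v. u \<in> {1..n} \<Longrightarrow> v \<in> {1..n} \<Longrightarrow> U u + g\<^sub>2 \<le> U v \<Longrightarrow> 16 * b < card (separators u v)"
    and W: "\<And>i. i \<in> {1..n} \<Longrightarrow> card {k\<in>{1..n}. \<bar>U k - U i\<bar> < g\<^sub>2} \<le> W"
    and D: "2 * real W \<le> D"
  shows "correct_outputs n \<alpha> m t \<zeta> D E U d"
proof -
  have rel: "reliable_sketches R \<epsilon> n U H m K k g \<zeta> Q" if Q: "sketching H t d Q" for Q
  proof
    note sk = sketching_draws[OF Q t]
    fix j assume j: "j < length Q"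
    then have "snd (Q ! j) \<in> snd ` set Q" by simp
    then have "snd (Q ! j) \<in> d ` {..<M}" using sk(1) by (rule rev_subsetD)
    then show "good_sample m K k g \<zeta> (snd (Q ! j))" by (auto intro: draws)
    show "interval_order H (snd (Q ! j)) (fst (Q ! j))"
      using Q nth_mem[OF j] by (auto simp: sketching_def)
  next
    note sk = sketching_draws[OF Q t]
    fix u v assume "u \<in> {1..n}" "v \<in> {1..n}" "v \<notin> amb u"
    then obtain j where j: "j < t" "u \<in> d j" "v \<in> d j" "successful H (d j)" using pairs by blast
    then obtain i where "i < length Q" "snd (Q ! i) = d j"
      using sk(2) by (force simp: image_iff in_set_conv_nth)
    then show "\<exists>j<length Q. u \<in> snd (Q ! j) \<and> v \<in> snd (Q ! j)"
      using j by auto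
  qed (use near_clear in auto)
  obtain Q where Q: "sketching H t d Q" using sketching_exists[OF t] by blast
  have "\<exists>a. consistent_signs m \<zeta> Q a" if "sketching H t d Q" for Q
    using reliable_sketches.signs_consistent[OF rel[OF that]] by blast
  moreover have "error_less n U D \<sigma>"
    if "sketching H t d Q" "consistent_signs m \<zeta> Q a" "ranking n (local_refinement H (sketch_comparison m Q a)) \<sigma>"
    for Q a \<sigma>
    by (rule reliable_sketches.ranking_error[OF rel[OF that(1)] g_less amb_le g2 seps W D that(2,3)])
  moreover have "bij_betw \<sigma> {1..n} {1..n}" if "ranking n F \<sigma>" for F \<sigma>
    using that by (simp add: ranking_def)
  ultimately show ?thesis
    using Q ranking_exists unfolding correct_outputs_def estimation_output_def Let_def H[symmetric] by blast
qed

section \<open>Uniformly random subsets\<close>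

abbreviation subset_pmf :: "nat \<Rightarrow> nat \<Rightarrow> nat set pmf" where
  "subset_pmf n m \<equiv> pmf_of_set {S. S \<subseteq> {1..n} \<and> card S = m}"

lemma subset_family:
  assumes "m \<le> n"
  shows "finite {S. S \<subseteq> {1..n} \<and> card S = m}" "{S. S \<subseteq> {1..n} \<and> card S = m} \<noteq> {}"
    "card {S. S \<subseteq> {1..n} \<and> card S = m} = n choose m"
proof -
  show "finite {S. S \<subseteq> {1..n} \<and> card S = m}" by (rule finite_subset[of _ "Pow {1..n}"]) auto
  show "card {S. S \<subseteq> {1..n} \<and> card S = m} = n choose m" using n_subsets[of "{1..n}" m] by simp
  then show "{S. S \<subseteq> {1..n} \<and> card S = m} \<noteq> {}" using assms by (metis card.empty zero_less_binomial_iff less_irrefl)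
qed

lemma subset_pmf_prob:
  assumes "m \<le> n"
  shows "measure (subset_pmf n m) A = real (card {S. S \<subseteq> {1..n} \<and> card S = m \<and> S \<in> A}) / real (n choose m)"
proof -
  have "{S. S \<subseteq> {1..n} \<and> card S = m} \<inter> A = {S. S \<subseteq> {1..n} \<and> card S = m \<and> S \<in> A}" by auto
  then show ?thesis using subset_family[OF assms] by (simp add: measure_pmf_of_set)
qed

lemma card_subsets_containing:
  assumes "J \<subseteq> {1..n}" "card J \<le> m"
  shows "card {S. S \<subseteq> {1..n} \<and> card S = m \<and> J \<subseteq> S} = (n - card J) choose (m - card J)"
proof -
  have fin: "finite J" using assms(1) by (auto intro: finite_subset)
  have "bij_betw (\<lambda>B. B \<union> J) {B. B \<subseteq> {1..n} - J \<and> card B = m - card J} {S. S \<subseteq> {1..n} \<and> card S = m \<and> J \<subseteq> S}"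
  proof (rule bij_betw_byWitness[where f' = "\<lambda>S. S - J"])
    show "(\<lambda>B. B \<union> J) ` {B. B \<subseteq> {1..n} - J \<and> card B = m - card J} \<subseteq> {S. S \<subseteq> {1..n} \<and> card S = m \<and> J \<subseteq> S}"
    proof safe
      fix B assume B: "B \<subseteq> {1..n} - J" "card B = m - card J"
      then have "finite B" "B \<inter> J = {}" by (auto intro: finite_subset)
      then show "card (B \<union> J) = m" using B(2) fin assms by (simp add: card_Un_disjoint)
    qed (use assms in auto)
    show "(\<lambda>S. S - J) ` {S. S \<subseteq> {1..n} \<and> card S = m \<and> J \<subseteq> S} \<subseteq> {B. B \<subseteq> {1..n} - J \<and> card B = m - card J}"
      using fin by (auto simp: card_Diff_subset)
  qed auto
  then show ?thesis
    using bij_betw_same_card n_subsets[of "{1..n} - J" "m - card J"] fin assms by (fastforce simp: card_Diff_subset)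
qed

lemma card_subsets_avoiding:
  assumes "J \<subseteq> {1..n}"
  shows "card {S. S \<subseteq> {1..n} \<and> card S = m \<and> S \<inter> J = {}} = (n - card J) choose m"
proof -
  have "{S. S \<subseteq> {1..n} \<and> card S = m \<and> S \<inter> J = {}} = {S. S \<subseteq> {1..n} - J \<and> card S = m}" by auto
  then show ?thesis
    using n_subsets[of "{1..n} - J" m] finite_subset[OF assms] assms by (simp add: card_Diff_subset)
qed

lemma eq_ratio_mult: "(b::real) \<noteq> 0 \<Longrightarrow> a * y = b * x \<Longrightarrow> x = a / b * y"
  by (simp add: field_simps)

text \<open>The quotient for one more prescribed element is
  \<open>(m - j) / (n - j) \<le> m / n\<close>.\<close>

lemma binomial_containing_ratio:
  assumes "j \<le> m" "m \<le> n" "0 < n"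
  shows "real ((n - j) choose (m - j)) \<le> (real m / real n) ^ j * real (n choose m)"
  using assms(1)
proof (induction j)
  case (Suc j)
  have pos: "0 < m - j" "0 < n - j" using Suc.prems assms by auto
  have "(m - j) * ((n - j) choose (m - j)) = (n - j) * ((n - Suc j) choose (m - Suc j))"
    using times_binomial_minus1_eq[OF pos(1), of "n - j"] by simp
  then have "real (m - j) * real ((n - j) choose (m - j)) = real (n - j) * real ((n - Suc j) choose (m - Suc j))"
    by (metis of_nat_mult)
  then have "real ((n - Suc j) choose (m - Suc j)) = real (m - j) / real (n - j) * real ((n - j) choose (m - j))"
    using pos by (intro eq_ratio_mult) auto
  also have "\<dots> \<le> real m / real n * real ((n - j) choose (m - j))"
  proof (rule mult_right_mono)
    have "real (m - j) * real n \<le> real m * real (n - j)"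
      using Suc.prems assms mult_left_mono[of "real m" "real n" "real j"]
      by (simp add: of_nat_diff algebra_simps)
    then show "real (m - j) / real (n - j) \<le> real m / real n"
      using pos assms by (simp add: field_simps)
  qed simp
  also have "\<dots> \<le> real m / real n * ((real m / real n) ^ j * real (n choose m))"
    using Suc by (intro mult_left_mono) auto
  finally show ?case by simp
qed simp

text \<open>The quotient for one more forbidden element is
  \<open>(n - j - m) / (n - j) \<le> 1 - m / n\<close>; for \<open>n - j < m\<close> natural
  subtraction makes it 0.\<close>

lemma binomial_avoiding_ratio:
  assumes "j \<le> n" "m \<le> n" "0 < n"
  shows "real ((n - j) choose m) \<le> (1 - real m / real n) ^ j * real (n choose m)"
  using assms(1)
proof (induction j)
  case (Suc j)
  have pos: "0 < n - j" using Suc.prems by auto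
  have le1: "real m / real n \<le> 1" using assms by simp
  have "(n - j - m) * ((n - j) choose m) = (n - j) * ((n - Suc j) choose m)"
    using binomial_absorb_comp[of "n - j" m] by simp
  then have "real (n - j - m) * real ((n - j) choose m) = real (n - j) * real ((n - Suc j) choose m)"
    by (metis of_nat_mult)
  then have "real ((n - Suc j) choose m) = real (n - j - m) / real (n - j) * real ((n - j) choose m)"
    using pos by (intro eq_ratio_mult) auto
  also have "\<dots> \<le> (1 - real m / real n) * real ((n - j) choose m)"
  proof (rule mult_right_mono)
    show "real (n - j - m) / real (n - j) \<le> 1 - real m / real n"
    proof (cases "m \<le> n - j")
      case True
      then have "real (n - j - m) / real (n - j) = 1 - real m / real (n - j)"
        using pos by (simp add: of_nat_diff field_simps)
      moreover have "real m / real n \<le> real m / real (n - j)"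
        using pos by (intro divide_left_mono) auto
      ultimately show ?thesis by (metis diff_left_mono)
    qed (use le1 in auto)
  qed simp
  also have "\<dots> \<le> (1 - real m / real n) * ((1 - real m / real n) ^ j * real (n choose m))"
    using Suc le1 by (intro mult_left_mono) auto
  finally show ?case by simp
qed simp

text \<open>Sampling without replacement is negatively correlated: prescribed elements are jointly
  no likelier than under independent inclusion. This is the hypothesis of
  \<open>moment_bound\<close>.\<close>

lemma subset_pmf_containing:
  assumes "m \<le> n" "0 < n" "J \<subseteq> {1..n}"
  shows "measure (subset_pmf n m) {S. J \<subseteq> S} \<le> (real m / real n) ^ card J"
proof (cases "card J \<le> m")
  case True
  then show ?thesis
    using binomial_containing_ratio[OF True assms(1,2)] card_subsets_containing[OF assms(3) True] assms(1)
    unfolding subset_pmf_prob[OF assms(1)] mem_Collect_eq by (simp add: divide_le_eq)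
next
  case False
  have "card J \<le> card S" if "S \<subseteq> {1..n}" "J \<subseteq> S" for S
    using that by (auto intro: card_mono finite_subset)
  with False have "{S. S \<subseteq> {1..n} \<and> card S = m \<and> J \<subseteq> S} = {}" by blast
  then have "measure (subset_pmf n m) {S. J \<subseteq> S} = 0"
    unfolding subset_pmf_prob[OF assms(1)] mem_Collect_eq by simp
  then show ?thesis by simp
qed

lemma subset_pmf_avoiding:
  assumes "m \<le> n" "0 < n" "J \<subseteq> {1..n}"
  shows "measure (subset_pmf n m) {S. S \<inter> J = {}} \<le> (1 - real m / real n) ^ card J"
proof -
  have "card J \<le> n" using card_mono[OF finite_atLeastAtMost assms(3)] by simp
  then have "real (n - card J choose m) \<le> (1 - real m / real n) ^ card J * real (n choose m)"
    by (rule binomial_avoiding_ratio[OF _ assms(1,2)])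
  moreover have "real (n choose m) > 0" using assms(1) by simp
  ultimately show ?thesis
    unfolding subset_pmf_prob[OF assms(1)] mem_Collect_eq card_subsets_avoiding[OF assms(3)]
    by (simp only: divide_le_eq if_True)
qed

section \<open>Tail bounds for the intersection with a random subset\<close>

lemma power_card_eq_sum:
  fixes s :: real
  assumes "finite T"
  shows "(1 + s) ^ card T = (\<Sum>J\<in>Pow T. s ^ card J)"
  using prod_add[OF assms, of "\<lambda>_. s" "\<lambda>_. 1"] by (simp add: add.commute)

text \<open>\<open>(1 + s) ^ card (f S)\<close> is the sum of \<open>s ^ card J\<close> over the subsets \<open>J\<close> of \<open>f S\<close>, so that no
  independence is needed.\<close>

lemma moment_bound:
  fixes p :: "'a pmf" and s q :: real and f :: "'a \<Rightarrow> 'b set"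
  assumes fin: "finite (set_pmf p)" "finite T" and s: "0 \<le> s"
    and f: "\<And>S. f S \<subseteq> T"
    and q: "\<And>J. J \<subseteq> T \<Longrightarrow> measure p {S. J \<subseteq> f S} \<le> q ^ card J"
  shows "measure p {S. a \<le> real (card (f S))} * (1 + s) powr a \<le> (1 + s * q) ^ card T"
proof -
  have int: "integrable p g" for g :: "'a \<Rightarrow> real"
    by (rule integrable_measure_pmf_finite[OF fin(1)])
  have "(1 + s) ^ card (f S) = (\<Sum>J\<in>Pow T. s ^ card J * indicator {S. J \<subseteq> f S} S)" for S
  proof -
    have "(1 + s) ^ card (f S) = (\<Sum>J\<in>Pow (f S). s ^ card J)"
      using power_card_eq_sum finite_subset[OF f fin(2)] by blast
    also have "\<dots> = (\<Sum>J\<in>Pow T. s ^ card J * indicator {S. J \<subseteq> f S} S)"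
      using f[of S] fin(2) by (intro sum.mono_neutral_cong_left) (auto simp: indicator_def)
    finally show ?thesis .
  qed
  then have "measure_pmf.expectation p (\<lambda>S. (1 + s) ^ card (f S)) =
      (\<Sum>J\<in>Pow T. s ^ card J * measure p {S. J \<subseteq> f S})"
    by (simp add: Bochner_Integration.integral_sum[OF int])
  also have "\<dots> \<le> (\<Sum>J\<in>Pow T. s ^ card J * q ^ card J)"
    using q s by (intro sum_mono mult_left_mono) auto
  also have "\<dots> = (1 + s * q) ^ card T"
    using power_card_eq_sum[OF fin(2), of "s * q"] by (simp add: power_mult_distrib)
  finally have E: "measure_pmf.expectation p (\<lambda>S. (1 + s) ^ card (f S)) \<le> (1 + s * q) ^ card T" .
  have "measure p {S. a \<le> real (card (f S))} * (1 + s) powr a =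
      measure_pmf.expectation p (\<lambda>S. indicator {S. a \<le> real (card (f S))} S * (1 + s) powr a)"
    by simp
  also have "\<dots> \<le> measure_pmf.expectation p (\<lambda>S. (1 + s) ^ card (f S))"
  proof (rule integral_mono[OF int int])
    fix S
    show "indicator {S. a \<le> real (card (f S))} S * (1 + s) powr a \<le> (1 + s) ^ card (f S)"
      using s powr_mono[of a "real (card (f S))" "1 + s"] by (auto simp: indicator_def powr_realpow)
  qed
  finally show ?thesis using E by simp
qed

text \<open>\<open>moment_bound\<close> together with \<open>1 + x \<le> exp x\<close>. The
  parameter \<open>s\<close> stays free: a constant serves for the vertices near 0, a power of
  \<open>n\<close> for the sparse sets of misclassified vertices.\<close>

lemma subset_pmf_upper_tail:
  assumes "m \<le> n" "0 < n" "T \<subseteq> {1..n}" "0 \<le> s"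
  shows "measure (subset_pmf n m) {S. a \<le> real (card (S \<inter> T))}
    \<le> exp (s * real m * real (card T) / real n) / (1 + s) powr a"
proof -
  have fin: "finite T" using assms(3) by (auto intro: finite_subset)
  have "measure (subset_pmf n m) {S. a \<le> real (card (S \<inter> T))} * (1 + s) powr a
      \<le> (1 + s * (real m / real n)) ^ card T"
  proof (rule moment_bound)
    fix J assume J: "J \<subseteq> T"
    then have "{S. J \<subseteq> S \<inter> T} = {S. J \<subseteq> S}" by auto
    then show "measure (subset_pmf n m) {S. J \<subseteq> S \<inter> T} \<le> (real m / real n) ^ card J"
      using subset_pmf_containing[OF assms(1,2), of J] J assms(3) by auto
  qed (use subset_family[OF assms(1)] fin assms in auto)
  also have "\<dots> \<le> exp (s * (real m / real n)) ^ card T"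
    using assms(4) by (intro power_mono exp_ge_add_one_self) auto
  also have "\<dots> = exp (s * real m * real (card T) / real n)"
    by (simp add: exp_of_nat_mult[symmetric] mult_ac)
  finally show ?thesis using assms(4) by (simp add: field_simps)
qed

text \<open>The moment bound only controls upper tails; here it is applied to \<open>T - S\<close>.\<close>

lemma subset_pmf_lower_tail:
  assumes "m \<le> n" "0 < n" "T \<subseteq> {1..n}"
  shows "measure (subset_pmf n m) {S. real (card (S \<inter> T)) \<le> a}
    \<le> exp (- (real m * real (card T) / (2 * real n))) * 2 powr a"
proof -
  have fin: "finite T" using assms(3) by (auto intro: finite_subset)
  have le1: "real m / real n \<le> 1" using assms by simp
  have card: "real (card (T - S)) = real (card T) - real (card (S \<inter> T))" for S
    using card_Diff_subset_Int[of T S] card_mono[of T "S \<inter> T"] fin by (simp add: Int_commute of_nat_diff)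
  \<comment> \<open>\<open>moment_bound\<close> with \<open>s = 1\<close> and
    \<open>q = 1 - m / n\<close>. Division by the power of 2 leaves the factor
    \<open>1 - m / (2 * n)\<close> for each element of \<open>T\<close>.\<close>
  have "measure (subset_pmf n m) {S. real (card T) - a \<le> real (card (T - S))} * (1 + 1) powr (real (card T) - a)
      \<le> (1 + 1 * (1 - real m / real n)) ^ card T"
  proof (rule moment_bound)
    fix J assume J: "J \<subseteq> T"
    then have "{S. J \<subseteq> T - S} = {S. S \<inter> J = {}}" by auto
    then show "measure (subset_pmf n m) {S. J \<subseteq> T - S} \<le> (1 - real m / real n) ^ card J"
      using subset_pmf_avoiding[OF assms(1,2), of J] J assms(3) by auto
  qed (use subset_family[OF assms(1)] fin assms in auto)
  moreover have "{S. real (card T) - a \<le> real (card (T - S))} = {S. real (card (S \<inter> T)) \<le> a}"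
    unfolding card by auto
  ultimately have "measure (subset_pmf n m) {S. real (card (S \<inter> T)) \<le> a} \<le> (2 - real m / real n) ^ card T / 2 powr (real (card T) - a)"
    by (simp add: field_simps)
  also have "\<dots> = ((2 - real m / real n) / 2) ^ card T * 2 powr a"
    by (simp add: powr_diff powr_realpow power_divide)
  also have "\<dots> \<le> exp (- (real m / (2 * real n))) ^ card T * 2 powr a"
  proof (intro mult_right_mono power_mono)
    have "(2 - real m / real n) / 2 = 1 + - (real m / (2 * real n))" by (simp add: field_simps)
    also have "\<dots> \<le> exp (- (real m / (2 * real n)))" by (rule exp_ge_add_one_self)
    finally show "(2 - real m / real n) / 2 \<le> exp (- (real m / (2 * real n)))" .
  qed (use le1 in auto)
  also have "exp (- (real m / (2 * real n))) ^ card T = exp (- (real m * real (card T) / (2 * real n)))"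
    by (simp add: exp_of_nat_mult[symmetric] mult_ac)
  finally show ?thesis .
qed

lemma subset_pmf_pair:
  assumes "m \<le> n" "2 \<le> m" "u \<in> {1..n}" "v \<in> {1..n}" "u \<noteq> v"
  shows "measure (subset_pmf n m) {S. {u, v} \<subseteq> S} = real m * (real m - 1) / (real n * (real n - 1))"
proof -
  have "m * (n choose m) = n * ((n - 1) choose (m - 1))"
    "(m - 1) * ((n - 1) choose (m - 1)) = (n - 1) * ((n - 2) choose (m - 2))"
    using times_binomial_minus1_eq[of m n] times_binomial_minus1_eq[of "m - 1" "n - 1"] assms
    by (auto simp: diff_diff_left numeral_2_eq_2)
  then have "real m * real (n choose m) = real n * real ((n - 1) choose (m - 1))"
    "real (m - 1) * real ((n - 1) choose (m - 1)) = real (n - 1) * real ((n - 2) choose (m - 2))"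
    by (metis of_nat_mult)+
  then have 1: "real m * real (n choose m) = real n * real ((n - 1) choose (m - 1))"
    "(real m - 1) * real ((n - 1) choose (m - 1)) = (real n - 1) * real ((n - 2) choose (m - 2))"
    using assms by (simp_all add: of_nat_diff)
  have pos: "real (n choose m) > 0" "real n > 0" "real n - 1 > 0" using assms by auto
  have "real m * (real m - 1) * real (n choose m) = real n * (real n - 1) * real ((n - 2) choose (m - 2))"
    using 1 by algebra
  moreover have "card {S. S \<subseteq> {1..n} \<and> card S = m \<and> {u, v} \<subseteq> S} = (n - 2) choose (m - 2)"
    using card_subsets_containing[of "{u, v}" n m] assms by (auto simp: numeral_2_eq_2)
  ultimately show ?thesis
    using assms pos unfolding subset_pmf_prob[OF assms(1)] mem_Collect_eq by (simp add: field_simps)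
qed

text \<open>Union bound over the misclassified pairs. Those disjoint from \<open>{u, v}\<close>
  number at most \<open>n * b\<close> and prescribe four vertices; those sharing a vertex with it
  number at most \<open>2 * b\<close> and prescribe three. The pair \<open>u\<close>,
  \<open>v\<close> itself is excluded by hypothesis.\<close>

lemma subset_pmf_clean_pair:
  assumes m: "m \<le> n" "2 \<le> m" and uv: "u \<in> {1..n}" "v \<in> {1..n}" "u \<noteq> v" "v \<notin> B u"
    and B: "\<And>x. x \<in> {1..n} \<Longrightarrow> B x \<subseteq> {1..n}" "\<And>x. x \<in> {1..n} \<Longrightarrow> real (card (B x)) \<le> b"
    and sym: "\<And>x y. x \<in> {1..n} \<Longrightarrow> y \<in> {1..n} \<Longrightarrow> y \<in> B x \<longleftrightarrow> x \<in> B y"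
  shows "measure (subset_pmf n m) {S. {u, v} \<subseteq> S \<and> (\<exists>x\<in>S. \<exists>y\<in>S. x \<in> {1..n} \<and> y \<in> {1..n} \<and> x \<noteq> y \<and> y \<in> B x)}
    \<le> b * real m ^ 4 / real n ^ 3 + 2 * b * real m ^ 3 / real n ^ 3"
proof -
  let ?p = "measure (subset_pmf n m)"
  define q where "q = real m / real n"
  have n: "0 < n" using uv by auto
  have q: "0 \<le> q" "q \<le> 1" using m by (auto simp: q_def)
  have finB: "finite (B x)" if "x \<in> {1..n}" for x using B(1)[OF that] by (auto intro: finite_subset)
  have vu: "u \<notin> B v" using sym uv by blast
  define P where "P = (SIGMA x:{1..n} - {u, v}. B x - {x, u, v})"
  define P' where "P' = {u, v} \<times> ({1..n} - {u, v}) \<inter> (SIGMA x:{u,v}. B x)"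
  have "{S. {u, v} \<subseteq> S \<and> (\<exists>x\<in>S. \<exists>y\<in>S. x \<in> {1..n} \<and> y \<in> {1..n} \<and> x \<noteq> y \<and> y \<in> B x)}
    \<subseteq> (\<Union>(x, y)\<in>P. {S. {u, v, x, y} \<subseteq> S}) \<union> (\<Union>(x, y)\<in>P'. {S. {u, v, x, y} \<subseteq> S})"
  proof safe
    fix S x y
    assume *: "{u, v} \<subseteq> S" "x \<in> S" "y \<in> S" "x \<in> {1..n}" "y \<in> {1..n}" "x \<noteq> y" "y \<in> B x"
      and no: "S \<notin> (\<Union>(x, y)\<in>P'. {S. {u, v, x, y} \<subseteq> S})"
    have "(x, y) \<notin> P'" "(y, x) \<notin> P'" using no * by auto
    moreover have "x \<in> B y" using sym * by blast
    ultimately have "(x, y) \<in> P" using * uv vu by (auto simp: P_def P'_def)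
    then show "S \<in> (\<Union>(x, y)\<in>P. {S. {u, v, x, y} \<subseteq> S})" using * by auto
  qed
  then have "?p {S. {u, v} \<subseteq> S \<and> (\<exists>x\<in>S. \<exists>y\<in>S. x \<in> {1..n} \<and> y \<in> {1..n} \<and> x \<noteq> y \<and> y \<in> B x)}
    \<le> ?p ((\<Union>(x, y)\<in>P. {S. {u, v, x, y} \<subseteq> S}) \<union> (\<Union>(x, y)\<in>P'. {S. {u, v, x, y} \<subseteq> S}))"
    by (intro measure_pmf.finite_measure_mono) auto
  also have "\<dots> \<le> ?p (\<Union>(x, y)\<in>P. {S. {u, v, x, y} \<subseteq> S}) + ?p (\<Union>(x, y)\<in>P'. {S. {u, v, x, y} \<subseteq> S})"
    by (intro measure_Un_le) auto
  also have "?p (\<Union>(x, y)\<in>P. {S. {u, v, x, y} \<subseteq> S}) \<le> real n * b * q ^ 4"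
  proof -
    have fin: "finite P" using finB by (auto simp: P_def)
    have "?p (\<Union>z\<in>P. case z of (x, y) \<Rightarrow> {S. {u, v, x, y} \<subseteq> S}) \<le> (\<Sum>z\<in>P. ?p (case z of (x, y) \<Rightarrow> {S. {u, v, x, y} \<subseteq> S}))"
      by (intro measure_UNION_le fin) auto
    also have "\<dots> \<le> (\<Sum>z\<in>P. q ^ 4)"
    proof (rule sum_mono, safe)
      fix x y assume xy: "(x, y) \<in> P"
      then have "y \<in> {1..n}" using B(1)[of x] unfolding P_def by blast
      then have "card {u, v, x, y} = 4" "{u, v, x, y} \<subseteq> {1..n}" using uv xy by (auto simp: P_def)
      then show "?p {S. {u, v, x, y} \<subseteq> S} \<le> q ^ 4"
        using subset_pmf_containing[OF m(1) n, of "{u, v, x, y}"] by (simp add: q_def)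
    qed
    also have "\<dots> = real (card P) * q ^ 4" by simp
    also have "real (card P) = (\<Sum>x\<in>{1..n} - {u, v}. real (card (B x - {x, u, v})))"
      using finB by (simp add: P_def)
    also have "\<dots> \<le> (\<Sum>x\<in>{1..n} - {u, v}. b)"
    proof (rule sum_mono)
      fix x assume "x \<in> {1..n} - {u, v}"
      then show "real (card (B x - {x, u, v})) \<le> b"
        using B(2)[of x] card_mono[OF finB, of x "B x - {x, u, v}"] by auto
    qed
    also have "\<dots> \<le> (\<Sum>x\<in>{1..n}. b)"
      using B(2)[OF uv(1)] by (intro sum_mono2) auto
    also have "\<dots> = real n * b" by simp
    finally show ?thesis using q by (simp add: mult_right_mono)
  qed
  also have "?p (\<Union>(x, y)\<in>P'. {S. {u, v, x, y} \<subseteq> S}) \<le> 2 * b * q ^ 3"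
  proof -
    have sub: "P' \<subseteq> (SIGMA x:{u,v}. B x)" by (auto simp: P'_def)
    have fin': "finite (SIGMA x:{u,v}. B x)" using finB uv by auto
    have fin: "finite P'" using finite_subset[OF sub fin'] .
    have "?p (\<Union>z\<in>P'. case z of (x, y) \<Rightarrow> {S. {u, v, x, y} \<subseteq> S}) \<le> (\<Sum>z\<in>P'. ?p (case z of (x, y) \<Rightarrow> {S. {u, v, x, y} \<subseteq> S}))"
      by (intro measure_UNION_le fin) auto
    also have "\<dots> \<le> (\<Sum>z\<in>P'. q ^ 3)"
    proof (rule sum_mono, safe)
      fix x y assume "(x, y) \<in> P'"
      then have "{u, v, x, y} = {u, v, y}" "card {u, v, y} = 3" "{u, v, y} \<subseteq> {1..n}"
        using uv by (auto simp: P'_def)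
      then show "?p {S. {u, v, x, y} \<subseteq> S} \<le> q ^ 3"
        using subset_pmf_containing[OF m(1) n, of "{u, v, y}"] by (simp add: q_def)
    qed
    also have "\<dots> = real (card P') * q ^ 3" by simp
    also have "real (card P') \<le> real (card (SIGMA x:{u,v}. B x))"
      using card_mono[OF fin' sub] by simp
    also have "\<dots> = real (card (B u)) + real (card (B v))"
      using finB uv by simp
    also have "\<dots> \<le> 2 * b" using B(2)[OF uv(1)] B(2)[OF uv(2)] by simp
    finally show ?thesis using q by (simp add: mult_right_mono)
  qed
  also have "real n * b * q ^ 4 + 2 * b * q ^ 3 \<le> b * real m ^ 4 / real n ^ 3 + 2 * b * real m ^ 3 / real n ^ 3"
  proof -
    have "0 \<le> b" using B(2)[OF uv(1)] by linarith
    then have "0 \<le> b * real m ^ 3 / real n ^ 3" by simp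
    moreover have "real n * b * q ^ 4 = b * real m ^ 4 / real n ^ 3"
      using n by (simp add: q_def power_divide power4_eq_xxxx power3_eq_cube)
    moreover have "2 * b * q ^ 3 = 2 * (b * real m ^ 3 / real n ^ 3)"
      by (simp add: q_def power_divide)
    ultimately show ?thesis by linarith
  qed
  finally show ?thesis by simp
qed

section \<open>Concentration in product spaces\<close>

text \<open>Fubini, with the inner probability bounded by \<open>q\<close> on \<open>G\<close> and
  by 0 elsewhere. It joins the stages of positions, edges and draws.\<close>

lemma measure_pair_ge:
  assumes "prob_space M" "prob_space N" "A \<in> sets (M \<Otimes>\<^sub>M N)" "G \<in> sets M" "0 \<le> q"
    and "\<And>x. x \<in> G \<Longrightarrow> measure N {y\<in>space N. (x, y) \<in> A} \<ge> q"
  shows "measure (M \<Otimes>\<^sub>M N) A \<ge> measure M G * q"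
proof -
  interpret M: prob_space M by fact
  interpret N: prob_space N by fact
  interpret MN: pair_prob_space M N ..
  have "ennreal (measure M G * q) = ennreal q * emeasure M G"
    using assms(5) by (simp add: M.emeasure_eq_measure ennreal_mult mult.commute)
  also have "\<dots> = (\<integral>\<^sup>+x. ennreal q * indicator G x \<partial>M)"
    using assms(4) by (simp add: nn_integral_cmult)
  also have "\<dots> \<le> (\<integral>\<^sup>+x. emeasure N (Pair x -` A) \<partial>M)"
  proof (rule nn_integral_mono)
    fix x assume x: "x \<in> space M"
    show "ennreal q * indicator G x \<le> emeasure N (Pair x -` A)"
    proof (cases "x \<in> G")
      case True
      have "Pair x -` A = {y\<in>space N. (x, y) \<in> A}"
        using sets.sets_into_space[OF assms(3)] by (auto simp: space_pair_measure)
      then show ?thesis using True assms(6)[OF True] by (simp add: N.emeasure_eq_measure ennreal_leI)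
    qed simp
  qed
  also have "\<dots> = emeasure (M \<Otimes>\<^sub>M N) A"
    by (rule N.emeasure_pair_measure_alt[OF assms(3), symmetric])
  finally show ?thesis by (simp add: MN.emeasure_eq_measure)
qed

lemma measure_pair_le:
  assumes "prob_space M" "prob_space N" "A \<in> sets (M \<Otimes>\<^sub>M N)" "0 \<le> q"
    and "\<And>x. x \<in> space M \<Longrightarrow> measure N {y\<in>space N. (x, y) \<in> A} \<le> q"
  shows "measure (M \<Otimes>\<^sub>M N) A \<le> q"
proof -
  interpret M: prob_space M by fact
  interpret N: prob_space N by fact
  interpret MN: pair_prob_space M N ..
  have "emeasure (M \<Otimes>\<^sub>M N) A = (\<integral>\<^sup>+x. emeasure N (Pair x -` A) \<partial>M)"
    by (rule N.emeasure_pair_measure_alt[OF assms(3)])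
  also have "\<dots> \<le> (\<integral>\<^sup>+x. ennreal q \<partial>M)"
  proof (rule nn_integral_mono)
    fix x assume x: "x \<in> space M"
    have "Pair x -` A = {y\<in>space N. (x, y) \<in> A}"
      using sets.sets_into_space[OF assms(3)] by (auto simp: space_pair_measure)
    then show "emeasure N (Pair x -` A) \<le> ennreal q"
      using assms(5)[OF x] by (simp add: N.emeasure_eq_measure ennreal_leI)
  qed
  also have "\<dots> = ennreal q" by (simp add: M.emeasure_space_1)
  finally show ?thesis using assms(4) by (simp add: MN.emeasure_eq_measure)
qed

lemma space_draws [simp]: "space (PiM UNIV (\<lambda>_. measure_pmf p)) = UNIV"
  by (auto simp: space_PiM)

lemma prob_PiM_all:
  fixes p :: "'a pmf" and J :: "'i set"
  assumes "finite J"
  shows "measure (PiM UNIV (\<lambda>_. measure_pmf p)) {d. \<forall>j\<in>J. d j \<in> X} = measure p X ^ card J"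
proof -
  interpret product_prob_space "\<lambda>_::'i. measure_pmf p" UNIV by standard
  have "emeasure (PiM UNIV (\<lambda>_. measure_pmf p)) {d\<in>space (PiM UNIV (\<lambda>_. measure_pmf p)). \<forall>j\<in>J. d j \<in> X}
      = (\<Prod>j\<in>J. emeasure p X)"
    by (rule emeasure_PiM_Collect) (use assms in auto)
  then have "ennreal (measure (PiM UNIV (\<lambda>_. measure_pmf p)) {d. \<forall>j\<in>J. d j \<in> X}) = ennreal (measure p X ^ card J)"
    by (simp add: P.emeasure_eq_measure measure_pmf.emeasure_eq_measure ennreal_power)
  then show ?thesis by simp
qed

lemma sets_draw:
  fixes p :: "'a pmf"
  shows "{d. d j \<in> X} \<in> sets (PiM UNIV (\<lambda>_. measure_pmf p))"
proof -
  have "{d\<in>space (PiM UNIV (\<lambda>_. measure_pmf p)). d j \<in> X} \<in> sets (PiM UNIV (\<lambda>_. measure_pmf p))"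
    by (rule sets_Collect_single') auto
  then show ?thesis by simp
qed

text \<open>Union bound over three kinds of failure. A success in each of \<open>t\<close> disjoint
  blocks of length \<open>B\<close> is a crude way to obtain \<open>t\<close> successes that avoids
  a tail bound for their number. The sets in \<open>\<D>\<close> must be hit within the first
  \<open>t\<close> draws, because successes among these are certain to be recorded.\<close>

lemma prob_draws_ge:
  fixes p :: "'a pmf" and G Succ :: "'a set" and \<D> :: "'a set set"
  assumes G: "measure p (- G) \<le> q"
    and r: "0 \<le> r" "r \<le> 1"
    and Succ: "r \<le> measure p Succ"
    and \<D>: "finite \<D>" "\<And>D. D \<in> \<D> \<Longrightarrow> r \<le> measure p D"
  shows "measure (PiM UNIV (\<lambda>_. measure_pmf p))
      {d. (\<forall>j<M. d j \<in> G) \<and> (\<forall>i<t. \<exists>j\<in>{i * B..<Suc i * B}. d j \<in> Succ) \<and> (\<forall>D\<in>\<D>. \<exists>j<t. d j \<in> D)}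
    \<ge> 1 - real M * q - real t * (1 - r) ^ B - real (card \<D>) * (1 - r) ^ t"
    (is "measure ?P ?E \<ge> _")
proof -
  interpret P: prob_space ?P by (intro prob_space_PiM) unfold_locales
  have fail: "measure ?P {d. \<forall>j\<in>J. d j \<in> - X} \<le> (1 - r) ^ card J" if "finite J" "r \<le> measure p X" for J :: "nat set" and X
    unfolding prob_PiM_all[OF that(1)]
    using measure_pmf.prob_compl[of X p] that(2) by (intro power_mono) (auto simp: Compl_eq_Diff_UNIV)
  have meas: "{d. \<forall>j\<in>J. d j \<in> X} \<in> sets ?P" if "finite J" for J :: "nat set" and X
  proof -
    have "{d\<in>space ?P. \<forall>j\<in>J. d j \<in> X} \<in> sets ?P"
      using that sets_draw[of _ X p] by (intro sets.sets_Collect_finite_All) auto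
    then show ?thesis by simp
  qed
  let ?B1 = "\<Union>j<M. {d. \<forall>j\<in>{j}. d j \<in> - G}"
  let ?B2 = "\<Union>i<t. {d. \<forall>j\<in>{i * B..<Suc i * B}. d j \<in> - Succ}"
  let ?B3 = "\<Union>D\<in>\<D>. {d. \<forall>j\<in>{..<t}. d j \<in> - D}"
  have sets: "?B1 \<in> sets ?P" "?B2 \<in> sets ?P" "?B3 \<in> sets ?P"
    by (rule sets.finite_UN meas finite_lessThan finite.intros finite_atLeastLessThan \<D>(1))+
  have "?E = UNIV - (?B1 \<union> ?B2 \<union> ?B3)" by blast
  then have E: "?E = space ?P - (?B1 \<union> ?B2 \<union> ?B3)" unfolding space_draws .
  have "measure ?P (?B1 \<union> ?B2 \<union> ?B3) \<le> measure ?P (?B1 \<union> ?B2) + measure ?P ?B3"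
    using sets by (intro measure_Un_le) auto
  also have "measure ?P (?B1 \<union> ?B2) \<le> measure ?P ?B1 + measure ?P ?B2"
    using sets by (intro measure_Un_le) auto
  also have "measure ?P ?B1 \<le> (\<Sum>j<M. measure ?P {d. \<forall>j\<in>{j}. d j \<in> - G})"
    by (intro measure_UNION_le meas) auto
  also have "\<dots> \<le> (\<Sum>j<M. q)"
  proof (rule sum_mono)
    fix j
    show "measure ?P {d. \<forall>j\<in>{j}. d j \<in> - G} \<le> q"
      using G by (subst prob_PiM_all) auto
  qed
  also have "measure ?P ?B2 \<le> (\<Sum>i<t. measure ?P {d. \<forall>j\<in>{i * B..<Suc i * B}. d j \<in> - Succ})"
    by (intro measure_UNION_le meas) auto
  also have "\<dots> \<le> (\<Sum>i<t. (1 - r) ^ B)"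
  proof (rule sum_mono)
    fix i
    show "measure ?P {d. \<forall>j\<in>{i * B..<Suc i * B}. d j \<in> - Succ} \<le> (1 - r) ^ B"
      using fail[OF finite_atLeastLessThan Succ, of "i * B" "Suc i * B"] by simp
  qed
  also have "measure ?P ?B3 \<le> (\<Sum>D\<in>\<D>. measure ?P {d. \<forall>j\<in>{..<t}. d j \<in> - D})"
    using \<D>(1) by (intro measure_UNION_le meas) auto
  also have "\<dots> \<le> (\<Sum>D\<in>\<D>. (1 - r) ^ t)"
  proof (rule sum_mono)
    fix D assume "D \<in> \<D>"
    then show "measure ?P {d. \<forall>j\<in>{..<t}. d j \<in> - D} \<le> (1 - r) ^ t"
      using fail[OF finite_lessThan \<D>(2), of D t] by simp
  qed
  finally have "measure ?P (?B1 \<union> ?B2 \<union> ?B3) \<le> real M * q + real t * (1 - r) ^ B + real (card \<D>) * (1 - r) ^ t"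
    by simp
  moreover have "measure ?P ?E = 1 - measure ?P (?B1 \<union> ?B2 \<union> ?B3)"
    unfolding E using sets by (intro P.prob_compl) auto
  ultimately show ?thesis by linarith
qed

lemma blocks_give_successes:
  assumes "\<And>i. i < t \<Longrightarrow> \<exists>j\<in>{i * B..<Suc i * B}. P (d j)"
  shows "t \<le> length (filter P (map d [0..<t * B]))"
  using assms
proof (induction t)
  case (Suc t)
  have IH: "t \<le> length (filter P (map d [0..<t * B]))" using Suc by simp
  obtain j where j: "t * B \<le> j" "j < Suc t * B" "P (d j)" using Suc.prems[of t] by auto
  have "d j \<in> set (filter P (map d [t * B..<Suc t * B]))" using j by auto
  then have "0 < length (filter P (map d [t * B..<Suc t * B]))"
    by (metis length_pos_if_in_set)
  moreover have "[0..<Suc t * B] = [0..<t * B] @ [t * B..<Suc t * B]"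
    using upt_add_eq_append[of 0 "t * B" B] by (simp add: add.commute)
  then have "length (filter P (map d [0..<Suc t * B])) =
    length (filter P (map d [0..<t * B])) + length (filter P (map d [t * B..<Suc t * B]))"
    by (simp only: map_append filter_append length_append)
  ultimately show ?case using IH by linarith
qed simp

section \<open>Hoeffding bounds in product spaces\<close>

lemma indep_vars_PiM_components:
  assumes M: "\<And>i. i \<in> I \<Longrightarrow> prob_space (M i)"
  shows "prob_space.indep_vars (PiM I M) M (\<lambda>i \<omega>. \<omega> i) I"
proof -
  interpret prob_space "PiM I M" by (rule prob_space_PiM[OF M])
  have "distr (PiM I M) (PiM I M) (\<lambda>\<omega>. \<lambda>i\<in>I. \<omega> i) = distr (PiM I M) (PiM I M) (\<lambda>\<omega>. \<omega>)"
    by (rule distr_cong) (auto simp: space_PiM PiE_def extensional_restrict)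
  also have "\<dots> = PiM I M" by simp
  also have "\<dots> = PiM I (\<lambda>i. distr (PiM I M) (M i) (\<lambda>\<omega>. \<omega> i))"
    by (intro PiM_cong refl distr_PiM_component[symmetric] M)
  finally have distr: "distr (PiM I M) (PiM I M) (\<lambda>\<omega>. \<lambda>i\<in>I. \<omega> i) = PiM I (\<lambda>i. distr (PiM I M) (M i) (\<lambda>\<omega>. \<omega> i))" .
  show ?thesis
  proof (cases "I = {}")
    case True
    show ?thesis unfolding indep_vars_def indep_sets_def using True by blast
  next
    case False
    then show ?thesis using distr by (subst indep_vars_iff_distr_eq_PiM') auto
  qed
qed

text \<open>Functions of disjoint blocks of coordinates are independent. Using \<open>N\<close>
  instead of \<open>card J\<close> makes the bound uniform in the pair of vertices and covers empty
  \<open>J\<close>.\<close>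

lemma PiM_Hoeffding:
  fixes f :: "'j \<Rightarrow> ('i \<Rightarrow> 'a) \<Rightarrow> real"
  assumes M: "\<And>i. i \<in> I \<Longrightarrow> prob_space (M i)"
    and J: "finite J" "card J \<le> N" "0 < N"
    and K: "\<And>j. j \<in> J \<Longrightarrow> K j \<subseteq> I" "disjoint_family_on K J"
    and f: "\<And>j. j \<in> J \<Longrightarrow> f j \<in> borel_measurable (PiM (K j) M)"
      "\<And>j \<omega>. j \<in> J \<Longrightarrow> \<omega> \<in> space (PiM (K j) M) \<Longrightarrow> f j \<omega> \<in> {0..1}"
    and \<tau>: "0 \<le> \<tau>"
  shows "measure (PiM I M) {\<omega>\<in>space (PiM I M).
      \<tau> \<le> \<bar>(\<Sum>j\<in>J. f j (restrict \<omega> (K j))) - (\<Sum>j\<in>J. \<integral>\<omega>. f j (restrict \<omega> (K j)) \<partial>PiM I M)\<bar>}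
    \<le> 2 * exp (- 2 * \<tau>\<^sup>2 / real N)"
proof (cases "J = {}")
  case True
  interpret prob_space "PiM I M" by (rule prob_space_PiM[OF M])
  show ?thesis
  proof (cases "\<tau> = 0")
    case False
    then have "\<not> \<tau> \<le> 0" using \<tau> by simp
    then show ?thesis unfolding True by simp
  next
    case 0: True
    have "(1::real) \<le> 2 * exp (- 2 * \<tau>\<^sup>2 / real N)" unfolding 0 by simp
    then show ?thesis by (rule order.trans[OF prob_le_1])
  qed
next
  case False
  interpret prob_space "PiM I M" by (rule prob_space_PiM[OF M])
  have "indep_vars (\<lambda>j. PiM (K j) M) (\<lambda>j \<omega>. restrict (\<lambda>i. \<omega> i) (K j)) J"
    by (rule indep_vars_restrict[OF indep_vars_PiM_components[OF M] K])
  then have "indep_vars (\<lambda>_. borel) (\<lambda>j. f j \<circ> (\<lambda>\<omega>. restrict (\<lambda>i. \<omega> i) (K j))) J"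
    by (rule indep_vars_compose) (rule f(1))
  then have ind: "indep_vars (\<lambda>_. borel) (\<lambda>j \<omega>. f j (restrict \<omega> (K j))) J"
    by (simp add: comp_def)
  interpret H: Hoeffding_ineq "PiM I M" J "\<lambda>j \<omega>. f j (restrict \<omega> (K j))" "\<lambda>_. 0" "\<lambda>_. 1"
    "\<Sum>j\<in>J. \<integral>\<omega>. f j (restrict \<omega> (K j)) \<partial>PiM I M"
  proof unfold_locales
    show "finite J" by fact
    show "indep_vars (\<lambda>_. borel) (\<lambda>j \<omega>. f j (restrict \<omega> (K j))) J" by fact
    fix j assume j: "j \<in> J"
    have "restrict \<omega> (K j) \<in> space (PiM (K j) M)" if "\<omega> \<in> space (PiM I M)" for \<omega>
      using that K(1)[OF j] by (auto simp: space_PiM)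
    then show "AE \<omega> in PiM I M. f j (restrict \<omega> (K j)) \<in> {0..1}"
      using f(2)[OF j] by (intro AE_I2) auto
  qed auto
  have card: "real (card J) > 0" using False J by (simp add: card_gt_0_iff)
  then have "measure (PiM I M) {\<omega>\<in>space (PiM I M).
      \<tau> \<le> \<bar>(\<Sum>j\<in>J. f j (restrict \<omega> (K j))) - (\<Sum>j\<in>J. \<integral>\<omega>. f j (restrict \<omega> (K j)) \<partial>PiM I M)\<bar>}
    \<le> 2 * exp (- 2 * \<tau>\<^sup>2 / real (card J))"
    using H.Hoeffding_ineq_abs_ge[OF \<tau>] by simp
  also have "\<dots> \<le> 2 * exp (- 2 * \<tau>\<^sup>2 / real N)"
    using card J(2,3) by (auto intro!: divide_left_mono)
  finally show ?thesis .
qed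

lemma prob_space_unif01: "prob_space unif01"
  by (rule prob_space_restrict_space) auto

lemma space_unif01 [simp]: "space unif01 = {0..1}"
  by (simp add: space_restrict_space)

lemma measure_unif01:
  assumes "A \<in> sets borel" "A \<subseteq> {0..1}"
  shows "measure unif01 A = measure lborel A"
  using assms by (intro measure_restrict_space) auto

lemma integral_PiM_component:
  fixes f :: "'a \<Rightarrow> real"
  assumes "\<And>i. i \<in> I \<Longrightarrow> prob_space (M i)" "j \<in> I" "f \<in> borel_measurable (M j)"
  shows "(\<integral>\<omega>. f (\<omega> j) \<partial>PiM I M) = (\<integral>x. f x \<partial>M j)"
proof -
  have "(\<integral>x. f x \<partial>M j) = (\<integral>x. f x \<partial>distr (PiM I M) (M j) (\<lambda>\<omega>. \<omega> j))"
    using distr_PiM_component[of I M j] assms by simp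
  also have "\<dots> = (\<integral>\<omega>. f (\<omega> j) \<partial>PiM I M)"
    using assms by (intro integral_distr) auto
  finally show ?thesis by simp
qed

text \<open>Conditioning on the coordinates \<open>u\<close> and \<open>v\<close> makes the summands independent.\<close>

lemma Hoeffding_given_two:
  fixes f :: "'a \<Rightarrow> 'a \<Rightarrow> 'a \<Rightarrow> real" and M :: "'a measure" and I :: "'i set"
  assumes M: "prob_space M" and I: "finite I" "u \<in> I" "v \<in> I" "card I \<le> N" "0 < N"
    and f: "(\<lambda>(a, b, c). f a b c) \<in> borel_measurable (M \<Otimes>\<^sub>M M \<Otimes>\<^sub>M M)"
    and f01: "\<And>a b c. a \<in> space M \<Longrightarrow> b \<in> space M \<Longrightarrow> c \<in> space M \<Longrightarrow> f a b c \<in> {0..1}"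
    and \<tau>: "0 \<le> \<tau>"
  shows "{U\<in>space (PiM I (\<lambda>_. M)). \<tau> \<le> \<bar>(\<Sum>x\<in>I - {u, v}. f (U u) (U v) (U x)) -
      real (card (I - {u, v})) * (\<integral>c. f (U u) (U v) c \<partial>M)\<bar>} \<in> sets (PiM I (\<lambda>_. M))" (is "?A \<in> _")
    and "measure (PiM I (\<lambda>_. M)) {U\<in>space (PiM I (\<lambda>_. M)). \<tau> \<le> \<bar>(\<Sum>x\<in>I - {u, v}. f (U u) (U v) (U x)) -
      real (card (I - {u, v})) * (\<integral>c. f (U u) (U v) c \<partial>M)\<bar>} \<le> 2 * exp (- 2 * \<tau>\<^sup>2 / real N)"
proof -
  interpret prob_space M by (rule M)
  interpret product_sigma_finite "\<lambda>_::'i. M" by standard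
  let ?P = "\<lambda>J. PiM J (\<lambda>_::'i. M)"
  have comp: "(\<lambda>U. U i) \<in> ?P J \<rightarrow>\<^sub>M M" if "i \<in> J" for i J
    using that by (rule measurable_component_singleton)
  have fm: "(\<lambda>z. f (a z) (b z) (c z)) \<in> borel_measurable L"
    if "a \<in> L \<rightarrow>\<^sub>M M" "b \<in> L \<rightarrow>\<^sub>M M" "c \<in> L \<rightarrow>\<^sub>M M" for L :: "'z measure" and a b c
  proof -
    have "(\<lambda>z. (a z, b z, c z)) \<in> L \<rightarrow>\<^sub>M M \<Otimes>\<^sub>M M \<Otimes>\<^sub>M M"
      using that by (intro measurable_Pair)
    from measurable_compose[OF this f] show ?thesis by simp
  qed
  have sum: "(\<lambda>U. \<Sum>x\<in>I - {u, v}. f (U u) (U v) (U x)) \<in> borel_measurable (?P I)"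
    using I by (intro borel_measurable_sum fm comp) auto
  have "(\<lambda>(U, c). f (U u) (U v) c) \<in> borel_measurable (?P I \<Otimes>\<^sub>M M)"
    unfolding case_prod_beta
    by (intro fm measurable_compose[OF measurable_fst comp] measurable_snd I)
  then have int: "(\<lambda>U. \<integral>c. f (U u) (U v) c \<partial>M) \<in> borel_measurable (?P I)"
    by (rule borel_measurable_lebesgue_integral)
  have dev: "(\<lambda>U. \<bar>(\<Sum>x\<in>I - {u, v}. f (U u) (U v) (U x)) -
      real (card (I - {u, v})) * (\<integral>c. f (U u) (U v) c \<partial>M)\<bar>) \<in> borel_measurable (?P I)"
    by (intro borel_measurable_abs borel_measurable_diff sum borel_measurable_times borel_measurable_const int)
  show A: "?A \<in> sets (?P I)"
    by (intro borel_measurable_le borel_measurable_const dev)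
  define K where "K = I - {u, v}"
  have K: "finite K" "{u, v} \<inter> K = {}" "{u, v} \<union> K = I" using I by (auto simp: K_def)
  have merge: "merge {u, v} K \<in> ?P {u, v} \<Otimes>\<^sub>M ?P K \<rightarrow>\<^sub>M ?P I"
    using measurable_merge[of "{u, v}" K "\<lambda>_. M"] K by simp
  \<comment> \<open>The coordinates \<open>u\<close> and \<open>v\<close> are split off by
    \<open>merge\<close>; by \<open>measure_pair_le\<close> it suffices to bound the probability
    over the others for each fixed value \<open>y\<close> of these two.\<close>
  have "measure (?P I) ?A = measure (distr (?P {u, v} \<Otimes>\<^sub>M ?P K) (?P I) (merge {u, v} K)) ?A"
    using distr_merge[of "{u, v}" K] K by simp
  also have "\<dots> = measure (?P {u, v} \<Otimes>\<^sub>M ?P K) (merge {u, v} K -` ?A \<inter> space (?P {u, v} \<Otimes>\<^sub>M ?P K))"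
    by (rule measure_distr[OF merge A])
  also have "\<dots> \<le> 2 * exp (- 2 * \<tau>\<^sup>2 / real N)"
  proof (rule measure_pair_le)
    show "prob_space (?P {u, v})" "prob_space (?P K)" by (rule prob_space_PiM, rule M)+
    show "merge {u, v} K -` ?A \<inter> space (?P {u, v} \<Otimes>\<^sub>M ?P K) \<in> sets (?P {u, v} \<Otimes>\<^sub>M ?P K)"
      by (rule measurable_sets[OF merge A])
    fix y assume y: "y \<in> space (?P {u, v})"
    have y01: "y u \<in> space M" "y v \<in> space M" using y by (auto simp: space_PiM)
    have fx: "(\<lambda>c. f (y u) (y v) c) \<in> borel_measurable M"
      by (intro fm measurable_const y01 measurable_ident_sets refl)
    have E: "(\<integral>\<omega>. f (y u) (y v) (restrict \<omega> {x} x) \<partial>?P K) = (\<integral>c. f (y u) (y v) c \<partial>M)" if "x \<in> K" for x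
      using integral_PiM_component[of K "\<lambda>_. M" x "f (y u) (y v)"] that fx M by simp
    have sumE: "(\<Sum>x\<in>K. \<integral>\<omega>. f (y u) (y v) (restrict \<omega> {x} x) \<partial>?P K) =
        real (card K) * (\<integral>c. f (y u) (y v) c \<partial>M)"
      by (subst sum.cong[OF refl E]) simp_all
    have sub: "{z\<in>space (?P K). (y, z) \<in> merge {u, v} K -` ?A \<inter> space (?P {u, v} \<Otimes>\<^sub>M ?P K)} \<subseteq>
      {z\<in>space (?P K). \<tau> \<le> \<bar>(\<Sum>x\<in>K. f (y u) (y v) (restrict z {x} x)) -
         (\<Sum>x\<in>K. \<integral>\<omega>. f (y u) (y v) (restrict \<omega> {x} x) \<partial>?P K)\<bar>}"
    proof (rule subsetI)
      fix z assume z: "z \<in> {z\<in>space (?P K). (y, z) \<in> merge {u, v} K -` ?A \<inter> space (?P {u, v} \<Otimes>\<^sub>M ?P K)}"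
      then have *: "merge {u, v} K (y, z) \<in> ?A" by blast
      have "(\<Sum>x\<in>K. f (y u) (y v) (merge {u, v} K (y, z) x)) = (\<Sum>x\<in>K. f (y u) (y v) (z x))"
        using K(2) by (intro sum.cong) (auto simp: merge_def)
      moreover have "merge {u, v} K (y, z) u = y u" "merge {u, v} K (y, z) v = y v"
        by (simp_all add: merge_def)
      ultimately have "\<tau> \<le> \<bar>(\<Sum>x\<in>K. f (y u) (y v) (restrict z {x} x)) -
         (\<Sum>x\<in>K. \<integral>\<omega>. f (y u) (y v) (restrict \<omega> {x} x) \<partial>?P K)\<bar>"
        unfolding sumE using * by (simp flip: K_def)
      then show "z \<in> {z\<in>space (?P K). \<tau> \<le> \<bar>(\<Sum>x\<in>K. f (y u) (y v) (restrict z {x} x)) -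
         (\<Sum>x\<in>K. \<integral>\<omega>. f (y u) (y v) (restrict \<omega> {x} x) \<partial>?P K)\<bar>}"
        using z by blast
    qed
    have m: "{z\<in>space (?P K). \<tau> \<le> \<bar>(\<Sum>x\<in>K. f (y u) (y v) (restrict z {x} x)) -
         (\<Sum>x\<in>K. \<integral>\<omega>. f (y u) (y v) (restrict \<omega> {x} x) \<partial>?P K)\<bar>} \<in> sets (?P K)"
    proof -
      have "(\<lambda>z. \<Sum>x\<in>K. f (y u) (y v) (restrict z {x} x)) \<in> borel_measurable (?P K)"
        using comp[of _ K] by (intro borel_measurable_sum) (auto intro!: measurable_compose[OF _ fx])
      then show ?thesis
        by (intro borel_measurable_le borel_measurable_const borel_measurable_abs borel_measurable_diff)
    qed
    interpret PK: prob_space "?P K" by (rule prob_space_PiM, rule M)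
    have "measure (?P K) {z\<in>space (?P K). \<tau> \<le> \<bar>(\<Sum>x\<in>K. f (y u) (y v) (restrict z {x} x)) -
         (\<Sum>x\<in>K. \<integral>\<omega>. f (y u) (y v) (restrict \<omega> {x} x) \<partial>?P K)\<bar>} \<le> 2 * exp (- 2 * \<tau>\<^sup>2 / real N)"
    proof (rule PiM_Hoeffding)
      have "card K \<le> card I" using I(1) by (auto simp: K_def intro: card_mono)
      then show "card K \<le> N" using I by simp
      show "(\<lambda>\<omega>. f (y u) (y v) (\<omega> x)) \<in> borel_measurable (?P {x})" for x
        by (rule measurable_compose[OF comp fx]) simp
      show "f (y u) (y v) (\<omega> x) \<in> {0..1}" if "\<omega> \<in> space (?P {x})" for x \<omega>
        using that y01 by (intro f01) (auto simp: space_PiM)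
    qed (use M K I \<tau> in \<open>auto simp: disjoint_family_on_def\<close>)
    then show "measure (?P K) {z\<in>space (?P K). (y, z) \<in> merge {u, v} K -` ?A \<inter> space (?P {u, v} \<Otimes>\<^sub>M ?P K)}
      \<le> 2 * exp (- 2 * \<tau>\<^sup>2 / real N)"
      using PK.finite_measure_mono[OF sub m] by linarith
  qed simp
  finally show "measure (?P I) ?A \<le> 2 * exp (- 2 * \<tau>\<^sup>2 / real N)" .
qed

section \<open>Common neighbours for fixed positions\<close>

definition pairs :: "nat \<Rightarrow> (nat \<times> nat) set" where
  "pairs n = {(i, j). 1 \<le> i \<and> i < j \<and> j \<le> n}"

definition ordered_pair :: "nat \<Rightarrow> nat \<Rightarrow> nat \<times> nat" where
  "ordered_pair i j = (min i j, max i j)"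

lemma finite_pairs [simp]: "finite (pairs n)"
  by (rule finite_subset[of _ "{1..n} \<times> {1..n}"]) (auto simp: pairs_def)

lemma graphon_sym: "graphon w \<Longrightarrow> x \<in> {0..1} \<Longrightarrow> y \<in> {0..1} \<Longrightarrow> w x y = w y x"
  and graphon_range: "graphon w \<Longrightarrow> x \<in> {0..1} \<Longrightarrow> y \<in> {0..1} \<Longrightarrow> w x y \<in> {0..1}"
  by (auto simp: graphon_def)

lemma graphon_graph_edge:
  assumes "graphon w" "\<And>i. i \<in> {1..n} \<Longrightarrow> U i \<in> {0..1}"
  shows "{i, j} \<in> graphon_graph w n U U' \<longleftrightarrow>
    i \<in> {1..n} \<and> j \<in> {1..n} \<and> i \<noteq> j \<and> U' (ordered_pair i j) < w (U i) (U j)"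
proof -
  have 1: "{i, j} \<in> graphon_graph w n U U' \<longleftrightarrow> 1 \<le> i \<and> j \<le> n \<and> U' (i, j) < w (U i) (U j)" if "i < j" for i j
    using that by (auto simp: graphon_graph_def doubleton_eq_iff)
  consider "i < j" | "j < i" | "i = j" by linarith
  then show ?thesis
  proof cases
    case 1
    then show ?thesis using \<open>\<And>j i. i < j \<Longrightarrow> _\<close>[of i j] by (auto simp: ordered_pair_def)
  next
    case 2
    then show ?thesis
      using \<open>\<And>j i. i < j \<Longrightarrow> _\<close>[of j i] graphon_sym[OF assms(1) assms(2) assms(2), of i j]
      by (auto simp: ordered_pair_def insert_commute)
  next
    case 3
    then show ?thesis by (auto simp: graphon_graph_def)
  qed
qed

lemma prob_PiM_two_less:
  assumes "p \<in> P" "q \<in> P" "p \<noteq> q" "a \<in> {0..1}" "b \<in> {0..1}"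
  shows "(\<integral>\<omega>. (if \<omega> p < a \<and> \<omega> q < b then 1 else 0) \<partial>PiM P (\<lambda>_. unif01)) = a * b"
proof -
  interpret prob_space unif01 by (rule prob_space_unif01)
  interpret product_prob_space "\<lambda>_. unif01" P by standard
  let ?X = "\<lambda>i. {0..1} \<inter> {..<(if i = p then a else b)}"
  have m: "emeasure unif01 ({0..1} \<inter> {..<c}) = ennreal c" if "c \<in> {0..1}" for c :: real
  proof -
    have "{0..1} \<inter> {..<c} = {0..<c}" using that by auto
    moreover have "measure unif01 {0..<c} = c"
      using that by (subst measure_unif01) auto
    ultimately show ?thesis by (simp add: finite_measure.emeasure_eq_measure[OF prob_space.axioms(1)[OF prob_space_unif01]])
  qed
  have "emeasure (PiM P (\<lambda>_. unif01)) {\<omega>\<in>space (PiM P (\<lambda>_. unif01)). \<forall>i\<in>{p, q}. \<omega> i \<in> ?X i} =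
      (\<Prod>i\<in>{p, q}. emeasure unif01 (?X i))"
    using assms by (intro emeasure_PiM_Collect) (auto simp: sets_restrict_space_iff)
  then have 1: "measure (PiM P (\<lambda>_. unif01)) {\<omega>\<in>space (PiM P (\<lambda>_. unif01)). \<forall>i\<in>{p, q}. \<omega> i \<in> ?X i} = a * b"
    using assms m[of a] m[of b] by (simp add: P.emeasure_eq_measure flip: ennreal_mult)
  have "(\<integral>\<omega>. (if \<omega> p < a \<and> \<omega> q < b then 1 else 0) \<partial>PiM P (\<lambda>_. unif01)) =
    (\<integral>\<omega>. indicator {\<omega>\<in>space (PiM P (\<lambda>_. unif01)). \<forall>i\<in>{p, q}. \<omega> i \<in> ?X i} \<omega> \<partial>PiM P (\<lambda>_. unif01))"
    using assms by (intro Bochner_Integration.integral_cong) (auto simp: indicator_def space_PiM PiE_iff)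
  also have "\<dots> = measure (PiM P (\<lambda>_. unif01)) {\<omega>\<in>space (PiM P (\<lambda>_. unif01)). \<forall>i\<in>{p, q}. \<omega> i \<in> ?X i}"
    unfolding Bochner_Integration.integral_indicator by (rule arg_cong[of _ _ "measure _"]) blast
  finally show ?thesis using 1 by simp
qed

text \<open>For fixed positions the contribution of \<open>x\<close> depends only on the variables
  of its edges to \<open>u\<close> and \<open>v\<close>, and these coordinate pairs are disjoint for
  different \<open>x\<close>. As there are no loops, \<open>u\<close> and \<open>v\<close>
  themselves contribute nothing.\<close>

lemma common_neighbours_concentration:
  assumes w: "graphon w" and U: "\<And>i. i \<in> {1..n} \<Longrightarrow> U i \<in> {0..1}"
    and uv: "u \<in> {1..n}" "v \<in> {1..n}" "u \<noteq> v" and \<tau>: "0 \<le> \<tau>"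
  shows "{U'\<in>space (PiM (pairs n) (\<lambda>_. unif01)). \<tau> \<le>
        \<bar>real (card {x\<in>{1..n}. {u, x} \<in> graphon_graph w n U U' \<and> {v, x} \<in> graphon_graph w n U U'}) -
         (\<Sum>x\<in>{1..n} - {u, v}. w (U u) (U x) * w (U x) (U v))\<bar>} \<in> sets (PiM (pairs n) (\<lambda>_. unif01))" (is "?A \<in> _")
    and "measure (PiM (pairs n) (\<lambda>_. unif01)) {U'\<in>space (PiM (pairs n) (\<lambda>_. unif01)). \<tau> \<le>
        \<bar>real (card {x\<in>{1..n}. {u, x} \<in> graphon_graph w n U U' \<and> {v, x} \<in> graphon_graph w n U U'}) -
         (\<Sum>x\<in>{1..n} - {u, v}. w (U u) (U x) * w (U x) (U v))\<bar>} \<le> 2 * exp (- 2 * \<tau>\<^sup>2 / real n)"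
proof -
  let ?P = "PiM (pairs n) (\<lambda>_. unif01)"
  let ?V = "{1..n} - {u, v}"
  define K where "K x = {ordered_pair u x, ordered_pair v x}" for x
  define f where "f x \<omega> = (if \<omega> (ordered_pair u x) < w (U u) (U x) \<and> \<omega> (ordered_pair v x) < w (U x) (U v) then 1 else (0::real))"
    for x and \<omega> :: "nat \<times> nat \<Rightarrow> real"
  have op: "ordered_pair y x \<in> pairs n" if "x \<in> ?V" "y \<in> {u, v}" for x y
    using that uv by (auto simp: ordered_pair_def pairs_def min_def max_def)
  have K: "K x \<subseteq> pairs n" if "x \<in> ?V" for x
    using op[OF that] by (auto simp: K_def)
  have ne: "ordered_pair u x \<noteq> ordered_pair v x" if "x \<in> ?V" for x
    using that uv by (auto simp: ordered_pair_def min_def max_def split: if_splits)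
  have disj: "disjoint_family_on K ?V"
    unfolding disjoint_family_on_def K_def ordered_pair_def using uv
    by (auto simp: min_def max_def split: if_splits)
  have card: "real (card {x\<in>{1..n}. {u, x} \<in> graphon_graph w n U U' \<and> {v, x} \<in> graphon_graph w n U U'})
      = (\<Sum>x\<in>?V. f x (restrict U' (K x)))" for U'
  proof -
    have "{x\<in>{1..n}. {u, x} \<in> graphon_graph w n U U' \<and> {v, x} \<in> graphon_graph w n U U'} =
      {x\<in>?V. U' (ordered_pair u x) < w (U u) (U x) \<and> U' (ordered_pair v x) < w (U x) (U v)}"
      using graphon_graph_edge[OF w U] uv graphon_sym[OF w U U] by auto
    then have "real (card {x\<in>{1..n}. {u, x} \<in> graphon_graph w n U U' \<and> {v, x} \<in> graphon_graph w n U U'}) =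
       (\<Sum>x\<in>{x\<in>?V. U' (ordered_pair u x) < w (U u) (U x) \<and> U' (ordered_pair v x) < w (U x) (U v)}. 1)"
      by simp
    also have "\<dots> = (\<Sum>x\<in>?V. f x (restrict U' (K x)))"
      by (subst sum.inter_filter) (auto simp: f_def K_def intro!: sum.cong)
    finally show ?thesis .
  qed
  have E: "(\<integral>\<omega>. f x (restrict \<omega> (K x)) \<partial>?P) = w (U u) (U x) * w (U x) (U v)" if "x \<in> ?V" for x
  proof -
    have "(\<integral>\<omega>. f x (restrict \<omega> (K x)) \<partial>?P) =
      (\<integral>\<omega>. (if \<omega> (ordered_pair u x) < w (U u) (U x) \<and> \<omega> (ordered_pair v x) < w (U x) (U v) then 1 else 0) \<partial>?P)"
      by (simp add: f_def K_def)
    also have "\<dots> = w (U u) (U x) * w (U x) (U v)"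
      using that uv U by (intro prob_PiM_two_less op ne graphon_range[OF w]) auto
    finally show ?thesis .
  qed
  have fm: "f x \<in> borel_measurable (PiM (K x) (\<lambda>_. unif01))" for x
  proof -
    have id: "(\<lambda>t. t) \<in> borel_measurable unif01"
      by (rule measurable_restrict_space1) simp
    have c: "(\<lambda>\<omega>. \<omega> i) \<in> borel_measurable (PiM (K x) (\<lambda>_. unif01))" if "i \<in> K x" for i
      by (rule measurable_compose[OF measurable_component_singleton[OF that] id])
    have p: "Measurable.pred (PiM (K x) (\<lambda>_. unif01)) (\<lambda>\<omega>. \<omega> i < t)" if "i \<in> K x" for i t
      by (rule borel_measurable_pred_less[OF c[OF that] borel_measurable_const])
    have "Measurable.pred (PiM (K x) (\<lambda>_. unif01))
       (\<lambda>\<omega>. \<omega> (ordered_pair u x) < w (U u) (U x) \<and> \<omega> (ordered_pair v x) < w (U x) (U v))"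
      by (intro pred_intros_logic p) (simp_all add: K_def)
    then show ?thesis unfolding f_def by measurable
  qed
  have Pr: "prob_space unif01" by (rule prob_space_unif01)
  show "measure ?P ?A \<le> 2 * exp (- 2 * \<tau>\<^sup>2 / real n)"
  proof -
    have "measure ?P {\<omega>\<in>space ?P. \<tau> \<le> \<bar>(\<Sum>x\<in>?V. f x (restrict \<omega> (K x))) - (\<Sum>x\<in>?V. \<integral>\<omega>. f x (restrict \<omega> (K x)) \<partial>?P)\<bar>}
      \<le> 2 * exp (- 2 * \<tau>\<^sup>2 / real n)"
    proof (rule PiM_Hoeffding[OF Pr])
      show "card ?V \<le> n" using card_mono[of "{1..n}" ?V] by simp
      show "f x \<omega> \<in> {0..1}" for x \<omega> by (simp add: f_def)
    qed (use K disj fm uv \<tau> in auto)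
    moreover have "(\<Sum>x\<in>?V. \<integral>\<omega>. f x (restrict \<omega> (K x)) \<partial>?P) = (\<Sum>x\<in>?V. w (U u) (U x) * w (U x) (U v))"
      by (rule sum.cong[OF refl E])
    ultimately show ?thesis unfolding card by simp
  qed
  show "?A \<in> sets ?P"
  proof -
    have "(\<lambda>\<omega>. f x (restrict \<omega> (K x))) \<in> borel_measurable ?P" if "x \<in> ?V" for x
      by (rule measurable_compose[OF measurable_restrict_subset[OF K[OF that]] fm])
    then have "(\<lambda>\<omega>. \<Sum>x\<in>?V. f x (restrict \<omega> (K x))) \<in> borel_measurable ?P"
      by (intro borel_measurable_sum)
    then show ?thesis unfolding card
      by (intro borel_measurable_le borel_measurable_const borel_measurable_abs borel_measurable_diff)
  qed
qed

section \<open>Measurability of the outcome\<close>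

lemma measurable_random_subset:
  assumes "finite A" "\<And>p. p \<in> A \<Longrightarrow> Measurable.pred M (P p)"
  shows "(\<lambda>\<omega>. {p\<in>A. P p \<omega>}) \<in> M \<rightarrow>\<^sub>M count_space (Pow A)"
proof -
  let ?f = "\<lambda>\<omega>. {p\<in>A. P p \<omega>}"
  have iff: "Measurable.pred M (\<lambda>\<omega>. P p \<omega> \<longleftrightarrow> p \<in> B)" if "p \<in> A" for p B
    using assms(2)[OF that] by measurable
  have "?f -` {B} \<inter> space M \<in> sets M" if "B \<in> Pow A" for B
  proof -
    have eq: "?f -` {B} \<inter> space M = {\<omega>\<in>space M. \<forall>p\<in>A. P p \<omega> \<longleftrightarrow> p \<in> B}"
      using that by blast
    show ?thesis
      unfolding eq using assms(1) iff by (intro sets.sets_Collect_finite_All) (auto simp: pred_def)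
  qed
  then show ?thesis
    using assms(1) measurable_count_space_eq2[of "Pow A" ?f M] by blast
qed

lemma pred_countable_Bex:
  assumes "countable C" "\<And>L. Measurable.pred M (P L)"
  shows "Measurable.pred M (\<lambda>x. \<exists>L\<in>C. P L x)"
proof -
  have "{x\<in>space M. \<exists>L\<in>C. P L x} = (\<Union>L\<in>C. {x\<in>space M. P L x})" by blast
  also have "\<dots> \<in> sets M"
    using assms by (intro sets.countable_UN') (auto simp: pred_def)
  finally show ?thesis by (simp add: pred_def)
qed

lemma pred_countable_Ball:
  assumes "countable C" "\<And>L. Measurable.pred M (P L)"
  shows "Measurable.pred M (\<lambda>x. \<forall>L\<in>C. P L x)"
proof -
  have "Measurable.pred M (\<lambda>x. \<not> (\<exists>L\<in>C. \<not> P L x))"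
    by (rule pred_intros_logic(2)[OF pred_countable_Bex[OF assms(1) pred_intros_logic(2)[OF assms(2)]]])
  then show ?thesis by simp
qed

text \<open>Induction over the draws: the last draw either fails and leaves the list unchanged, or
  succeeds and is its last element.\<close>

lemma pred_filtered_draws:
  fixes p :: "'a pmf" and ok :: "'a \<Rightarrow> bool"
  shows "Measurable.pred (PiM UNIV (\<lambda>_. measure_pmf p)) (\<lambda>d. filter ok (map d [0..<N]) = L)"
proof (induction N arbitrary: L)
  case (Suc N)
  have draw: "Measurable.pred (PiM UNIV (\<lambda>_. measure_pmf p)) (\<lambda>d. P (d j))" for P and j :: nat
    using sets_draw[of j "Collect P" p] by (simp add: pred_def)
  have eq: "filter ok (map d [0..<Suc N]) = L \<longleftrightarrow>
      \<not> ok (d N) \<and> filter ok (map d [0..<N]) = L \<or>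
      (ok (d N) \<and> L \<noteq> [] \<and> d N = last L) \<and> filter ok (map d [0..<N]) = butlast L" for d
    by (cases L rule: rev_cases) auto
  show ?case unfolding eq
    by (rule pred_intros_logic(5)[OF pred_intros_logic(3)[OF draw[of "\<lambda>x. \<not> ok x"] Suc.IH]
        pred_intros_logic(3)[OF draw[of "\<lambda>x. ok x \<and> L \<noteq> [] \<and> x = last L"] Suc.IH]])
qed simp

text \<open>The algorithm sees the draws only through the list of its first \<open>t\<close> successful samples.\<close>

definition output_on_samples ::
  "nat \<Rightarrow> real \<Rightarrow> nat \<Rightarrow> real \<Rightarrow> graph \<Rightarrow> nat set list \<Rightarrow> (nat \<Rightarrow> nat) \<Rightarrow> bool" where
  "output_on_samples n \<alpha> m \<zeta> E L \<sigma> \<longleftrightarrow>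
     (let H = square_threshold n \<alpha> E in
      \<exists>Q. map snd Q = L \<and> (\<forall>(\<sigma>, S)\<in>set Q. interval_order H S \<sigma>) \<and>
          ((\<nexists>a. consistent_signs m \<zeta> Q a) \<or>
           (\<exists>a. consistent_signs m \<zeta> Q a \<and>
                ranking n (local_refinement H (sketch_comparison m Q a)) \<sigma>)))"

text \<open>Moves the draws under a quantifier over lists of finite sets, of which there are
  countably many. Successful samples are finite because an interval order is a bijection onto
  \<open>{1..card S}\<close>.\<close>

lemma estimation_output_iff:
  "estimation_output n \<alpha> m t \<zeta> E d \<sigma> \<longleftrightarrow>
    (\<exists>L\<in>lists (Collect finite). (\<exists>N. filter (successful (square_threshold n \<alpha> E)) (map d [0..<N]) = L) \<and>
       length L = t \<and> output_on_samples n \<alpha> m \<zeta> E L \<sigma>)" (is "?l \<longleftrightarrow> ?r")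
proof
  have fin: "finite S" if "unit_interval_graph H S" for H S
    using that bij_betw_finite unfolding unit_interval_graph_def interval_order_def by blast
  assume ?l
  then obtain Q where Q: "sketching (square_threshold n \<alpha> E) t d Q" and
    "(\<nexists>a. consistent_signs m \<zeta> Q a) \<or> (\<exists>a. consistent_signs m \<zeta> Q a \<and>
       ranking n (local_refinement (square_threshold n \<alpha> E) (sketch_comparison m Q a)) \<sigma>)"
    by (auto simp: estimation_output_def Let_def)
  moreover from Q obtain N where N: "map snd Q = filter (successful (square_threshold n \<alpha> E)) (map d [0..<N])"
    "length Q = t" "\<forall>(\<sigma>, S)\<in>set Q. interval_order (square_threshold n \<alpha> E) S \<sigma>"
    by (auto simp: sketching_def)
  ultimately have "output_on_samples n \<alpha> m \<zeta> E (map snd Q) \<sigma>"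
    unfolding output_on_samples_def Let_def by blast
  moreover have "map snd Q \<in> lists (Collect finite)"
    unfolding N(1) by (auto intro: fin)
  moreover have "length (map snd Q) = t" using N(2) by simp
  ultimately show ?r using N(1)[symmetric] by blast
next
  assume ?r
  then obtain L N where L: "filter (successful (square_threshold n \<alpha> E)) (map d [0..<N]) = L" "length L = t"
    "output_on_samples n \<alpha> m \<zeta> E L \<sigma>" by blast
  then obtain Q where Q: "map snd Q = L" "\<forall>(\<sigma>, S)\<in>set Q. interval_order (square_threshold n \<alpha> E) S \<sigma>"
    "(\<nexists>a. consistent_signs m \<zeta> Q a) \<or> (\<exists>a. consistent_signs m \<zeta> Q a \<and>
       ranking n (local_refinement (square_threshold n \<alpha> E) (sketch_comparison m Q a)) \<sigma>)"
    by (auto simp: output_on_samples_def Let_def)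
  have "length Q = t" using Q(1) L(2) by auto
  moreover have "map snd Q = filter (successful (square_threshold n \<alpha> E)) (map d [0..<N])"
    using Q(1) L(1) by simp
  ultimately have "sketching (square_threshold n \<alpha> E) t d Q"
    unfolding sketching_def using Q(2) by blast
  then show ?l unfolding estimation_output_def Let_def using Q(3) by blast
qed

text \<open>The permutations range over an uncountable type, but for a fixed list of samples the
  statements about them do not involve \<open>d\<close>, so only countable quantifiers over lists
  have to be measured.\<close>

lemma pred_all_outputs:
  "Measurable.pred (PiM UNIV (\<lambda>_. measure_pmf p)) (\<lambda>d.
     (\<exists>\<sigma>. estimation_output n \<alpha> m t \<zeta> E d \<sigma>) \<and> (\<forall>\<sigma>. estimation_output n \<alpha> m t \<zeta> E d \<sigma> \<longrightarrow> G \<sigma>))"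
proof -
  let ?C = "lists (Collect finite) :: nat set list set"
  let ?S = "\<lambda>d L. (\<exists>N. filter (successful (square_threshold n \<alpha> E)) (map d [0..<N]) = L) \<and> length L = t"
  have eq: "(\<exists>\<sigma>. estimation_output n \<alpha> m t \<zeta> E d \<sigma>) \<and> (\<forall>\<sigma>. estimation_output n \<alpha> m t \<zeta> E d \<sigma> \<longrightarrow> G \<sigma>) \<longleftrightarrow>
      (\<exists>L\<in>?C. ?S d L \<and> (\<exists>\<sigma>. output_on_samples n \<alpha> m \<zeta> E L \<sigma>)) \<and>
      (\<forall>L\<in>?C. ?S d L \<longrightarrow> (\<forall>\<sigma>. output_on_samples n \<alpha> m \<zeta> E L \<sigma> \<longrightarrow> G \<sigma>))" for d
    unfolding estimation_output_iff by blast
  have C: "countable ?C" by (intro countable_lists countable_Collect_finite)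
  have S: "Measurable.pred (PiM UNIV (\<lambda>_. measure_pmf p)) (\<lambda>d. ?S d L)" for L
    by (rule pred_intros_logic(3)[OF pred_intros_countable(2)[OF pred_filtered_draws]]) simp
  have "Measurable.pred (PiM UNIV (\<lambda>_. measure_pmf p))
      (\<lambda>d. \<exists>L\<in>?C. ?S d L \<and> (\<exists>\<sigma>. output_on_samples n \<alpha> m \<zeta> E L \<sigma>))"
    by (rule pred_countable_Bex[OF C pred_intros_logic(3)[OF S]]) simp
  moreover have "Measurable.pred (PiM UNIV (\<lambda>_. measure_pmf p))
      (\<lambda>d. \<forall>L\<in>?C. ?S d L \<longrightarrow> (\<forall>\<sigma>. output_on_samples n \<alpha> m \<zeta> E L \<sigma> \<longrightarrow> G \<sigma>))"
    by (rule pred_countable_Ball[OF C pred_intros_logic(4)[OF S]]) simp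
  ultimately show ?thesis unfolding eq by (rule pred_intros_logic(3))
qed

lemma measurable_unif01_coordinate:
  assumes "i \<in> I"
  shows "(\<lambda>U. U i) \<in> PiM I (\<lambda>_. unif01) \<rightarrow>\<^sub>M unif01"
  using assms by (rule measurable_component_singleton)

lemma unif01_borel: "f \<in> M \<rightarrow>\<^sub>M unif01 \<Longrightarrow> f \<in> borel_measurable M"
  by (auto simp: measurable_restrict_space2_iff)

text \<open>Positions and edge variables enter only through the edge set \<open>X\<close> and the
  set \<open>Y\<close> of comparisons of positions. These take finitely many values, and for fixed
  values \<open>pred_all_outputs\<close> applies.\<close>

lemma sample_space_event:
  assumes w: "graphon w"
  shows "{\<omega>\<in>space (sample_space n m). case \<omega> of (U, U', d) \<Rightarrow>
      correct_outputs n \<alpha> m t \<zeta> D (graphon_graph w n U U') U d} \<in> sets (sample_space n m)"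
proof -
  let ?M = "sample_space n m"
  let ?N = "PiM UNIV (\<lambda>_::nat. measure_pmf (subset_pmf n m))"
  have M: "?M = PiM {1..n} (\<lambda>_. unif01) \<Otimes>\<^sub>M PiM (pairs n) (\<lambda>_. unif01) \<Otimes>\<^sub>M ?N"
    by (simp add: sample_space_def pairs_def)
  have U: "(\<lambda>\<omega>. fst \<omega> i) \<in> ?M \<rightarrow>\<^sub>M unif01" if "i \<in> {1..n}" for i
    unfolding M by (rule measurable_compose[OF measurable_fst measurable_unif01_coordinate[OF that]])
  have U': "(\<lambda>\<omega>. fst (snd \<omega>) p) \<in> ?M \<rightarrow>\<^sub>M unif01" if "p \<in> pairs n" for p
    unfolding M
    by (rule measurable_compose[OF measurable_compose[OF measurable_snd measurable_fst] measurable_unif01_coordinate[OF that]])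
  have d: "(\<lambda>\<omega>. snd (snd \<omega>)) \<in> ?M \<rightarrow>\<^sub>M ?N"
    unfolding M by (rule measurable_compose[OF measurable_snd measurable_snd])
  have wm: "(\<lambda>(x, y). w x y) \<in> borel_measurable (unif01 \<Otimes>\<^sub>M unif01)" using w by (simp add: graphon_def)
  have wU: "(\<lambda>\<omega>. w (fst \<omega> i) (fst \<omega> j)) \<in> borel_measurable ?M" if "i \<in> {1..n}" "j \<in> {1..n}" for i j
    using measurable_compose[OF measurable_Pair[OF U[OF that(1)] U[OF that(2)]] wm] by simp
  define X where "X \<omega> = {p\<in>pairs n. fst (snd \<omega>) p < w (fst \<omega> (fst p)) (fst \<omega> (snd p))}"
    for \<omega> :: "(nat \<Rightarrow> real) \<times> (nat \<times> nat \<Rightarrow> real) \<times> (nat \<Rightarrow> nat set)"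
  define Y where "Y \<omega> = {p\<in>{1..n} \<times> {1..n}. fst \<omega> (snd p) \<le> fst \<omega> (fst p)}"
    for \<omega> :: "(nat \<Rightarrow> real) \<times> (nat \<times> nat \<Rightarrow> real) \<times> (nat \<Rightarrow> nat set)"
  have X: "X \<in> ?M \<rightarrow>\<^sub>M count_space (Pow (pairs n))"
    unfolding X_def
    by (rule measurable_random_subset[OF finite_pairs], rule borel_measurable_pred_less[OF unif01_borel[OF U'] wU])
      (auto simp: pairs_def)
  have Y: "Y \<in> ?M \<rightarrow>\<^sub>M count_space (Pow ({1..n} \<times> {1..n}))"
    unfolding Y_def not_less[symmetric]
    by (rule measurable_random_subset, simp,
        rule pred_intros_logic(2)[OF borel_measurable_pred_less[OF unif01_borel[OF U] unif01_borel[OF U]]]) auto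
  define gr where "gr I = {{i, j} | i j. (i, j) \<in> I}" for I :: "(nat \<times> nat) set"
  define err where "err O' \<sigma> \<longleftrightarrow> (\<exists>\<tau>\<in>{\<lambda>i. card {j. (i, j) \<in> O'}, \<lambda>i. n + 1 - card {j. (i, j) \<in> O'}}.
     \<forall>i\<in>{1..n}. \<forall>j\<in>{1..n}. real (\<tau> i) > real (\<tau> j) + D \<longrightarrow> \<sigma> i > \<sigma> j)"
    for O' :: "(nat \<times> nat) set" and \<sigma> :: "nat \<Rightarrow> nat"
  have gr: "graphon_graph w n (fst \<omega>) (fst (snd \<omega>)) = gr (X \<omega>)" for \<omega>
    by (auto simp: graphon_graph_def gr_def X_def pairs_def)
  have err: "error_less n (fst \<omega>) D \<sigma> \<longleftrightarrow> err (Y \<omega>) \<sigma>" for \<omega> \<sigma>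
  proof -
    have "{j. (i, j) \<in> Y \<omega>} = {j\<in>{1..n}. fst \<omega> j \<le> fst \<omega> i}" if "i \<in> {1..n}" for i
      using that by (auto simp: Y_def)
    then have "true_order n (fst \<omega>) i = card {j. (i, j) \<in> Y \<omega>}" if "i \<in> {1..n}" for i
      using that by (simp add: true_order_def)
    then show ?thesis by (simp add: error_less_def err_def reverse_order_def)
  qed
  let ?\<Phi> = "\<lambda>E O' d. (\<exists>\<sigma>. estimation_output n \<alpha> m t \<zeta> (gr E) d \<sigma>) \<and>
      (\<forall>\<sigma>. estimation_output n \<alpha> m t \<zeta> (gr E) d \<sigma> \<longrightarrow> bij_betw \<sigma> {1..n} {1..n} \<and> err O' \<sigma>)"
  have "Measurable.pred ?M (\<lambda>\<omega>. ?\<Phi> E O' (snd (snd \<omega>)))" for E O'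
    by (rule measurable_compose[OF d pred_all_outputs])
  then have "Measurable.pred ?M (\<lambda>\<omega>. ?\<Phi> E (Y \<omega>) (snd (snd \<omega>)))" for E
    by (rule measurable_compose_countable'[OF _ Y]) (simp add: countable_finite)
  then have "Measurable.pred ?M (\<lambda>\<omega>. ?\<Phi> (X \<omega>) (Y \<omega>) (snd (snd \<omega>)))"
    by (rule measurable_compose_countable'[OF _ X]) (simp add: countable_finite)
  then show ?thesis
    by (simp add: pred_def case_prod_beta gr err correct_outputs_def)
qed

section \<open>Failure probability of a sample\<close>

text \<open>\<open>s\<close> is the free parameter of the exponential moment bound for misclassified pairs.\<close>

definition sample_failure :: "nat \<Rightarrow> nat \<Rightarrow> nat \<Rightarrow> real \<Rightarrow> real \<Rightarrow> real \<Rightarrow> real \<Rightarrow> real \<Rightarrow> real \<Rightarrow> real" where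
  "sample_failure n m K \<epsilon> k g \<zeta> b s = real n * (exp (s * real m * b / real n) / (1 + s) powr k) +
     real K * (exp (- (real m / (4 * real K))) * 2 powr \<zeta>) +
     real n * real n * (exp (- (real m * \<epsilon> * g / 8)) * 2 powr (4 * k)) +
     exp (3 * real m * g) / 2 powr \<zeta> + exp (- (real m * g / 4))"

lemma sample_failure_nonneg: "0 \<le> s \<Longrightarrow> 0 \<le> sample_failure n m K \<epsilon> k g \<zeta> b s"
  unfolding sample_failure_def by (intro add_nonneg_nonneg mult_nonneg_nonneg divide_nonneg_nonneg) auto

lemma sample_failure_le:
  assumes "m1 \<le> real m" "real m \<le> m2" "0 \<le> s" "0 \<le> b" "0 \<le> \<epsilon>" "0 \<le> g"
  shows "sample_failure n m K \<epsilon> k g \<zeta> b s \<le> real n * (exp (s * m2 * b / real n) / (1 + s) powr k) +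
     real K * (exp (- (m1 / (4 * real K))) * 2 powr \<zeta>) +
     real n * real n * (exp (- (m1 * \<epsilon> * g / 8)) * 2 powr (4 * k)) +
     exp (3 * m2 * g) / 2 powr \<zeta> + exp (- (m1 * g / 4))"
  unfolding sample_failure_def using assms
  by (intro add_mono mult_left_mono mult_right_mono divide_right_mono exp_le_cancel_iff[THEN iffD2] le_imp_neg_le)
    (auto intro!: divide_right_mono mult_right_mono mult_left_mono)

text \<open>The counts may miss the means, or the known bounds on them, by constant factors; this
  absorbs the fluctuation of the positions for large \<open>n\<close>.\<close>

locale scaled_graph = sampling_scale +
  fixes b :: real
  assumes n: "0 < n" "m \<le> n" "2 \<le> m" and k_\<zeta>: "4 * k \<le> \<zeta>"
    and card_amb: "\<And>u. u \<in> {1..n} \<Longrightarrow> real (card (amb u)) \<le> b"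
    and card_cell: "\<And>i. i < K \<Longrightarrow> real n / (2 * real K) \<le> real (card (cell K i))"
    and card_separators: "\<And>u v. u \<in> {1..n} \<Longrightarrow> v \<in> {1..n} \<Longrightarrow> U u + g \<le> U v \<Longrightarrow>
      real n * \<epsilon> * g / 4 \<le> real (card (separators u v))"
    and card_low_le: "real (card {u\<in>{1..n}. U u \<le> 2 * g}) \<le> 3 * g * real n"
    and card_low_ge: "g * real n / 2 \<le> real (card {u\<in>{1..n}. U u \<le> g})"
begin

abbreviation "p \<equiv> subset_pmf n m"

lemma lower_tail:
  assumes "T \<subseteq> {1..n}" "c * real n \<le> real (card T)"
  shows "measure p {S. real (card (S \<inter> T)) \<le> a} \<le> exp (- (real m * c / 2)) * 2 powr a"
proof -
  have "real m * c / 2 = real m * (c * real n) / (2 * real n)" using n by simp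
  also have "\<dots> \<le> real m * real (card T) / (2 * real n)"
    using assms by (intro divide_right_mono mult_left_mono) auto
  finally have "exp (- (real m * real (card T) / (2 * real n))) * 2 powr a \<le> exp (- (real m * c / 2)) * 2 powr a"
    by (intro mult_right_mono) auto
  with subset_pmf_lower_tail[OF n(2,1) assms(1), of a] show ?thesis by linarith
qed

lemma upper_tail:
  assumes "T \<subseteq> {1..n}" "real (card T) \<le> c" "0 \<le> s"
  shows "measure p {S. a \<le> real (card (S \<inter> T))} \<le> exp (s * real m * c / real n) / (1 + s) powr a"
proof -
  have "exp (s * real m * real (card T) / real n) / (1 + s) powr a \<le> exp (s * real m * c / real n) / (1 + s) powr a"
    using assms by (intro divide_right_mono exp_le_cancel_iff[THEN iffD2] mult_left_mono) auto
  with subset_pmf_upper_tail[OF n(2,1) assms(1,3), of a] show ?thesis by linarith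
qed

lemma cell_miss:
  assumes "i < K"
  shows "measure p {S. real (card (S \<inter> cell K i)) \<le> a} \<le> exp (- (real m / (4 * real K))) * 2 powr a"
proof -
  have "measure p {S. real (card (S \<inter> cell K i)) \<le> a} \<le> exp (- (real m * (1 / (2 * real K)) / 2)) * 2 powr a"
    using card_cell[OF assms] by (intro lower_tail) (auto simp: cell_def)
  then show ?thesis by simp
qed

text \<open>Union bound over the ways to violate \<open>good_sample\<close>: too many misclassified
  partners of a vertex, a sparse cell, too few separators of a distant pair, a crowded and an empty
  low part. The bound \<open>4 * k\<close> for cells follows from
  \<open>4 * k \<le> \<zeta>\<close>.\<close>

lemma prob_sample_failure:
  assumes s: "0 \<le> s"
  shows "measure p (- {S. good_sample m K k g \<zeta> S}) \<le> sample_failure n m K \<epsilon> k g \<zeta> b s"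
proof -
  let ?B1 = "\<Union>u\<in>{1..n}. {S. k \<le> real (card (S \<inter> amb u))}"
  let ?B2 = "\<Union>i<K. {S. real (card (S \<inter> cell K i)) \<le> \<zeta>}"
  let ?P = "{(u, v). u \<in> {1..n} \<and> v \<in> {1..n} \<and> U u + g \<le> U v}"
  let ?B3 = "\<Union>z\<in>?P. {S. real (card (S \<inter> separators (fst z) (snd z))) \<le> 4 * k}"
  let ?B4 = "{S. \<zeta> \<le> real (card (S \<inter> {u\<in>{1..n}. U u \<le> 2 * g}))}"
  let ?B5 = "{S. real (card (S \<inter> {u\<in>{1..n}. U u \<le> g})) \<le> 0}"
  have finP: "finite ?P" by (rule finite_subset[of _ "{1..n} \<times> {1..n}"]) auto
  have cardP: "real (card ?P) \<le> real n * real n"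
  proof -
    have "card ?P \<le> card ({1..n} \<times> {1..n})" by (rule card_mono) auto
    then show ?thesis by (simp flip: of_nat_mult)
  qed
  have "- {S. good_sample m K k g \<zeta> S} \<inter> set_pmf p \<subseteq> ?B1 \<union> ?B2 \<union> ?B3 \<union> ?B4 \<union> ?B5"
  proof
    fix S assume S: "S \<in> - {S. good_sample m K k g \<zeta> S} \<inter> set_pmf p"
    then have S': "S \<subseteq> {1..n}" "card S = m" "finite S"
      using subset_family[OF n(2)] by (auto intro: finite_subset)
    show "S \<in> ?B1 \<union> ?B2 \<union> ?B3 \<union> ?B4 \<union> ?B5"
    proof (rule ccontr)
      assume no: "S \<notin> ?B1 \<union> ?B2 \<union> ?B3 \<union> ?B4 \<union> ?B5"
      have 1: "\<not> k \<le> real (card (S \<inter> amb u))" if "u \<in> {1..n}" for u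
        using no that by blast
      have 2: "\<not> real (card (S \<inter> cell K i)) \<le> \<zeta>" if "i < K" for i
        using no that by blast
      have 3: "\<not> real (card (S \<inter> separators u v)) \<le> 4 * k" if "u \<in> {1..n}" "v \<in> {1..n}" "U u + g \<le> U v" for u v
      proof
        assume "real (card (S \<inter> separators u v)) \<le> 4 * k"
        then have "S \<in> ?B3" using that by (intro UN_I[of "(u, v)"]) auto
        then show False using no by blast
      qed
      have 4: "\<not> \<zeta> \<le> real (card (S \<inter> {u\<in>{1..n}. U u \<le> 2 * g}))" using no by blast
      have 5: "S \<inter> {u\<in>{1..n}. U u \<le> g} \<noteq> {}"
      proof
        assume *: "S \<inter> {u\<in>{1..n}. U u \<le> g} = {}"
        have "S \<in> ?B5" unfolding mem_Collect_eq * by simp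
        then show False using no by blast
      qed
      have "good_sample m K k g \<zeta> S"
        unfolding good_sample_def
      proof (intro conjI ballI allI impI)
        show "4 * k < real (card (S \<inter> cell K i))" if "i < K" for i
          using 2[OF that] k_\<zeta> by linarith
      qed (use S' 1 2 3 4 5 in \<open>simp_all only: not_le order.strict_implies_order not_False_eq_True\<close>)
      then show False using S by simp
    qed
  qed
  then have "measure p (- {S. good_sample m K k g \<zeta> S} \<inter> set_pmf p) \<le> measure p (?B1 \<union> ?B2 \<union> ?B3 \<union> ?B4 \<union> ?B5)"
    by (intro measure_pmf.finite_measure_mono) auto
  then have "measure p (- {S. good_sample m K k g \<zeta> S}) \<le> measure p (?B1 \<union> ?B2 \<union> ?B3 \<union> ?B4 \<union> ?B5)"
    by (simp only: measure_Int_set_pmf)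
  also have "\<dots> \<le> measure p ?B1 + measure p ?B2 + measure p ?B3 + measure p ?B4 + measure p ?B5"
    by (intro order.trans[OF measure_Un_le] add_mono order.refl) auto
  also have "measure p ?B1 \<le> (\<Sum>u\<in>{1..n}. measure p {S. k \<le> real (card (S \<inter> amb u))})"
    by (intro measure_UNION_le) auto
  also have "\<dots> \<le> (\<Sum>u\<in>{1..n}. exp (s * real m * b / real n) / (1 + s) powr k)"
    by (intro sum_mono upper_tail card_amb s) (auto simp: amb_def)
  also have "measure p ?B2 \<le> (\<Sum>i<K. measure p {S. real (card (S \<inter> cell K i)) \<le> \<zeta>})"
    by (intro measure_UNION_le) auto
  also have "\<dots> \<le> (\<Sum>i<K. exp (- (real m / (4 * real K))) * 2 powr \<zeta>)"
    by (intro sum_mono cell_miss) auto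
  also have "measure p ?B3 \<le> (\<Sum>z\<in>?P. measure p {S. real (card (S \<inter> separators (fst z) (snd z))) \<le> 4 * k})"
    using finP by (intro measure_UNION_le) auto
  also have "\<dots> \<le> (\<Sum>z\<in>?P. exp (- (real m * \<epsilon> * g / 8)) * 2 powr (4 * k))"
  proof (rule sum_mono)
    fix z assume "z \<in> ?P"
    then have "real n * \<epsilon> * g / 4 \<le> real (card (separators (fst z) (snd z)))"
      using card_separators[of "fst z" "snd z"] by (simp add: case_prod_beta)
    then have "measure p {S. real (card (S \<inter> separators (fst z) (snd z))) \<le> 4 * k}
        \<le> exp (- (real m * (\<epsilon> * g / 4) / 2)) * 2 powr (4 * k)"
      by (intro lower_tail) (auto simp: separators_def mult_ac)
    then show "measure p {S. real (card (S \<inter> separators (fst z) (snd z))) \<le> 4 * k}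
        \<le> exp (- (real m * \<epsilon> * g / 8)) * 2 powr (4 * k)" by (simp add: mult_ac)
  qed
  also have "\<dots> = real (card ?P) * (exp (- (real m * \<epsilon> * g / 8)) * 2 powr (4 * k))" by simp
  also have "\<dots> \<le> real n * real n * (exp (- (real m * \<epsilon> * g / 8)) * 2 powr (4 * k))"
    by (rule mult_right_mono[OF cardP]) simp
  also have "measure p ?B4 \<le> exp (3 * real m * g) / 2 powr \<zeta>"
  proof -
    have "measure p ?B4 \<le> exp (1 * real m * (3 * g * real n) / real n) / (1 + 1) powr \<zeta>"
      by (rule upper_tail[OF _ card_low_le]) auto
    also have "1 * real m * (3 * g * real n) / real n = 3 * real m * g" using n by simp
    finally show ?thesis by simp
  qed
  also have "measure p ?B5 \<le> exp (- (real m * g / 4))"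
  proof -
    have "measure p ?B5 \<le> exp (- (real m * (g / 2) / 2)) * 2 powr 0"
      using card_low_ge by (intro lower_tail) auto
    then show ?thesis by simp
  qed
  finally show ?thesis by (simp add: sample_failure_def)
qed

text \<open>A misclassified pair may be contained in no successful sample at all, so that it has to be
  excluded here and in the final count.\<close>

lemma pair_success:
  assumes uv: "u \<in> {1..n}" "v \<in> {1..n}" "v \<notin> amb u"
  shows "real m * (real m - 1) / (real n * (real n - 1)) - (b * real m ^ 4 / real n ^ 3 + 2 * b * real m ^ 3 / real n ^ 3)
      - real K * exp (- (real m / (4 * real K)))
    \<le> measure p {S. u \<in> S \<and> v \<in> S \<and> successful H S}"
proof -
  have ne: "u \<noteq> v" using self_amb uv by auto
  let ?A = "{S. {u, v} \<subseteq> S}"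
  let ?D = "{S. {u, v} \<subseteq> S \<and> (\<exists>x\<in>S. \<exists>y\<in>S. x \<in> {1..n} \<and> y \<in> {1..n} \<and> x \<noteq> y \<and> y \<in> amb x)}"
  let ?C = "\<Union>i<K. {S. real (card (S \<inter> cell K i)) \<le> 0}"
  let ?T = "{S. u \<in> S \<and> v \<in> S \<and> successful H S}"
  \<comment> \<open>By \<open>clean_sample_succeeds\<close> a sample with \<open>u\<close> and
    \<open>v\<close> fails only if it contains a misclassified pair or misses a cell.\<close>
  have "?A \<inter> set_pmf p \<subseteq> ?T \<union> ?D \<union> ?C"
  proof
    fix S assume "S \<in> ?A \<inter> set_pmf p"
    then have S: "{u, v} \<subseteq> S" "S \<subseteq> {1..n}" "finite S"
      using subset_family[OF n(2)] by (auto intro: finite_subset)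
    show "S \<in> ?T \<union> ?D \<union> ?C"
    proof (rule ccontr)
      assume no: "S \<notin> ?T \<union> ?D \<union> ?C"
      have cells: "S \<inter> cell K i \<noteq> {}" if "i < K" for i
      proof
        assume *: "S \<inter> cell K i = {}"
        have "S \<in> {S. real (card (S \<inter> cell K i)) \<le> 0}" unfolding mem_Collect_eq * by simp
        then show False using no that by blast
      qed
      have clean: "y \<notin> amb x" if "x \<in> S" "y \<in> S" "x \<noteq> y" for x y
        using no S that by blast
      have "successful H S"
        using clean_sample_succeeds[OF S(2) clean cells] K by auto
      then show False using no S by blast
    qed
  qed
  then have "measure p (?A \<inter> set_pmf p) \<le> measure p (?T \<union> ?D \<union> ?C)"
    by (intro measure_pmf.finite_measure_mono) auto
  then have "measure p ?A \<le> measure p (?T \<union> ?D \<union> ?C)"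
    by (simp only: measure_Int_set_pmf)
  also have "\<dots> \<le> measure p ?T + measure p ?D + measure p ?C"
    by (intro order.trans[OF measure_Un_le] add_mono order.refl) auto
  also have "measure p ?D \<le> b * real m ^ 4 / real n ^ 3 + 2 * b * real m ^ 3 / real n ^ 3"
    using uv ne card_amb amb_sym by (intro subset_pmf_clean_pair n) (auto simp: amb_def)
  also have "measure p ?C \<le> (\<Sum>i<K. measure p {S. real (card (S \<inter> cell K i)) \<le> 0})"
    by (intro measure_UNION_le) auto
  also have "\<dots> \<le> (\<Sum>i<K. exp (- (real m / (4 * real K))) * 2 powr 0)"
    by (intro sum_mono cell_miss) auto
  finally show ?thesis
    using subset_pmf_pair[OF n(2,3) uv(1,2) ne] by simp
qed

end

section \<open>Concentration of the vertex positions\<close>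

locale good_graphon =
  fixes w :: "real \<Rightarrow> real \<Rightarrow> real" and \<alpha> \<epsilon> A :: real
  assumes w: "graphon w" and \<epsilon>01: "0 < \<epsilon>" "\<epsilon> < 1" and A: "0 < A"
    and diag: "diagonally_increasing (thresholded_square w \<alpha>)"
    and good_level: "uniformly_good A \<epsilon> \<alpha> (square w)"
    and conn: "connected_at \<epsilon> \<alpha> (square w)"
    and split: "has_split \<epsilon> (thresholded_square w \<alpha>)"
    and sep: "separated \<epsilon> (thresholded_square w \<alpha>)"
begin

definition R :: "real \<Rightarrow> real \<Rightarrow> bool" where
  "R x y \<longleftrightarrow> \<alpha> < square w x y"

lemma thresholded: "thresholded_square w \<alpha> x y = (if R x y then 1 else 0)"
  by (simp add: thresholded_square_def R_def)

sublocale unif: prob_space unif01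
  by (rule prob_space_unif01)

lemma w_measurable: "(\<lambda>(x, y). w x y) \<in> borel_measurable (unif01 \<Otimes>\<^sub>M unif01)"
  using w by (simp add: graphon_def)

lemma w_compose:
  assumes "f \<in> M \<rightarrow>\<^sub>M unif01" "h \<in> M \<rightarrow>\<^sub>M unif01"
  shows "(\<lambda>z. w (f z) (h z)) \<in> borel_measurable M"
  using measurable_compose[OF measurable_Pair[OF assms] w_measurable] by simp

lemma square_measurable: "(\<lambda>(x, y). square w x y) \<in> borel_measurable (unif01 \<Otimes>\<^sub>M unif01)"
proof -
  have "(\<lambda>(z, u). w (fst z) u * w u (snd z)) \<in> borel_measurable ((unif01 \<Otimes>\<^sub>M unif01) \<Otimes>\<^sub>M unif01)"
    unfolding case_prod_beta
    by (intro borel_measurable_times w_compose measurable_compose[OF measurable_fst measurable_fst]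
        measurable_compose[OF measurable_fst measurable_snd] measurable_snd)
  then have "(\<lambda>z. \<integral>u. w (fst z) u * w u (snd z) \<partial>unif01) \<in> borel_measurable (unif01 \<Otimes>\<^sub>M unif01)"
    by (rule unif.borel_measurable_lebesgue_integral)
  then show ?thesis by (simp add: square_def case_prod_beta)
qed

lemma square_compose:
  assumes "f \<in> M \<rightarrow>\<^sub>M unif01" "h \<in> M \<rightarrow>\<^sub>M unif01"
  shows "(\<lambda>z. square w (f z) (h z)) \<in> borel_measurable M"
  using measurable_compose[OF measurable_Pair[OF assms] square_measurable] by simp

lemma square_sym:
  assumes "x \<in> {0..1}" "y \<in> {0..1}"
  shows "square w x y = square w y x"
  unfolding square_def
  by (rule Bochner_Integration.integral_cong) (use assms graphon_sym[OF w] in \<open>auto simp: mult.commute\<close>)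

lemma square_nonneg:
  assumes "x \<in> {0..1}" "y \<in> {0..1}"
  shows "0 \<le> square w x y"
  unfolding square_def using assms graphon_range[OF w] by (intro integral_nonneg_AE AE_I2) auto

text \<open>The infimum itself exceeds \<open>\<alpha>\<close>, and its excess is the margin. It
  keeps nearby pairs away from the threshold once \<open>\<delta> < \<kappa>\<close>.\<close>

lemma gap: "\<exists>\<kappa>>0. \<forall>x\<in>{0..1}. \<forall>y\<in>{0..1}. \<bar>x - y\<bar> \<le> \<epsilon> \<longrightarrow> \<alpha> + \<kappa> \<le> square w x y"
proof -
  let ?S = "{square w x y | x y. x \<in> {0..1} \<and> y \<in> {0..1} \<and> \<bar>x - y\<bar> \<le> \<epsilon>}"
  have bdd: "bdd_below ?S" using square_nonneg by (intro bdd_belowI[of _ 0]) auto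
  have "\<alpha> + (Inf ?S - \<alpha>) \<le> square w x y" if "x \<in> {0..1}" "y \<in> {0..1}" "\<bar>x - y\<bar> \<le> \<epsilon>" for x y
    using cInf_lower[OF _ bdd, of "square w x y"] that by auto
  moreover have "0 < Inf ?S - \<alpha>" using conn by (simp add: connected_at_def)
  ultimately show ?thesis by blast
qed

lemma near_R: "x \<in> {0..1} \<Longrightarrow> y \<in> {0..1} \<Longrightarrow> \<bar>x - y\<bar> \<le> \<epsilon> \<Longrightarrow> R x y"
  using gap unfolding R_def by force

sublocale diagonal_relation R \<epsilon>
proof
  fix x y z :: real
  show "R x y \<longleftrightarrow> R y x" if "x \<in> {0..1}" "y \<in> {0..1}"
    using square_sym[OF that] by (simp add: R_def)
  show "R x z" if "x \<in> {0..1}" "y \<in> {0..1}" "x < z" "z < y" "R x y"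
  proof -
    have "z \<in> {0..1}" using that by auto
    then have "thresholded_square w \<alpha> x z \<ge> thresholded_square w \<alpha> x y"
      using diag that unfolding diagonally_increasing_def by blast
    then show ?thesis using that(5) by (simp add: thresholded split: if_splits)
  qed
  show "R z y" if "x \<in> {0..1}" "y \<in> {0..1}" "x < z" "z < y" "R x y"
  proof -
    have "z \<in> {0..1}" using that by auto
    then have "thresholded_square w \<alpha> z y \<ge> thresholded_square w \<alpha> x y"
      using diag that unfolding diagonally_increasing_def by blast
    then show ?thesis using that(5) by (simp add: thresholded split: if_splits)
  qed
  show "\<not> R x y" if "x \<in> {0..1}" "y \<in> {0..1}" "x \<le> y - (1 - \<epsilon>)"
  proof
    assume "R x y"
    \<comment> \<open>\<open>y\<close> itself is the common neighbour that the split forbids, since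
      connectedness relates it to itself.\<close>
    moreover have "R y y" using near_R[of y y] that \<epsilon>01 by simp
    ultimately have "y \<in> {z\<in>{0..1}. thresholded_square w \<alpha> x z = 1 \<and> thresholded_square w \<alpha> y z = 1}"
      using that by (simp add: thresholded)
    then show False using split that unfolding has_split_def by blast
  qed
qed (use \<epsilon>01 near_R in auto)

lemma square_section: "x \<in> {0..1} \<Longrightarrow> (\<lambda>y. square w x y) \<in> borel_measurable unif01"
  by (rule square_compose) (auto intro: measurable_ident_sets)

lemma measure_near_level:
  assumes "x \<in> {0..1}" "0 < \<delta>" "\<delta> < \<epsilon>"
  shows "measure unif01 {y\<in>{0..1}. \<bar>\<alpha> - square w x y\<bar> \<le> \<delta>} \<le> A * \<delta>"
proof -
  have le1: "measure lborel {y\<in>{0..1}. \<bar>\<alpha> - square w x' y\<bar> \<le> \<delta>} \<le> 1" if "x' \<in> {0..1}" for x'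
    using unif.prob_le_1 by (subst measure_restrict_space[symmetric, of "{0..1}"]) auto
  have "measure lborel {y\<in>{0..1}. \<bar>\<alpha> - square w x y\<bar> \<le> \<delta>} \<le>
      (SUP x\<in>{0..1}. measure lborel {y\<in>{0..1}. \<bar>\<alpha> - square w x y\<bar> \<le> \<delta>})"
    using assms(1) le1 by (intro cSUP_upper bdd_aboveI2[of _ _ 1]) auto
  also have "\<dots> \<le> A * \<delta>" using good_level assms unfolding uniformly_good_def by blast
  finally show ?thesis by (subst measure_restrict_space) auto
qed

lemma measure_separators:
  assumes "x \<in> {0..1}" "y \<in> {0..1}"
  shows "measure unif01 {z\<in>{0..1}. R x z \<noteq> R y z} \<ge> \<epsilon> * \<bar>x - y\<bar>"
proof -
  have "{z\<in>{0..1}. R x z \<noteq> R y z} = {z\<in>{0..1}. \<bar>thresholded_square w \<alpha> x z - thresholded_square w \<alpha> y z\<bar> = 1}"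
    by (auto simp: thresholded)
  moreover have "measure lborel {z\<in>{0..1}. \<bar>thresholded_square w \<alpha> x z - thresholded_square w \<alpha> y z\<bar> = 1} \<ge> \<epsilon> * \<bar>x - y\<bar>"
    using sep assms unfolding separated_def by blast
  ultimately show ?thesis by (subst measure_restrict_space) auto
qed

lemma measure_interval: "0 \<le> a \<Longrightarrow> a \<le> b \<Longrightarrow> b \<le> 1 \<Longrightarrow> measure unif01 {c\<in>{0..1}. a \<le> c \<and> c \<le> b} = b - a"
proof -
  assume ab: "0 \<le> a" "a \<le> b" "b \<le> 1"
  then have "{c\<in>{0..1}. a \<le> c \<and> c \<le> b} = {a..b}" by auto
  then show ?thesis using ab by (simp add: measure_unif01)
qed

lemma measure_window:
  assumes "0 \<le> r"
  shows "measure unif01 {c\<in>{0..1}. \<bar>c - a\<bar> < r} \<le> 2 * r"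
proof -
  have "measure unif01 {c\<in>{0..1}. \<bar>c - a\<bar> < r} = measure lborel {c\<in>{0..1}. \<bar>c - a\<bar> < r}"
    by (rule measure_restrict_space) auto
  also have "\<dots> \<le> measure lborel {a - r..a + r}"
  proof (rule measure_mono_fmeasurable)
    have "{c\<in>{0..1}. \<bar>c - a\<bar> < r} = {0..1} \<inter> {a - r<..<a + r}" by (auto simp: abs_less_iff)
    then show "{c\<in>{0..1}. \<bar>c - a\<bar> < r} \<in> sets lborel" by simp
    show "{a - r..a + r} \<in> fmeasurable lborel" by (simp add: fmeasurable_def emeasure_lborel_Icc_eq)
  qed auto
  also have "\<dots> = 2 * r" using assms by simp
  finally show ?thesis .
qed

text \<open>All the information needed about the positions \<open>U\<close> is that sums of \<open>f (U u) (U v) (U x)\<close> over \<open>x\<close>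
  are close to their conditional means, for finitely many functions \<open>f\<close>.\<close>

definition statistic :: "(real \<Rightarrow> real \<Rightarrow> real \<Rightarrow> real) \<Rightarrow> bool" where
  "statistic f \<longleftrightarrow> (\<lambda>(a, b, c). f a b c) \<in> borel_measurable (unif01 \<Otimes>\<^sub>M unif01 \<Otimes>\<^sub>M unif01) \<and>
     (\<forall>a\<in>{0..1}. \<forall>b\<in>{0..1}. \<forall>c\<in>{0..1}. f a b c \<in> {0..1})"

text \<open>Equal \<open>u\<close> and \<open>v\<close> are allowed and serve statistics of a single
  position; for this reason the number of summands is not simply \<open>n - 2\<close>.\<close>

definition concentrated :: "nat \<Rightarrow> real \<Rightarrow> (real \<Rightarrow> real \<Rightarrow> real \<Rightarrow> real) \<Rightarrow> (nat \<Rightarrow> real) \<Rightarrow> bool" where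
  "concentrated n \<tau> f U \<longleftrightarrow> (\<forall>u\<in>{1..n}. \<forall>v\<in>{1..n}.
     \<bar>(\<Sum>x\<in>{1..n} - {u, v}. f (U u) (U v) (U x)) - real (card ({1..n} - {u, v})) * (\<integral>c. f (U u) (U v) c \<partial>unif01)\<bar> < \<tau>)"

lemma prob_concentrated:
  assumes fin: "finite \<F>" and f: "\<And>f. f \<in> \<F> \<Longrightarrow> statistic f" and n: "0 < n" and \<tau>: "0 \<le> \<tau>"
  shows "{U\<in>space (PiM {1..n} (\<lambda>_. unif01)). \<forall>f\<in>\<F>. concentrated n \<tau> f U} \<in> sets (PiM {1..n} (\<lambda>_. unif01))"
    and "measure (PiM {1..n} (\<lambda>_. unif01)) {U\<in>space (PiM {1..n} (\<lambda>_. unif01)). \<forall>f\<in>\<F>. concentrated n \<tau> f U}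
      \<ge> 1 - real (card \<F>) * (real n * real n * (2 * exp (- 2 * \<tau>\<^sup>2 / real n)))"
proof -
  let ?P = "PiM {1..n} (\<lambda>_. unif01)"
  interpret P: prob_space ?P by (rule prob_space_PiM) (rule prob_space_unif01)
  define Bad where "Bad f u v = {U\<in>space ?P. \<tau> \<le> \<bar>(\<Sum>x\<in>{1..n} - {u, v}. f (U u) (U v) (U x)) -
      real (card ({1..n} - {u, v})) * (\<integral>c. f (U u) (U v) c \<partial>unif01)\<bar>}" for f u v
  have Bad: "Bad f u v \<in> sets ?P" "measure ?P (Bad f u v) \<le> 2 * exp (- 2 * \<tau>\<^sup>2 / real n)"
    if "f \<in> \<F>" "u \<in> {1..n}" "v \<in> {1..n}" for f u v
  proof -
    have fm: "(\<lambda>(a, b, c). f a b c) \<in> borel_measurable (unif01 \<Otimes>\<^sub>M unif01 \<Otimes>\<^sub>M unif01)"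
      and f01: "\<And>a b c. a \<in> space unif01 \<Longrightarrow> b \<in> space unif01 \<Longrightarrow> c \<in> space unif01 \<Longrightarrow> f a b c \<in> {0..1}"
      using f[OF that(1)] unfolding statistic_def space_unif01 by blast+
    have "card {1..n} \<le> n" by simp
    note Hoeffding_given_two[OF prob_space_unif01 finite_atLeastAtMost that(2,3) this n fm f01 \<tau>]
    then show "Bad f u v \<in> sets ?P" "measure ?P (Bad f u v) \<le> 2 * exp (- 2 * \<tau>\<^sup>2 / real n)"
      unfolding Bad_def by blast+
  qed
  define B where "B = (\<Union>z\<in>\<F> \<times> {1..n} \<times> {1..n}. Bad (fst z) (fst (snd z)) (snd (snd z)))"
  have eq: "{U\<in>space ?P. \<forall>f\<in>\<F>. concentrated n \<tau> f U} = space ?P - B"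
  proof -
    have "B = (\<Union>f\<in>\<F>. \<Union>u\<in>{1..n}. \<Union>v\<in>{1..n}. Bad f u v)"
      unfolding B_def by fastforce
    then show ?thesis unfolding Bad_def concentrated_def not_le[symmetric] by blast
  qed
  have B: "B \<in> sets ?P"
    unfolding B_def using fin Bad(1) by (intro sets.finite_UN) (auto simp del: atLeastAtMost_iff)
  show "{U\<in>space ?P. \<forall>f\<in>\<F>. concentrated n \<tau> f U} \<in> sets ?P"
    unfolding eq using B by (rule sets.compl_sets)
  have "measure ?P B \<le> (\<Sum>z\<in>\<F> \<times> {1..n} \<times> {1..n}. measure ?P (Bad (fst z) (fst (snd z)) (snd (snd z))))"
    unfolding B_def using fin Bad(1) by (intro measure_UNION_le) (auto simp del: atLeastAtMost_iff)
  also have "\<dots> \<le> (\<Sum>z\<in>\<F> \<times> {1..n} \<times> {1..n}. 2 * exp (- 2 * \<tau>\<^sup>2 / real n))"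
    using Bad(2) by (intro sum_mono) (auto simp del: atLeastAtMost_iff)
  also have "\<dots> = real (card \<F>) * (real n * real n * (2 * exp (- 2 * \<tau>\<^sup>2 / real n)))"
    by (simp add: card_cartesian_product mult_ac)
  finally show "measure ?P {U\<in>space ?P. \<forall>f\<in>\<F>. concentrated n \<tau> f U}
      \<ge> 1 - real (card \<F>) * (real n * real n * (2 * exp (- 2 * \<tau>\<^sup>2 / real n)))"
    unfolding eq using P.prob_compl[OF B] by simp
qed

lemma concentrated_count:
  fixes P :: "real \<Rightarrow> real \<Rightarrow> real \<Rightarrow> bool"
  assumes c: "concentrated n \<tau> (\<lambda>a b c. if P a b c then 1 else 0) U"
    and uv: "u \<in> {1..n}" "v \<in> {1..n}"
    and meas: "{c\<in>{0..1}. P (U u) (U v) c} \<in> sets unif01"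
  defines "\<mu> \<equiv> measure unif01 {c\<in>{0..1}. P (U u) (U v) c}"
  shows "(real n - 2) * \<mu> - \<tau> \<le> real (card {x\<in>{1..n}. P (U u) (U v) (U x)})"
    and "real (card {x\<in>{1..n}. P (U u) (U v) (U x)}) \<le> real n * \<mu> + \<tau> + 2"
proof -
  let ?V = "{1..n} - {u, v}"
  have \<mu>: "0 \<le> \<mu>" by (simp add: \<mu>_def)
  have "(\<integral>c. (if P (U u) (U v) c then 1 else 0) \<partial>unif01) = (\<integral>c. indicator {c\<in>{0..1}. P (U u) (U v) c} c \<partial>unif01)"
    by (rule Bochner_Integration.integral_cong) (auto simp: indicator_def)
  also have "\<dots> = \<mu>"
    unfolding \<mu>_def by (subst Bochner_Integration.integral_indicator) (rule arg_cong[of _ _ "measure _"], auto)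
  finally have int: "(\<integral>c. (if P (U u) (U v) c then 1 else 0) \<partial>unif01) = \<mu>" .
  have sum: "(\<Sum>x\<in>?V. if P (U u) (U v) (U x) then 1 else (0::real)) = real (card {x\<in>?V. P (U u) (U v) (U x)})"
    by (simp flip: sum.inter_filter)
  have dev: "\<bar>real (card {x\<in>?V. P (U u) (U v) (U x)}) - real (card ?V) * \<mu>\<bar> < \<tau>"
    using c uv unfolding concentrated_def int[symmetric] sum[symmetric] by blast
  have cV: "real n - 2 \<le> real (card ?V)" "real (card ?V) \<le> real n"
  proof -
    have "card {u, v} \<le> 2" by (simp add: card_insert_if)
    then have "n - 2 \<le> card ?V" using card_Diff_subset[of "{u, v}" "{1..n}"] uv by simp
    then show "real n - 2 \<le> real (card ?V)" by linarith
    show "real (card ?V) \<le> real n" using card_mono[of "{1..n}" ?V] by simp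
  qed
  have le: "card {x\<in>?V. P (U u) (U v) (U x)} \<le> card {x\<in>{1..n}. P (U u) (U v) (U x)}"
    by (rule card_mono) auto
  have "card {x\<in>{1..n}. P (U u) (U v) (U x)} \<le> card ({x\<in>?V. P (U u) (U v) (U x)} \<union> {u, v})"
    by (rule card_mono) auto
  also have "\<dots> \<le> card {x\<in>?V. P (U u) (U v) (U x)} + card {u, v}" by (rule card_Un_le)
  also have "\<dots> \<le> card {x\<in>?V. P (U u) (U v) (U x)} + 2" by (simp add: card_insert_if)
  finally have ge: "real (card {x\<in>{1..n}. P (U u) (U v) (U x)}) \<le> real (card {x\<in>?V. P (U u) (U v) (U x)}) + 2"
    by linarith
  have "(real n - 2) * \<mu> \<le> real (card ?V) * \<mu>" "real (card ?V) * \<mu> \<le> real n * \<mu>"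
    using cV \<mu> by (auto intro: mult_right_mono)
  then show "(real n - 2) * \<mu> - \<tau> \<le> real (card {x\<in>{1..n}. P (U u) (U v) (U x)})"
    "real (card {x\<in>{1..n}. P (U u) (U v) (U x)}) \<le> real n * \<mu> + \<tau> + 2"
    using dev le ge unfolding abs_less_iff by linarith+
qed

end

text \<open>The inequalities that the choice of parameters has to satisfy. \<open>2 * \<tau>\<close>
  adds the fluctuations of positions and edges. In the bound for \<open>b\<close>, of the constant 3
  two stand for vertices omitted by the statistic and one for \<open>u\<close> itself.
  \<open>b < real n - 1\<close> leaves every vertex a correctly classified partner.\<close>

locale good_instance = good_graphon +
  fixes n m K :: nat and \<tau> \<delta> g g\<^sub>2 k \<zeta> b \<kappa> W D :: real
  assumes gap: "\<And>x y. x \<in> {0..1} \<Longrightarrow> y \<in> {0..1} \<Longrightarrow> \<bar>x - y\<bar> \<le> \<epsilon> \<Longrightarrow> \<alpha> + \<kappa> \<le> square w x y"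
    and n: "6 \<le> n" "2 \<le> m" "m \<le> n" and K: "4 \<le> K" "2 / real K \<le> \<epsilon>"
    and \<tau>: "0 < \<tau>" and \<delta>: "0 < \<delta>" "\<delta> < \<epsilon>" "\<delta> < \<kappa>" "2 * \<tau> \<le> \<delta> * (real n - 2)"
    and b: "real n * (A * \<delta>) + \<tau> + 3 \<le> b" "b < real n - 1"
    and g: "0 < g" "g < \<epsilon>" "g \<le> 1 / 4"
    and low: "real n * (2 * g) + \<tau> + 2 \<le> 3 * g * real n" "g * real n / 2 \<le> (real n - 2) * g - \<tau>"
    and cells: "real n / (2 * real K) \<le> (real n - 2) * (1 / real K) - \<tau>"
    and seps: "real n * \<epsilon> * g / 4 \<le> (real n - 2) * (\<epsilon> * g) - \<tau>"
    and g2: "0 < g\<^sub>2" "16 * b < (real n - 2) * (\<epsilon> * g\<^sub>2) - \<tau>"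
    and W: "real n * (2 * g\<^sub>2) + \<tau> + 2 \<le> W" "2 * W \<le> D"
    and k: "0 \<le> k" "4 * k \<le> \<zeta>"
begin

definition path_stat :: "real \<Rightarrow> real \<Rightarrow> real \<Rightarrow> real" where
  "path_stat x y z = w x z * w z y"

definition ambiguous_stat :: "real \<Rightarrow> real \<Rightarrow> real \<Rightarrow> real" where
  "ambiguous_stat x y z = (if \<bar>\<alpha> - square w x z\<bar> \<le> \<delta> then 1 else 0)"

definition separator_stat :: "real \<Rightarrow> real \<Rightarrow> real \<Rightarrow> real" where
  "separator_stat x y z = (if R x z \<noteq> R y z then 1 else 0)"

definition window_stat :: "real \<Rightarrow> real \<Rightarrow> real \<Rightarrow> real" where
  "window_stat x y z = (if \<bar>z - x\<bar> < g\<^sub>2 then 1 else 0)"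

definition interval_stat :: "real \<Rightarrow> real \<Rightarrow> real \<Rightarrow> real \<Rightarrow> real \<Rightarrow> real" where
  "interval_stat l r x y z = (if l \<le> z \<and> z \<le> r then 1 else 0)"

definition stats :: "(real \<Rightarrow> real \<Rightarrow> real \<Rightarrow> real) set" where
  "stats = {path_stat, ambiguous_stat, separator_stat, window_stat, interval_stat 0 (2 * g), interval_stat 0 g} \<union>
     (\<lambda>i. interval_stat (real i / real K) (real (Suc i) / real K)) ` {..<K}"

lemma finite_stats: "finite stats"
  by (simp add: stats_def)

lemma card_stats: "card stats \<le> K + 6"
proof -
  have "card stats \<le> card {path_stat, ambiguous_stat, separator_stat, window_stat, interval_stat 0 (2 * g), interval_stat 0 g} +
     card ((\<lambda>i. interval_stat (real i / real K) (real (Suc i) / real K)) ` {..<K})"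
    unfolding stats_def by (rule card_Un_le)
  also have "card {path_stat, ambiguous_stat, separator_stat, window_stat, interval_stat 0 (2 * g), interval_stat 0 g} \<le> 6"
    using card_length[of "[path_stat, ambiguous_stat, separator_stat, window_stat, interval_stat 0 (2 * g), interval_stat 0 g]"] by simp
  also have "card ((\<lambda>i. interval_stat (real i / real K) (real (Suc i) / real K)) ` {..<K}) \<le> K"
    using card_image_le[of "{..<K}"] by simp
  finally show ?thesis by simp
qed

lemma indicator_statistic:
  assumes "Measurable.pred (unif01 \<Otimes>\<^sub>M unif01 \<Otimes>\<^sub>M unif01) (\<lambda>z. P (fst z) (fst (snd z)) (snd (snd z)))"
  shows "statistic (\<lambda>a b c. if P a b c then 1 else 0)"
proof -
  have "(\<lambda>z. if P (fst z) (fst (snd z)) (snd (snd z)) then 1 else (0::real)) \<in> borel_measurable (unif01 \<Otimes>\<^sub>M unif01 \<Otimes>\<^sub>M unif01)"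
    by (intro measurable_If borel_measurable_const) (use assms in \<open>simp add: pred_def\<close>)
  then show ?thesis unfolding statistic_def by (simp add: case_prod_beta)
qed

lemma stats_statistic:
  assumes "f \<in> stats"
  shows "statistic f"
proof -
  let ?M = "unif01 \<Otimes>\<^sub>M unif01 \<Otimes>\<^sub>M unif01"
  have p1: "(\<lambda>z. fst z) \<in> ?M \<rightarrow>\<^sub>M unif01" by (rule measurable_fst)
  have p2: "(\<lambda>z. fst (snd z)) \<in> ?M \<rightarrow>\<^sub>M unif01" by (rule measurable_compose[OF measurable_snd measurable_fst])
  have p3: "(\<lambda>z. snd (snd z)) \<in> ?M \<rightarrow>\<^sub>M unif01" by (rule measurable_compose[OF measurable_snd measurable_snd])
  note bp = unif01_borel[OF p1] unif01_borel[OF p2] unif01_borel[OF p3]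
  have lt: "Measurable.pred ?M (\<lambda>z. h z < j z)" if "h \<in> borel_measurable ?M" "j \<in> borel_measurable ?M" for h j :: "_ \<Rightarrow> real"
    by (rule borel_measurable_pred_less[OF that])
  have le: "Measurable.pred ?M (\<lambda>z. h z \<le> j z)" if "h \<in> borel_measurable ?M" "j \<in> borel_measurable ?M" for h j :: "_ \<Rightarrow> real"
    unfolding not_less[symmetric] by (rule pred_intros_logic(2)[OF lt[OF that(2,1)]])
  have path: "statistic path_stat"
  proof -
    have "(\<lambda>z. w (fst z) (snd (snd z)) * w (snd (snd z)) (fst (snd z))) \<in> borel_measurable ?M"
      by (intro borel_measurable_times w_compose p1 p2 p3)
    moreover have "w a c * w c b \<in> {0..1}" if "a \<in> {0..1}" "b \<in> {0..1}" "c \<in> {0..1}" for a b c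
      using graphon_range[OF w that(1,3)] graphon_range[OF w that(3,2)] by (auto intro: mult_le_one)
    ultimately show ?thesis by (simp add: statistic_def path_stat_def case_prod_beta)
  qed
  have ambst: "statistic ambiguous_stat"
    unfolding ambiguous_stat_def[abs_def]
    by (rule indicator_statistic, rule le)
      (intro borel_measurable_abs borel_measurable_diff borel_measurable_const square_compose p1 p3)+
  have R1: "Measurable.pred ?M (\<lambda>z. R (fst z) (snd (snd z)))"
    unfolding R_def by (rule lt[OF borel_measurable_const square_compose[OF p1 p3]])
  have R2: "Measurable.pred ?M (\<lambda>z. R (fst (snd z)) (snd (snd z)))"
    unfolding R_def by (rule lt[OF borel_measurable_const square_compose[OF p2 p3]])
  have sepst: "statistic separator_stat"
    unfolding separator_stat_def[abs_def]
    by (rule indicator_statistic, rule pred_intros_logic(2)[OF pred_intros_logic(6)[OF R1 R2]])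
  have winst: "statistic window_stat"
    unfolding window_stat_def[abs_def]
    by (rule indicator_statistic, rule lt) (intro borel_measurable_abs borel_measurable_diff borel_measurable_const bp)+
  have intst: "statistic (interval_stat l r)" for l r
    unfolding interval_stat_def[abs_def]
    by (rule indicator_statistic, rule pred_intros_logic(3)[OF le[OF borel_measurable_const bp(3)] le[OF bp(3) borel_measurable_const]])
  show ?thesis using assms path ambst sepst winst intst by (auto simp: stats_def)
qed

section \<open>Counts implied by concentrated positions\<close>

context
  fixes U :: "nat \<Rightarrow> real"
  assumes U01: "\<And>i. i \<in> {1..n} \<Longrightarrow> U i \<in> {0..1}"
    and conc: "\<And>f. f \<in> stats \<Longrightarrow> concentrated n \<tau> f U"
begin

lemma set_of_pred: "Measurable.pred unif01 P \<Longrightarrow> {c\<in>{0..1}. P c} \<in> sets unif01"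
  by (simp add: pred_def)

lemma count_near_level:
  assumes "u \<in> {1..n}"
  shows "real (card {v\<in>{1..n}. \<bar>\<alpha> - square w (U u) (U v)\<bar> \<le> \<delta>}) + 1 \<le> b"
proof -
  have "{c\<in>{0..1}. \<bar>\<alpha> - square w (U u) c\<bar> \<le> \<delta>} \<in> sets unif01"
    unfolding not_less[symmetric]
    by (rule set_of_pred, rule pred_intros_logic(2), rule borel_measurable_pred_less)
      (intro borel_measurable_abs borel_measurable_diff borel_measurable_const square_section[OF U01[OF assms]])+
  then have "real (card {v\<in>{1..n}. \<bar>\<alpha> - square w (U u) (U v)\<bar> \<le> \<delta>})
      \<le> real n * measure unif01 {c\<in>{0..1}. \<bar>\<alpha> - square w (U u) c\<bar> \<le> \<delta>} + \<tau> + 2"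
    by (intro concentrated_count(2)[OF conc[of ambiguous_stat, unfolded ambiguous_stat_def[abs_def]] assms assms])
      (simp_all add: stats_def ambiguous_stat_def[abs_def])
  also have "\<dots> \<le> real n * (A * \<delta>) + \<tau> + 2"
    using measure_near_level[OF U01[OF assms] \<delta>(1,2)] by (intro add_right_mono mult_left_mono) auto
  finally show ?thesis using b by linarith
qed

lemma count_separators:
  assumes "u \<in> {1..n}" "v \<in> {1..n}"
  shows "(real n - 2) * (\<epsilon> * \<bar>U u - U v\<bar>) - \<tau> \<le> real (card {x\<in>{1..n}. R (U u) (U x) \<noteq> R (U v) (U x)})"
proof -
  have "{c\<in>{0..1}. R (U u) c \<noteq> R (U v) c} \<in> sets unif01"
    unfolding R_def
    by (rule set_of_pred, rule pred_intros_logic(2), rule pred_intros_logic(6); rule borel_measurable_pred_less)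
      (rule borel_measurable_const square_section[OF U01[OF assms(1)]] square_section[OF U01[OF assms(2)]])+
  then have "(real n - 2) * measure unif01 {c\<in>{0..1}. R (U u) c \<noteq> R (U v) c} - \<tau>
      \<le> real (card {x\<in>{1..n}. R (U u) (U x) \<noteq> R (U v) (U x)})"
    by (intro concentrated_count(1)[OF conc[of separator_stat, unfolded separator_stat_def[abs_def]] assms])
      (simp_all add: stats_def separator_stat_def[abs_def])
  moreover have "(real n - 2) * (\<epsilon> * \<bar>U u - U v\<bar>) \<le> (real n - 2) * measure unif01 {c\<in>{0..1}. R (U u) c \<noteq> R (U v) c}"
    using measure_separators[OF U01[OF assms(1)] U01[OF assms(2)]] n by (intro mult_left_mono) auto
  ultimately show ?thesis by linarith
qed

lemma count_window:
  assumes "u \<in> {1..n}"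
  shows "real (card {v\<in>{1..n}. \<bar>U v - U u\<bar> < g\<^sub>2}) \<le> W"
proof -
  have id: "(\<lambda>c. c) \<in> borel_measurable unif01" by (rule unif01_borel[OF measurable_ident_sets[OF refl]])
  have "{c\<in>{0..1}. \<bar>c - U u\<bar> < g\<^sub>2} \<in> sets unif01"
    using id by (intro set_of_pred borel_measurable_pred_less borel_measurable_abs borel_measurable_diff borel_measurable_const)
  then have "real (card {v\<in>{1..n}. \<bar>U v - U u\<bar> < g\<^sub>2})
      \<le> real n * measure unif01 {c\<in>{0..1}. \<bar>c - U u\<bar> < g\<^sub>2} + \<tau> + 2"
    by (intro concentrated_count(2)[OF conc[of window_stat, unfolded window_stat_def[abs_def]] assms assms])
      (simp_all add: stats_def window_stat_def[abs_def])
  also have "\<dots> \<le> real n * (2 * g\<^sub>2) + \<tau> + 2"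
    using measure_window[of g\<^sub>2 "U u"] g2 by (intro add_right_mono mult_left_mono) auto
  finally show ?thesis using W by linarith
qed

lemma count_interval:
  assumes "interval_stat l r \<in> stats" "0 \<le> l" "l \<le> r" "r \<le> 1"
  shows "(real n - 2) * (r - l) - \<tau> \<le> real (card {v\<in>{1..n}. l \<le> U v \<and> U v \<le> r})"
    and "real (card {v\<in>{1..n}. l \<le> U v \<and> U v \<le> r}) \<le> real n * (r - l) + \<tau> + 2"
proof -
  \<comment> \<open>An interval statistic ignores its first two arguments, for which vertex 1 is a
    mere placeholder.\<close>
  have 1: "1 \<in> {1..n}" using n by simp
  have "{c\<in>{0..1}. l \<le> c \<and> c \<le> r} = {l..r}" using assms by auto
  then have m: "{c\<in>{0..1}. l \<le> c \<and> c \<le> r} \<in> sets unif01"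
    using assms by (simp add: sets_restrict_space_iff)
  note c = concentrated_count[OF conc[OF assms(1), unfolded interval_stat_def[abs_def]] 1 1 m]
  show "(real n - 2) * (r - l) - \<tau> \<le> real (card {v\<in>{1..n}. l \<le> U v \<and> U v \<le> r})"
    "real (card {v\<in>{1..n}. l \<le> U v \<and> U v \<le> r}) \<le> real n * (r - l) + \<tau> + 2"
    using c unfolding measure_interval[OF assms(2-4)] by blast+
qed

lemma path_sum:
  assumes "u \<in> {1..n}" "v \<in> {1..n}" "u \<noteq> v"
  shows "\<bar>(\<Sum>x\<in>{1..n} - {u, v}. w (U u) (U x) * w (U x) (U v)) - (real n - 2) * square w (U u) (U v)\<bar> < \<tau>"
proof -
  have "card ({1..n} - {u, v}) = n - 2" using assms by (simp add: card_Diff_subset)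
  then have card: "real (card ({1..n} - {u, v})) = real n - 2" using n by (simp add: of_nat_diff)
  have "concentrated n \<tau> path_stat U" by (rule conc) (simp add: stats_def)
  then have "\<bar>(\<Sum>x\<in>{1..n} - {u, v}. path_stat (U u) (U v) (U x)) -
      real (card ({1..n} - {u, v})) * (\<integral>c. path_stat (U u) (U v) c \<partial>unif01)\<bar> < \<tau>"
    using assms unfolding concentrated_def by blast
  then show ?thesis unfolding card path_stat_def square_def .
qed

section \<open>The thresholded graph for typical positions and edges\<close>

context
  fixes U' :: "nat \<times> nat \<Rightarrow> real"
  assumes common: "\<And>u v. u \<in> {1..n} \<Longrightarrow> v \<in> {1..n} \<Longrightarrow> u \<noteq> v \<Longrightarrow>
    \<bar>real (card {x\<in>{1..n}. {u, x} \<in> graphon_graph w n U U' \<and> {v, x} \<in> graphon_graph w n U U'}) -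
      (\<Sum>x\<in>{1..n} - {u, v}. w (U u) (U x) * w (U x) (U v))\<bar> < \<tau>"
begin

abbreviation "E \<equiv> graphon_graph w n U U'"
abbreviation "H \<equiv> square_threshold n \<alpha> E"

interpretation approximated_graph R \<epsilon> n U H
  by unfold_locales (use U01 square_threshold_edge in auto)

text \<open>If \<open>H\<close> and \<open>R\<close> disagree, \<open>\<alpha> * (n - 2)\<close>
  separates the number of common neighbours from \<open>n - 2\<close> times the square value. These
  differ by less than \<open>2 * \<tau>\<close>: one \<open>\<tau>\<close> for the edges given the
  positions, one for the positions.\<close>

lemma amb_near_level:
  assumes "u \<in> {1..n}" "v \<in> amb u" "v \<noteq> u"
  shows "\<bar>\<alpha> - square w (U u) (U v)\<bar> \<le> \<delta>"
proof -
  have v: "v \<in> {1..n}" "({u, v} \<in> H) \<noteq> R (U u) (U v)" using assms by (auto simp: amb_def)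
  define c where "c = real (card {x\<in>{1..n}. {u, x} \<in> E \<and> {v, x} \<in> E})"
  have "\<bar>c - (real n - 2) * square w (U u) (U v)\<bar> < 2 * \<tau>"
    using common[OF assms(1) v(1)] path_sum[OF assms(1) v(1)] assms(3) unfolding c_def by linarith
  moreover have "{u, v} \<in> H \<longleftrightarrow> \<alpha> * (real n - 2) < c"
    unfolding c_def square_threshold_iff using assms v(1) by auto
  then have "(\<alpha> * (real n - 2) < c) \<noteq> (\<alpha> < square w (U u) (U v))"
    using v(2) by (simp add: R_def)
  ultimately have "\<bar>(\<alpha> - square w (U u) (U v)) * (real n - 2)\<bar> \<le> 2 * \<tau>"
  proof -
    assume c: "\<bar>c - (real n - 2) * square w (U u) (U v)\<bar> < 2 * \<tau>"
      and ne: "(\<alpha> * (real n - 2) < c) \<noteq> (\<alpha> < square w (U u) (U v))"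
    have n2: "0 < real n - 2" using n by simp
    define s where "s = (real n - 2) * square w (U u) (U v)"
    have "\<alpha> < square w (U u) (U v) \<longleftrightarrow> \<alpha> * (real n - 2) < s"
      unfolding s_def using n2 by (simp add: mult.commute)
    then have ne': "(\<alpha> * (real n - 2) < c) \<noteq> (\<alpha> * (real n - 2) < s)" using ne by simp
    have "(\<alpha> - square w (U u) (U v)) * (real n - 2) = \<alpha> * (real n - 2) - s"
      by (simp add: s_def algebra_simps)
    then show ?thesis using ne' c[folded s_def] by linarith
  qed
  moreover have "\<bar>(\<alpha> - square w (U u) (U v)) * (real n - 2)\<bar> = \<bar>\<alpha> - square w (U u) (U v)\<bar> * (real n - 2)"
    using n by (simp add: abs_mult)
  ultimately have "\<bar>\<alpha> - square w (U u) (U v)\<bar> * (real n - 2) \<le> \<delta> * (real n - 2)"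
    using \<delta>(4) by linarith
  then show ?thesis by (rule mult_right_le_imp_le) (use n in simp)
qed

lemma card_amb_le:
  assumes "u \<in> {1..n}"
  shows "real (card (amb u)) \<le> b"
proof -
  have "amb u \<subseteq> insert u {v\<in>{1..n}. \<bar>\<alpha> - square w (U u) (U v)\<bar> \<le> \<delta>}"
    using amb_near_level[OF assms] by (auto simp: amb_def)
  then have "card (amb u) \<le> card (insert u {v\<in>{1..n}. \<bar>\<alpha> - square w (U u) (U v)\<bar> \<le> \<delta>})"
    by (intro card_mono) auto
  also have "\<dots> \<le> card {v\<in>{1..n}. \<bar>\<alpha> - square w (U u) (U v)\<bar> \<le> \<delta>} + 1"
    by (simp add: card_insert_if)
  finally show ?thesis using count_near_level[OF assms] by linarith
qed

lemma near_not_amb: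
  assumes "u \<in> {1..n}" "v \<in> {1..n}" "u \<noteq> v" "\<bar>U u - U v\<bar> \<le> \<epsilon>"
  shows "v \<notin> amb u"
  using amb_near_level[OF assms(1), of v] gap[OF U01[OF assms(1)] U01[OF assms(2)] assms(4)] \<delta> assms(3) by auto

lemma separators_ge:
  assumes "u \<in> {1..n}" "v \<in> {1..n}" "U u + r \<le> U v" "0 < r"
  shows "(real n - 2) * (\<epsilon> * r) - \<tau> \<le> real (card (separators u v))"
proof -
  have "r \<le> \<bar>U u - U v\<bar>" using assms(3,4) by linarith
  then have "(real n - 2) * (\<epsilon> * r) \<le> (real n - 2) * (\<epsilon> * \<bar>U u - U v\<bar>)"
    using n \<epsilon>01 by (intro mult_left_mono) auto
  then show ?thesis using count_separators[OF assms(1,2)] by (simp add: separators_def)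
qed

lemma instance_scaled: "scaled_graph R \<epsilon> n U H m K k g \<zeta> b"
proof unfold_locales
  show "real (card (amb u)) \<le> b" if "u \<in> {1..n}" for u by (rule card_amb_le[OF that])
  show "real n / (2 * real K) \<le> real (card (cell K i))" if "i < K" for i
  proof -
    have "interval_stat (real i / real K) (real (Suc i) / real K) \<in> stats" using that by (auto simp: stats_def)
    moreover have "real (Suc i) / real K \<le> 1" using that by simp
    moreover have "real (Suc i) / real K - real i / real K = 1 / real K" by (simp flip: diff_divide_distrib)
    ultimately show ?thesis
      using count_interval(1)[of "real i / real K" "real (Suc i) / real K"] cells
      by (simp add: cell_def divide_right_mono)
  qed
  show "real n * \<epsilon> * g / 4 \<le> real (card (separators u v))"
    if "u \<in> {1..n}" "v \<in> {1..n}" "U u + g \<le> U v" for u v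
    using separators_ge[OF that g(1)] seps by linarith
  have nonneg: "{u\<in>{1..n}. 0 \<le> U u \<and> U u \<le> r} = {u\<in>{1..n}. U u \<le> r}" for r using U01 by auto
  show "real (card {u\<in>{1..n}. U u \<le> 2 * g}) \<le> 3 * g * real n"
  proof -
    have "interval_stat 0 (2 * g) \<in> stats" by (simp add: stats_def)
    then have "real (card {u\<in>{1..n}. 0 \<le> U u \<and> U u \<le> 2 * g}) \<le> real n * (2 * g - 0) + \<tau> + 2"
      by (rule count_interval(2)) (use g in auto)
    then show ?thesis using low(1) unfolding nonneg diff_zero by linarith
  qed
  show "g * real n / 2 \<le> real (card {u\<in>{1..n}. U u \<le> g})"
  proof -
    have "interval_stat 0 g \<in> stats" by (simp add: stats_def)
    then have "(real n - 2) * (g - 0) - \<tau> \<le> real (card {u\<in>{1..n}. 0 \<le> U u \<and> U u \<le> g})"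
      by (rule count_interval(1)) (use g in auto)
    then show ?thesis using low(2) unfolding nonneg diff_zero by linarith
  qed
qed (use n K k g in auto)

text \<open>With positions and edges fixed, only the draws are random. \<open>r\<close> bounds from
  below the probability that a draw succeeds and contains a given correctly classified pair;
  \<open>B\<close> is the length of the blocks in which a success is awaited.\<close>

lemma output_prob:
  assumes s: "0 \<le> s" and r: "0 \<le> r" "r \<le> 1"
    "r \<le> real m * (real m - 1) / (real n * (real n - 1)) - (b * real m ^ 4 / real n ^ 3 + 2 * b * real m ^ 3 / real n ^ 3)
      - real K * exp (- (real m / (4 * real K)))"
  shows "measure (PiM UNIV (\<lambda>_. measure_pmf (subset_pmf n m)))
     {d. correct_outputs n \<alpha> m t \<zeta> D E U d}
    \<ge> 1 - real (t * B) * sample_failure n m K \<epsilon> k g \<zeta> b s - real t * (1 - r) ^ B - real n * real n * (1 - r) ^ t"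
    (is "measure ?P ?E \<ge> _")
proof -
  interpret S: scaled_graph R \<epsilon> n U H m K k g \<zeta> b by (rule instance_scaled)
  interpret P: prob_space ?P by (intro prob_space_PiM) unfold_locales
  define G where "G = {S. good_sample m K k g \<zeta> S}"
  define Succ where "Succ = {S. successful H S}"
  define \<D> where "\<D> = (\<lambda>(u, v). {S. u \<in> S \<and> v \<in> S \<and> successful H S}) ` {(u, v). u \<in> {1..n} \<and> v \<in> {1..n} \<and> v \<notin> amb u}"
  let ?I = "{(u, v). u \<in> {1..n} \<and> v \<in> {1..n} \<and> v \<notin> amb u}"
  have finI: "finite ?I" by (rule finite_subset[of _ "{1..n} \<times> {1..n}"]) auto
  have "card \<D> \<le> card ?I" unfolding \<D>_def by (rule card_image_le[OF finI])
  also have "card ?I \<le> card ({1..n} \<times> {1..n})" by (rule card_mono) auto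
  finally have card\<D>: "real (card \<D>) \<le> real n * real n" by (simp flip: of_nat_mult)
  have pair: "r \<le> measure (subset_pmf n m) {S. u \<in> S \<and> v \<in> S \<and> successful H S}"
    if "u \<in> {1..n}" "v \<in> {1..n}" "v \<notin> amb u" for u v
    using S.pair_success[OF that] r(3) by linarith
  have \<D>: "r \<le> measure (subset_pmf n m) X" if X: "X \<in> \<D>" for X
  proof -
    obtain z where z: "z \<in> ?I" "X = (\<lambda>(u, v). {S. u \<in> S \<and> v \<in> S \<and> successful H S}) z"
      using X unfolding \<D>_def image_iff by blast
    obtain u v where uv: "z = (u, v)" by (rule prod.exhaust)
    have "u \<in> {1..n}" "v \<in> {1..n}" "v \<notin> amb u" using z(1) unfolding uv by blast+
    then show ?thesis using pair unfolding z(2) uv prod.case by blast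
  qed
  \<comment> \<open>The success probability is bounded below through vertex 1 and some correctly
    classified partner \<open>v\<close>, which exists because \<open>b < real n - 1\<close>.\<close>
  have one: "1 \<in> {1..n}" using n by simp
  have lt: "real (card (amb 1)) < real n" using card_amb_le[OF one] b(2) by linarith
  have "\<not> {1..n} \<subseteq> amb 1"
  proof
    assume "{1..n} \<subseteq> amb 1"
    then have "card {1..n} \<le> card (amb 1)" by (rule card_mono[OF finite_amb])
    then show False using lt by simp
  qed
  then obtain v where v: "v \<in> {1..n}" "v \<notin> amb 1" by blast
  have Succ: "r \<le> measure (subset_pmf n m) Succ"
  proof -
    have "measure (subset_pmf n m) {S. 1 \<in> S \<and> v \<in> S \<and> successful H S} \<le> measure (subset_pmf n m) Succ"
      by (rule measure_pmf.finite_measure_mono) (auto simp: Succ_def)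
    then show ?thesis using pair[OF one v] by linarith
  qed
  have "measure (subset_pmf n m) (- G) \<le> sample_failure n m K \<epsilon> k g \<zeta> b s"
    unfolding G_def by (rule S.prob_sample_failure[OF s])
  from prob_draws_ge[OF this r(1,2) Succ _ \<D>, of \<D> "t * B" t B] finI
  have "measure ?P {d. (\<forall>j<t * B. d j \<in> G) \<and> (\<forall>i<t. \<exists>j\<in>{i * B..<Suc i * B}. d j \<in> Succ) \<and> (\<forall>X\<in>\<D>. \<exists>j<t. d j \<in> X)}
    \<ge> 1 - real (t * B) * sample_failure n m K \<epsilon> k g \<zeta> b s - real t * (1 - r) ^ B - real (card \<D>) * (1 - r) ^ t"
    by (simp add: \<D>_def)
  moreover have "real (card \<D>) * (1 - r) ^ t \<le> real n * real n * (1 - r) ^ t"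
    using r by (intro mult_right_mono card\<D>) auto
  moreover have "measure ?P {d. (\<forall>j<t * B. d j \<in> G) \<and> (\<forall>i<t. \<exists>j\<in>{i * B..<Suc i * B}. d j \<in> Succ) \<and> (\<forall>X\<in>\<D>. \<exists>j<t. d j \<in> X)}
    \<le> measure ?P ?E"
  proof (rule P.finite_measure_mono)
    show "?E \<in> sets ?P"
      using pred_all_outputs[where p = "subset_pmf n m" and n = n and \<alpha> = \<alpha> and m = m and t = t and \<zeta> = \<zeta> and E = E and
          G = "\<lambda>\<sigma>. bij_betw \<sigma> {1..n} {1..n} \<and> error_less n U D \<sigma>"]
      by (simp add: pred_def correct_outputs_def)
    show "{d. (\<forall>j<t * B. d j \<in> G) \<and> (\<forall>i<t. \<exists>j\<in>{i * B..<Suc i * B}. d j \<in> Succ) \<and> (\<forall>X\<in>\<D>. \<exists>j<t. d j \<in> X)} \<subseteq> ?E"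
    proof
      fix d assume d: "d \<in> {d. (\<forall>j<t * B. d j \<in> G) \<and> (\<forall>i<t. \<exists>j\<in>{i * B..<Suc i * B}. d j \<in> Succ) \<and> (\<forall>X\<in>\<D>. \<exists>j<t. d j \<in> X)}"
      have "correct_outputs n \<alpha> m t \<zeta> D E U d"
      proof (rule S.output_correct[where M = "t * B" and b = "nat \<lfloor>b\<rfloor>" and W = "nat \<lfloor>W\<rfloor>" and g\<^sub>2 = g\<^sub>2])
        show "good_sample m K k g \<zeta> (d j)" if "j < t * B" for j using d that by (simp add: G_def)
        show "t \<le> length (filter (successful H) (map d [0..<t * B]))"
          by (rule blocks_give_successes) (use d in \<open>simp add: Succ_def\<close>)
        show "\<exists>j<t. u \<in> d j \<and> v \<in> d j \<and> successful H (d j)"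
          if "u \<in> {1..n}" "v \<in> {1..n}" "v \<notin> amb u" for u v
        proof -
          have "{S. u \<in> S \<and> v \<in> S \<and> successful H S} \<in> \<D>" using that by (auto simp: \<D>_def)
          then show ?thesis using d by fastforce
        qed
        show "card (amb u) \<le> nat \<lfloor>b\<rfloor>" if "u \<in> {1..n}" for u
          using card_amb_le[OF that] by (simp add: le_nat_floor)
        show "16 * nat \<lfloor>b\<rfloor> < card (separators u v)" if "u \<in> {1..n}" "v \<in> {1..n}" "U u + g\<^sub>2 \<le> U v" for u v
        proof -
          have "0 \<le> b" using card_amb_le[OF that(1)] by linarith
          then have "real (16 * nat \<lfloor>b\<rfloor>) \<le> 16 * b" by simp
          also have "\<dots> < real (card (separators u v))" using separators_ge[OF that g2(1)] g2(2) by linarith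
          finally show ?thesis by (simp only: of_nat_less_iff)
        qed
        show "card {k\<in>{1..n}. \<bar>U k - U i\<bar> < g\<^sub>2} \<le> nat \<lfloor>W\<rfloor>" if "i \<in> {1..n}" for i
          using count_window[OF that] by (intro le_nat_floor)
        show "2 * real (nat \<lfloor>W\<rfloor>) \<le> D"
        proof -
          have "0 \<le> W" using count_window[OF one] by linarith
          then have "real (nat \<lfloor>W\<rfloor>) \<le> W" by simp
          then show ?thesis using W(2) by linarith
        qed
      qed (use near_not_amb g g2 in auto)
      then show "d \<in> ?E" by simp
    qed
  qed
  ultimately show ?thesis by linarith
qed

end

end

end

section \<open>Asymptotics\<close>

text \<open>Positions, edges given positions, and draws given both fail with probability at most
  \<open>q\<close> each; Bernoulli's inequality turns \<open>(1 - q) ^ 3\<close> into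
  \<open>1 - 3 * q\<close>.\<close>

lemma (in good_instance) sample_space_prob:
  assumes q: "0 \<le> q" "q \<le> 1"
    and q1: "(real K + 6) * (real n * real n * (2 * exp (- 2 * \<tau>\<^sup>2 / real n))) \<le> q"
    and s: "0 \<le> s" and r: "0 \<le> r" "r \<le> 1"
      "r \<le> real m * (real m - 1) / (real n * (real n - 1)) - (b * real m ^ 4 / real n ^ 3 + 2 * b * real m ^ 3 / real n ^ 3)
        - real K * exp (- (real m / (4 * real K)))"
    and q2: "real (t * B) * sample_failure n m K \<epsilon> k g \<zeta> b s + real t * (1 - r) ^ B + real n * real n * (1 - r) ^ t \<le> q"
  shows "measure (sample_space n m) {\<omega>\<in>space (sample_space n m). case \<omega> of (U, U', d) \<Rightarrow>
      correct_outputs n \<alpha> m t \<zeta> D (graphon_graph w n U U') U d} \<ge> 1 - 3 * q"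
    (is "measure _ ?A \<ge> _")
proof -
  let ?M1 = "PiM {1..n} (\<lambda>_. unif01)"
  let ?M2 = "PiM (pairs n) (\<lambda>_. unif01)"
  let ?M3 = "PiM UNIV (\<lambda>_::nat. measure_pmf (subset_pmf n m))"
  have M: "sample_space n m = ?M1 \<Otimes>\<^sub>M (?M2 \<Otimes>\<^sub>M ?M3)" by (simp add: sample_space_def pairs_def)
  define \<A> where "\<A> = ?A"
  have A: "\<A> \<in> sets (?M1 \<Otimes>\<^sub>M (?M2 \<Otimes>\<^sub>M ?M3))" unfolding M[symmetric] \<A>_def by (rule sample_space_event[OF w])
  interpret P1: prob_space ?M1 by (intro prob_space_PiM prob_space_unif01)
  interpret P2: prob_space ?M2 by (intro prob_space_PiM prob_space_unif01)
  interpret P3: prob_space ?M3 by (intro prob_space_PiM) unfold_locales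
  interpret P23: pair_prob_space ?M2 ?M3 ..
  have \<tau>0: "0 \<le> \<tau>" and n0: "0 < n" using \<tau> n by auto
  define e where "e = real n * real n * (2 * exp (- 2 * \<tau>\<^sup>2 / real n))"
  have e0: "0 \<le> e" by (simp add: e_def)
  have q1': "(real K + 6) * e \<le> q" using q1 by (simp add: e_def)
  have "1 * e \<le> (real K + 6) * e" using e0 by (intro mult_right_mono) auto
  then have eq: "e \<le> q" using q1' by linarith
  define G1 where "G1 = {U\<in>space ?M1. \<forall>f\<in>stats. concentrated n \<tau> f U}"
  have G1: "G1 \<in> sets ?M1" "measure ?M1 G1 \<ge> 1 - q"
  proof -
    show "G1 \<in> sets ?M1"
      unfolding G1_def by (rule prob_concentrated(1)[OF finite_stats stats_statistic n0 \<tau>0])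
    have "real (card stats) * e \<le> (real K + 6) * e"
      using card_stats e0 by (intro mult_right_mono) auto
    then show "measure ?M1 G1 \<ge> 1 - q"
      using prob_concentrated(2)[OF finite_stats stats_statistic n0 \<tau>0] q1' unfolding G1_def e_def by linarith
  qed
  have "measure ?M1 G1 * ((1 - q) * (1 - q)) \<le> measure (?M1 \<Otimes>\<^sub>M (?M2 \<Otimes>\<^sub>M ?M3)) \<A>"
  proof (rule measure_pair_ge[OF _ _ A G1(1)])
    show "prob_space ?M1" "prob_space (?M2 \<Otimes>\<^sub>M ?M3)" by unfold_locales
    show "0 \<le> (1 - q) * (1 - q)" using q by simp
    fix U assume U: "U \<in> G1"
    have U01: "U i \<in> {0..1}" if "i \<in> {1..n}" for i
      using U that by (auto simp: G1_def space_PiM)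
    have conc: "concentrated n \<tau> f U" if "f \<in> stats" for f using U that by (simp add: G1_def)
    let ?AU = "{y\<in>space (?M2 \<Otimes>\<^sub>M ?M3). (U, y) \<in> \<A>}"
    have AU: "?AU \<in> sets (?M2 \<Otimes>\<^sub>M ?M3)"
    proof -
      have "?AU = Pair U -` \<A>"
        using sets.sets_into_space[OF A] by (auto simp: space_pair_measure)
      then show ?thesis using sets_Pair1[OF A] by simp
    qed
    let ?dev = "\<lambda>U' u v. \<bar>real (card {x\<in>{1..n}. {u, x} \<in> graphon_graph w n U U' \<and> {v, x} \<in> graphon_graph w n U U'}) -
         (\<Sum>x\<in>{1..n} - {u, v}. w (U u) (U x) * w (U x) (U v))\<bar>"
    let ?J = "{(u, v). u \<in> {1..n} \<and> v \<in> {1..n} \<and> u \<noteq> v}"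
    define Bad where "Bad = (\<Union>z\<in>?J. {U'\<in>space ?M2. \<tau> \<le> ?dev U' (fst z) (snd z)})"
    define G2 where "G2 = space ?M2 - Bad"
    have finJ: "finite ?J" by (rule finite_subset[of _ "{1..n} \<times> {1..n}"]) auto
    have "card ?J \<le> card ({1..n} \<times> {1..n})" by (rule card_mono) auto
    then have cardJ: "real (card ?J) \<le> real n * real n" by (simp flip: of_nat_mult)
    note cn = common_neighbours_concentration[OF w U01 _ _ _ \<tau>0]
    have Bad: "Bad \<in> sets ?M2"
      unfolding Bad_def by (rule sets.finite_UN[OF finJ]) (rule cn(1); auto)
    have "measure ?M2 Bad \<le> (\<Sum>z\<in>?J. measure ?M2 {U'\<in>space ?M2. \<tau> \<le> ?dev U' (fst z) (snd z)})"
      unfolding Bad_def by (rule measure_UNION_le[OF finJ]) (rule cn(1); auto)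
    also have "\<dots> \<le> (\<Sum>z\<in>?J. 2 * exp (- 2 * \<tau>\<^sup>2 / real n))"
      by (rule sum_mono) (rule cn(2); auto)
    also have "\<dots> = real (card ?J) * (2 * exp (- 2 * \<tau>\<^sup>2 / real n))" by simp
    also have "\<dots> \<le> e" unfolding e_def by (rule mult_right_mono[OF cardJ]) simp
    finally have G2: "G2 \<in> sets ?M2" "1 - q \<le> measure ?M2 G2"
      using Bad P2.prob_compl[OF Bad] eq by (auto simp: G2_def)
    have "measure ?M2 G2 * (1 - q) \<le> measure (?M2 \<Otimes>\<^sub>M ?M3) ?AU"
    proof (rule measure_pair_ge[OF _ _ AU G2(1)])
      show "prob_space ?M2" "prob_space ?M3" by unfold_locales
      show "0 \<le> 1 - q" using q by simp
      fix U' assume U': "U' \<in> G2"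
      have common: "?dev U' u v < \<tau>" if "u \<in> {1..n}" "v \<in> {1..n}" "u \<noteq> v" for u v
      proof (rule ccontr)
        assume "\<not> ?thesis"
        then have "U' \<in> Bad" unfolding Bad_def using that U' by (intro UN_I[of "(u, v)"]) (auto simp: G2_def)
        then show False using U' by (simp add: G2_def)
      qed
      have "{d\<in>space ?M3. (U', d) \<in> ?AU} =
        {d. correct_outputs n \<alpha> m t \<zeta> D (graphon_graph w n U U') U d}"
        using U U' unfolding \<A>_def M by (auto simp: space_pair_measure G1_def G2_def)
      then show "1 - q \<le> measure ?M3 {d\<in>space ?M3. (U', d) \<in> ?AU}"
        using output_prob[OF U01 conc common s r, of t B] q2 by simp
    qed
    moreover have "(1 - q) * (1 - q) \<le> measure ?M2 G2 * (1 - q)"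
      using G2(2) q by (intro mult_right_mono) auto
    ultimately show "(1 - q) * (1 - q) \<le> measure (?M2 \<Otimes>\<^sub>M ?M3) ?AU" by linarith
  qed
  moreover have "(1 - q) * ((1 - q) * (1 - q)) \<le> measure ?M1 G1 * ((1 - q) * (1 - q))"
    using G1(2) q by (intro mult_right_mono) auto
  moreover have "1 - 3 * q \<le> (1 - q) * ((1 - q) * (1 - q))"
  proof -
    have "1 + real 3 * (- q) \<le> (1 + - q) ^ 3" using q by (intro Bernoulli_inequality) auto
    then show ?thesis by (simp add: power3_eq_cube)
  qed
  ultimately show ?thesis unfolding \<A>_def M by linarith
qed

lemma nat_round_bounds:
  fixes x :: real
  assumes "1 \<le> x"
  shows "x / 2 \<le> real (nat (round x))" "real (nat (round x)) \<le> 2 * x"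
proof -
  have *: "\<bar>real_of_int (round x) - x\<bar> \<le> 1 / 2" by (rule of_int_round_abs_le)
  then have "0 \<le> round x" using assms by linarith
  then have "real (nat (round x)) = real_of_int (round x)" by simp
  then show "x / 2 \<le> real (nat (round x))" "real (nat (round x)) \<le> 2 * x"
    using * assms by linarith+
qed

lemma one_minus_power_le:
  fixes r :: real
  assumes "r \<le> 1" "a \<le> r * real N"
  shows "(1 - r) ^ N \<le> exp (- a)"
proof -
  have "(1 - r) ^ N \<le> exp (- r) ^ N"
    using assms(1) exp_ge_add_one_self[of "- r"] by (intro power_mono) auto
  also have "\<dots> = exp (- (r * real N))" by (simp add: exp_of_nat_mult[symmetric] mult.commute)
  also have "\<dots> \<le> exp (- a)" using assms(2) by simp
  finally show ?thesis .
qed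

context good_graphon
begin

text \<open>With \<open>L = ln n\<close>, deviations of order \<open>sqrt n * L\<close> have probability \<open>exp (- 2 L\<^sup>2)\<close>, which makes
  the number of misclassified pairs at a vertex \<open>O(sqrt n * L)\<close>. The distance \<open>g = 1 / L\<^sup>2\<close> is large
  enough for a sample of size \<open>L\<^sup>5\<close> to meet sets of measure \<open>\<epsilon> * g\<close> more than \<open>4 L\<^sup>2\<close> times, and small
  enough for \<open>{U \<le> 2 * g}\<close> to be met fewer than \<open>4 L\<^sup>4\<close> times.\<close>

lemma eventually_sample_space_prob:
  "\<forall>\<^sub>F n in sequentially.
    measure (sample_space n (sample_size n)) {\<omega>\<in>space (sample_space n (sample_size n)). case \<omega> of (U, U', d) \<Rightarrow>
      correct_outputs n \<alpha> (sample_size n) (running_time n) (4 * ln (real n) ^ 4) (sqrt (real n) * ln (real n) ^ 5) (graphon_graph w n U U') U d}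
    \<ge> 1 - 3 * exp (- (ln (real n) ^ 2))"
proof -
  obtain \<kappa> where \<kappa>: "0 < \<kappa>" "\<And>x y. x \<in> {0..1} \<Longrightarrow> y \<in> {0..1} \<Longrightarrow> \<bar>x - y\<bar> \<le> \<epsilon> \<Longrightarrow> \<alpha> + \<kappa> \<le> square w x y"
    using gap by blast
  define K where "K = nat \<lceil>2 / \<epsilon>\<rceil> + 4"
  have K4: "4 \<le> K" by (simp add: K_def)
  have "2 / \<epsilon> \<le> real (nat \<lceil>2 / \<epsilon>\<rceil>)" by (rule real_nat_ceiling_ge)
  then have "2 / \<epsilon> \<le> real K" by (simp add: K_def)
  then have K\<epsilon>: "2 / real K \<le> \<epsilon>" using \<epsilon>01 K4 by (simp add: field_simps)
  have K0: "0 < real K" using K4 by simp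
  \<comment> \<open>\<open>b = c * sqrt n * L\<close> with \<open>L = ln n\<close>: the mean number
    of vertices near the threshold gives \<open>3 * A\<close>, the deviation adds 1, and another 1
    covers lower order terms.\<close>
  define c where "c = 3 * A + 2"
  have c: "0 < c" using A by (simp add: c_def)
  \<comment> \<open>At distance \<open>C * L / sqrt n\<close> separation gives about
    \<open>\<epsilon> * C * sqrt n * L\<close> separators, more than twice the
    \<open>(16 * c + 1) * sqrt n * L\<close> needed for the margin and the deviation.\<close>
  define C where "C = (32 * c + 4) / \<epsilon>"
  have C: "0 < C" "\<epsilon> * C = 32 * c + 4" using c \<epsilon>01 by (auto simp: C_def)
  \<comment> \<open>\<open>\<rho>\<close>, \<open>h\<close> and \<open>d\<close> hide the rounding
    in \<open>K\<close>, so that the asymptotic estimates see only positive parameters.\<close>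
  define \<rho> where "\<rho> = real K"
  have \<rho>: "0 < \<rho>" using K0 by (simp add: \<rho>_def)
  define h where "h = 1 / real K"
  have h: "0 < h" using K0 by (simp add: h_def)
  define d where "d = real K + 6"
  have d: "0 < d" by (simp add: d_def)
  note params = d h \<epsilon>01(1) A \<kappa>(1) \<rho> c C(1)
  let ?L = "\<lambda>n. ln (real n)"
  have "\<forall>\<^sub>F n::nat in sequentially. 6 \<le> real n" by real_asymp
  moreover have "\<forall>\<^sub>F n::nat in sequentially. 1 \<le> ?L n" by real_asymp
  moreover have "\<forall>\<^sub>F n::nat in sequentially. 4 \<le> ?L n ^ 5" by real_asymp
  moreover have "\<forall>\<^sub>F n::nat in sequentially. 2 * ?L n ^ 5 \<le> real n" by real_asymp
  moreover have "\<forall>\<^sub>F n::nat in sequentially. real n * (A * (3 * ?L n / sqrt (real n))) + sqrt (real n) * ?L n + 3 \<le> c * sqrt (real n) * ?L n"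
    unfolding c_def using params by real_asymp
  \<comment> \<open>\<open>\<delta> = 3 * L / sqrt n\<close> instead of
    \<open>2 * L / sqrt n\<close> leaves room for the \<open>- 2\<close>.\<close>
  moreover have "\<forall>\<^sub>F n::nat in sequentially. 2 * (sqrt (real n) * ?L n) \<le> (3 * ?L n / sqrt (real n)) * (real n - 2)" by real_asymp
  moreover have "\<forall>\<^sub>F n::nat in sequentially. 3 * ?L n / sqrt (real n) < \<epsilon>" using params by real_asymp
  moreover have "\<forall>\<^sub>F n::nat in sequentially. 3 * ?L n / sqrt (real n) < \<kappa>" using params by real_asymp
  moreover have "\<forall>\<^sub>F n::nat in sequentially. c * sqrt (real n) * ?L n < real n - 1" using params by real_asymp
  moreover have "\<forall>\<^sub>F n::nat in sequentially. 1 / ?L n ^ 2 < \<epsilon>" using params by real_asymp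
  moreover have "\<forall>\<^sub>F n::nat in sequentially. 1 / ?L n ^ 2 \<le> 1 / 4" by real_asymp
  moreover have "\<forall>\<^sub>F n::nat in sequentially. real n * (2 * (1 / ?L n ^ 2)) + sqrt (real n) * ?L n + 2 \<le> 3 * (1 / ?L n ^ 2) * real n" by real_asymp
  moreover have "\<forall>\<^sub>F n::nat in sequentially. 1 / ?L n ^ 2 * real n / 2 \<le> (real n - 2) * (1 / ?L n ^ 2) - sqrt (real n) * ?L n" by real_asymp
  moreover have "\<forall>\<^sub>F n::nat in sequentially. real n * h / 2 \<le> (real n - 2) * h - sqrt (real n) * ?L n"
    using params by real_asymp
  moreover have "\<forall>\<^sub>F n::nat in sequentially. real n * \<epsilon> * (1 / ?L n ^ 2) / 4 \<le> (real n - 2) * (\<epsilon> * (1 / ?L n ^ 2)) - sqrt (real n) * ?L n"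
    using params by real_asymp
  moreover have "\<forall>\<^sub>F n::nat in sequentially. 16 * (c * sqrt (real n) * ?L n) < (real n - 2) * ((32 * c + 4) * (?L n / sqrt (real n))) - sqrt (real n) * ?L n"
    using params by real_asymp
  moreover have "\<forall>\<^sub>F n::nat in sequentially. real n * (2 * (C * (?L n / sqrt (real n)))) + sqrt (real n) * ?L n + 2 \<le> (2 * C + 2) * sqrt (real n) * ?L n"
    using params by real_asymp
  moreover have "\<forall>\<^sub>F n::nat in sequentially. 2 * ((2 * C + 2) * sqrt (real n) * ?L n) \<le> sqrt (real n) * ?L n ^ 5"
    using params by real_asymp
  moreover have "\<forall>\<^sub>F n::nat in sequentially. 4 * ?L n ^ 2 \<le> 4 * ?L n ^ 4" by real_asymp
  moreover have "\<forall>\<^sub>F n::nat in sequentially. 1 \<le> (real n * ?L n)\<^sup>2" by real_asymp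
  moreover have "\<forall>\<^sub>F n::nat in sequentially. 2 * (real n * ?L n)\<^sup>2 \<le> real n ^ 3" by real_asymp
  moreover have "\<forall>\<^sub>F n::nat in sequentially. ?L n ^ 2 / real n ^ 2 \<le> 1" by real_asymp
  moreover have "\<forall>\<^sub>F n::nat in sequentially. d * (real n * real n * (2 * exp (- (2 * ?L n ^ 2)))) \<le> exp (- (?L n ^ 2))"
    using params by real_asymp
  \<comment> \<open>Here \<open>r = L^2 / n^2\<close>: a pair is drawn with probability of order
    \<open>L^10 / n^2\<close>, while misclassified pairs cost only order
    \<open>L^21 / n^(5/2)\<close>.\<close>
  moreover have "\<forall>\<^sub>F n::nat in sequentially. ?L n ^ 2 / real n ^ 2 \<le>
      (?L n ^ 5 / 2) * (?L n ^ 5 / 2 - 1) / (real n * real n) -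
      ((c * sqrt (real n) * ?L n) * (2 * ?L n ^ 5) ^ 4 / real n ^ 3 + 2 * (c * sqrt (real n) * ?L n) * (2 * ?L n ^ 5) ^ 3 / real n ^ 3)
      - \<rho> * exp (- (?L n ^ 5 / 2 / (4 * \<rho>)))"
    using params by real_asymp
  \<comment> \<open>\<open>n ^ 6\<close> bounds the number \<open>t * n ^ 3\<close> of draws. With
    \<open>s = n powr (1 / 4)\<close> the exponent \<open>s * m * b / n\<close> tends to 0, whereas
    \<open>(1 + s) powr L^2\<close> is at least \<open>exp (L^3 / 4)\<close>. The divisor 7 gives
    equal shares to the seven terms to be added.\<close>
  moreover have "\<forall>\<^sub>F n::nat in sequentially. real n ^ 6 * (real n * (exp (real n powr (1 / 4) * (2 * ?L n ^ 5) * (c * sqrt (real n) * ?L n) / real n) / (1 + real n powr (1 / 4)) powr (?L n ^ 2)))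
      \<le> exp (- (?L n ^ 2)) / 7"
    using params by real_asymp
  moreover have "\<forall>\<^sub>F n::nat in sequentially. real n ^ 6 * (\<rho> * (exp (- (?L n ^ 5 / 2 / (4 * \<rho>))) * 2 powr (4 * ?L n ^ 4))) \<le> exp (- (?L n ^ 2)) / 7"
    using params by real_asymp
  moreover have "\<forall>\<^sub>F n::nat in sequentially. real n ^ 6 * (real n * real n * (exp (- (?L n ^ 5 / 2 * \<epsilon> * (1 / ?L n ^ 2) / 8)) * 2 powr (4 * ?L n ^ 2))) \<le> exp (- (?L n ^ 2)) / 7"
    using params by real_asymp
  moreover have "\<forall>\<^sub>F n::nat in sequentially. real n ^ 6 * (exp (3 * (2 * ?L n ^ 5) * (1 / ?L n ^ 2)) / 2 powr (4 * ?L n ^ 4)) \<le> exp (- (?L n ^ 2)) / 7"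
    by real_asymp
  moreover have "\<forall>\<^sub>F n::nat in sequentially. real n ^ 6 * exp (- (?L n ^ 5 / 2 * (1 / ?L n ^ 2) / 4)) \<le> exp (- (?L n ^ 2)) / 7"
    by real_asymp
  moreover have "\<forall>\<^sub>F n::nat in sequentially. real n ^ 3 * exp (- (?L n ^ 2 / real n ^ 2 * real n ^ 3)) \<le> exp (- (?L n ^ 2)) / 7"
    by real_asymp
  \<comment> \<open>\<open>r * t\<close> is at least of order \<open>L^4\<close>, which outweighs
    the \<open>n^2\<close> pairs to be covered.\<close>
  moreover have "\<forall>\<^sub>F n::nat in sequentially. real n * real n * exp (- (?L n ^ 2 / real n ^ 2 * ((real n * ?L n)\<^sup>2 / 2))) \<le> exp (- (?L n ^ 2)) / 7"
    by real_asymp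
  ultimately show ?thesis
  proof eventually_elim
    case (elim n)
    define m where "m = sample_size n"
    define t where "t = running_time n"
    define L where "L = ln (real n)"
    note e = elim[folded L_def, unfolded \<rho>_def]
    have L0: "0 < L" using e(2) by linarith
    have m: "L ^ 5 / 2 \<le> real m" "real m \<le> 2 * L ^ 5"
      using nat_round_bounds[of "L ^ 5"] e(3) unfolding m_def sample_size_def L_def by auto
    have t: "(real n * L)\<^sup>2 / 2 \<le> real t" "real t \<le> real n ^ 3"
      using nat_round_bounds[of "(real n * L)\<^sup>2"] e(20,21) unfolding t_def running_time_def L_def by auto
    have n0: "0 < real n" "0 < sqrt (real n)" using e(1) by auto
    have b0: "0 \<le> c * sqrt (real n) * L" using c n0 L0 by simp
    interpret good_instance w \<alpha> \<epsilon> A n m K "sqrt (real n) * L" "3 * L / sqrt (real n)" "1 / L ^ 2" "C * (L / sqrt (real n))"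
      "L ^ 2" "4 * L ^ 4" "c * sqrt (real n) * L" \<kappa> "(2 * C + 2) * sqrt (real n) * L" "sqrt (real n) * L ^ 5"
    proof unfold_locales
      show "real n / (2 * real K) \<le> (real n - 2) * (1 / real K) - sqrt (real n) * L"
        using e(14) by (simp add: h_def)
      show "\<alpha> + \<kappa> \<le> square w x y" if "x \<in> {0..1}" "y \<in> {0..1}" "\<bar>x - y\<bar> \<le> \<epsilon>" for x y
        by (rule \<kappa>(2)[OF that])
      show "6 \<le> n" using e(1) by simp
      show "2 \<le> m" using m(1) e(3) by linarith
      show "m \<le> n" using m(2) e(4) by linarith
      show "16 * (c * sqrt (real n) * L) < (real n - 2) * (\<epsilon> * (C * (L / sqrt (real n)))) - sqrt (real n) * L"
        using e(16) C(2) by (simp add: mult.assoc[symmetric])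
    qed (use e K4 K\<epsilon> L0 n0 C(1) in auto)
    have "1 - 3 * exp (- (L ^ 2)) \<le> measure (sample_space n m) {\<omega>\<in>space (sample_space n m). case \<omega> of (U, U', d) \<Rightarrow>
      correct_outputs n \<alpha> m t (4 * L ^ 4) (sqrt (real n) * L ^ 5) (graphon_graph w n U U') U d}"
    proof (rule sample_space_prob[where s = "real n powr (1 / 4)" and r = "L ^ 2 / real n ^ 2" and B = "n ^ 3"])
      show "(real K + 6) * (real n * real n * (2 * exp (- 2 * (sqrt (real n) * L)\<^sup>2 / real n))) \<le> exp (- (L ^ 2))"
        proof -
        have "- 2 * (sqrt (real n) * L)\<^sup>2 / real n = - (2 * L ^ 2)" using n0 by (simp add: power_mult_distrib)
        then show ?thesis using e(23) by (simp only: d_def)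
      qed
      show "L ^ 2 / real n ^ 2 \<le> real m * (real m - 1) / (real n * (real n - 1)) -
          (c * sqrt (real n) * L * real m ^ 4 / real n ^ 3 + 2 * (c * sqrt (real n) * L) * real m ^ 3 / real n ^ 3) -
          real K * exp (- (real m / (4 * real K)))"
      proof -
        have "(L ^ 5 / 2) * (L ^ 5 / 2 - 1) / (real n * real n) \<le> real m * (real m - 1) / (real n * (real n - 1))"
          using m(1) e(1,3) by (intro frac_le mult_mono) auto
        moreover have "c * sqrt (real n) * L * real m ^ 4 / real n ^ 3 \<le> c * sqrt (real n) * L * (2 * L ^ 5) ^ 4 / real n ^ 3"
          using m(2) b0 by (intro divide_right_mono mult_left_mono power_mono) auto
        moreover have "2 * (c * sqrt (real n) * L) * real m ^ 3 / real n ^ 3 \<le> 2 * (c * sqrt (real n) * L) * (2 * L ^ 5) ^ 3 / real n ^ 3"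
          using m(2) b0 by (intro divide_right_mono mult_left_mono power_mono) auto
        moreover have "real K * exp (- (real m / (4 * real K))) \<le> real K * exp (- (L ^ 5 / 2 / (4 * real K)))"
        proof -
          have "L ^ 5 / 2 / (4 * real K) \<le> real m / (4 * real K)" by (intro divide_right_mono m(1)) simp
          then show ?thesis by (intro mult_left_mono) auto
        qed
        ultimately show ?thesis using e(24) by linarith
      qed
      show "real (t * n ^ 3) * sample_failure n m K \<epsilon> (L ^ 2) (1 / L ^ 2) (4 * L ^ 4) (c * sqrt (real n) * L) (real n powr (1 / 4)) +
        real t * (1 - L ^ 2 / real n ^ 2) ^ n ^ 3 + real n * real n * (1 - L ^ 2 / real n ^ 2) ^ t \<le> exp (- (L ^ 2))"
      proof -
        have "real (t * n ^ 3) = real t * real n ^ 3" by simp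
        also have "\<dots> \<le> real n ^ 3 * real n ^ 3" by (intro mult_right_mono t(2)) simp
        also have "\<dots> = real n ^ 6" by (simp flip: power_add)
        finally have tB: "real (t * n ^ 3) \<le> real n ^ 6" .
        note sf = sample_failure_le[OF m, of "real n powr (1 / 4)" "c * sqrt (real n) * L" \<epsilon> "1 / L ^ 2" n K "L ^ 2" "4 * L ^ 4"]
        have "real (t * n ^ 3) * sample_failure n m K \<epsilon> (L ^ 2) (1 / L ^ 2) (4 * L ^ 4) (c * sqrt (real n) * L) (real n powr (1 / 4)) \<le>
          real n ^ 6 * (real n * (exp (real n powr (1 / 4) * (2 * L ^ 5) * (c * sqrt (real n) * L) / real n) / (1 + real n powr (1 / 4)) powr (L ^ 2)) +
             real K * (exp (- (L ^ 5 / 2 / (4 * real K))) * 2 powr (4 * L ^ 4)) +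
             real n * real n * (exp (- (L ^ 5 / 2 * \<epsilon> * (1 / L ^ 2) / 8)) * 2 powr (4 * L ^ 2)) +
             exp (3 * (2 * L ^ 5) * (1 / L ^ 2)) / 2 powr (4 * L ^ 4) + exp (- (L ^ 5 / 2 * (1 / L ^ 2) / 4)))"
          using sf b0 \<epsilon>01 by (intro mult_mono tB sample_failure_nonneg) auto
        also have "\<dots> \<le> 5 * (exp (- (L ^ 2)) / 7)"
          using e(25-29) unfolding distrib_left by linarith
        finally have 1: "real (t * n ^ 3) * sample_failure n m K \<epsilon> (L ^ 2) (1 / L ^ 2) (4 * L ^ 4) (c * sqrt (real n) * L) (real n powr (1 / 4))
          \<le> 5 * (exp (- (L ^ 2)) / 7)" .
        have "real t * (1 - L ^ 2 / real n ^ 2) ^ n ^ 3 \<le> real n ^ 3 * exp (- (L ^ 2 / real n ^ 2 * real n ^ 3))"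
          using e(22) by (intro mult_mono t one_minus_power_le) auto
        also have "\<dots> \<le> exp (- (L ^ 2)) / 7" by (rule e(30))
        finally have 2: "real t * (1 - L ^ 2 / real n ^ 2) ^ n ^ 3 \<le> exp (- (L ^ 2)) / 7" .
        have "real n * real n * (1 - L ^ 2 / real n ^ 2) ^ t \<le> real n * real n * exp (- (L ^ 2 / real n ^ 2 * ((real n * L)\<^sup>2 / 2)))"
          using e(22) t(1) by (intro mult_left_mono one_minus_power_le) (auto intro!: mult_left_mono)
        also have "\<dots> \<le> exp (- (L ^ 2)) / 7" by (rule e(31))
        finally show ?thesis using 1 2 by linarith
      qed
    qed (use e(22) L0 in auto)
    then show ?case unfolding m_def t_def L_def .
  qed
qed

end

theorem theorem3:
  fixes w :: "real \<Rightarrow> real \<Rightarrow> real" and \<alpha> \<epsilon> A :: real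
  assumes "graphon w"
    and "0 < \<alpha>" "\<alpha> < 1"
    and "0 < \<epsilon>" "\<epsilon> < 1"
    and "A > 0"
    and "diagonally_increasing (thresholded_square w \<alpha>)"
    and "uniformly_good A \<epsilon> \<alpha> (square w)"
    and "connected_at \<epsilon> \<alpha> (square w)"
    and "has_split \<epsilon> (thresholded_square w \<alpha>)"
    and "separated \<epsilon> (thresholded_square w \<alpha>)"
  shows "with_extreme_probability
    (\<lambda>n. sample_space n (sample_size n))
    (\<lambda>n (U, U', d).
      let out = estimation_output n \<alpha> (sample_size n) (running_time n) (4 * ln (real n) ^ 4)
                  (graphon_graph w n U U') d
      in (\<exists>\<sigma>. out \<sigma>) \<and>
         (\<forall>\<sigma>. out \<sigma> \<longrightarrow>
            bij_betw \<sigma> {1..n} {1..n} \<and> error_less n U (sqrt (real n) * ln (real n) ^ 5) \<sigma>))"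
proof -
  interpret good_graphon w \<alpha> \<epsilon> A
    using assms by unfold_locales
  \<comment> \<open>Halving the exponent absorbs the factor 3. With \<open>L = ln n\<close>,
    \<open>exp (- (L^2 / 2)) = n powr (- L / 2)\<close>, hence the constants
    \<open>c1 = 1 / 2\<close> and \<open>c2 = 1\<close>.\<close>
  have "\<forall>\<^sub>F n::nat in sequentially. 3 * exp (- (ln (real n) ^ 2)) \<le> exp (- (ln (real n) ^ 2 / 2))" by real_asymp
  moreover have "\<forall>\<^sub>F n::nat in sequentially. 2 \<le> n" by (rule eventually_ge_at_top)
  ultimately have "\<forall>\<^sub>F n::nat in sequentially. 3 * exp (- (ln (real n) ^ 2)) \<le> real n powr (- (1 / 2) * ln (real n) powr 1)"
    by eventually_elim (simp add: powr_def power2_eq_square)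
  then have "\<forall>\<^sub>F n in sequentially. 1 - real n powr (- (1 / 2) * ln (real n) powr 1) \<le>
      measure (sample_space n (sample_size n)) {\<omega>\<in>space (sample_space n (sample_size n)). case \<omega> of (U, U', d) \<Rightarrow>
        correct_outputs n \<alpha> (sample_size n) (running_time n) (4 * ln (real n) ^ 4) (sqrt (real n) * ln (real n) ^ 5) (graphon_graph w n U U') U d}"
    using eventually_sample_space_prob by eventually_elim linarith
  then obtain N0 where N0: "\<forall>n\<ge>N0. 1 - real n powr (- (1 / 2) * ln (real n) powr 1) \<le>
      measure (sample_space n (sample_size n)) {\<omega>\<in>space (sample_space n (sample_size n)). case \<omega> of (U, U', d) \<Rightarrow>
        correct_outputs n \<alpha> (sample_size n) (running_time n) (4 * ln (real n) ^ 4) (sqrt (real n) * ln (real n) ^ 5) (graphon_graph w n U U') U d}"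
    unfolding eventually_sequentially by blast
  show ?thesis
    unfolding with_extreme_probability_def Let_def correct_outputs_def[symmetric]
    by (rule exI[of _ "1 / 2 :: real"], rule conjI[OF _ exI[of _ "1 :: real"]], simp,
        rule conjI[OF _ exI[of _ N0]], simp) (use N0 less_imp_le in blast)
qed

end
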